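(* Let $f$ be a minimal nilpotent element of a simple Lie algebra $\mathfrak g$, let $s=e$, and let $\mathcal W$ be the associated classical $\mathcal W$-algebra with its $\lambda$-bracket $\{\cdot_\lambda\cdot\}_{z,\rho}$. Let $L$, $\varphi(a)$ ($a\in\mathfrak g_0^f$), $\psi(u)$ ($u\in\mathfrak g_{-1/2}$) be its generators as given in the context. Then for all $a,b\in\mathfrak g_0^f$ and $u,u_1\in\mathfrak g_{-\frac12}$: $$\{L_\lambda L\}_{z,\rho}=(\partial+2\lambda)L-(x|x)\lambda^3+4(x|x)z\lambda,$$ $$\{L_\lambda\varphi(b)\}_{z,\rho}=(\partial+\lambda)\varphi(b),\qquad \{\varphi(a)_\lambda L\}_{z,\rho}=\lambda\varphi(a),$$ $$\{L_\lambda\psi(u_1)\}_{z,\rho}=\big(\partial+\tfrac32\lambda\big)\psi(u_1),\qquad \{\psi(u)_\lambda L\}_{z,\rho}=\big(\tfrac12\partial+\tfrac32\lambda\big)\psi(u),$$ $$\{\varphi(a)_\lambda\varphi(b)\}_{z,\rho}=\varphi([a,b])+(a|b)\lambda,$$ $$\{\varphi(a)_\lambda\psi(u_1)\}_{z,\rho}=\psi([a,u_1]),\qquad \{\psi(u)_\lambda\varphi(b)\}_{z,\rho}=\psi([u,b]),$$ and $$\{\psi(u)_\lambda\psi(u_1)\}_{z,\rho}=\sum_{k\in J_{1/2}}\varphi([u,v^k]^\sharp)\varphi([u_1,v_k]^\sharp)+(\partial+2\lambda)\varphi([u,[e,u_1]]^\sharp)+\frac{\omega_-(u,u_1)}{2(x|x)}\tilde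 L-\lambda^2\omega_-(u,u_1)+z\,\omega_-(u,u_1).$$ In particular, $L$ is an energy momentum element for all $z\in\mathbb F$, $\varphi(a)$ is a primary element of conformal weight $1$ for every $a\in\mathfrak g_0^f$, and $\psi(u)$ is a primary element of conformal weight $\frac32$ for every $u\in\mathfrak g_{-\frac12}$.
   Context: The base field $\mathbb F$ is algebraically closed of characteristic $0$. $\mathfrak g$ carries a non-degenerate symmetric invariant bilinear form $(\cdot|\cdot)$. $\{f,2x,e\}$ is an $\mathfrak{sl}_2$-triple: $[e,f]=2x$, $[x,e]=e$, $[x,f]=-f$; $\mathfrak g_i$ is the $\mathrm{ad}\,x$-eigenspace of eigenvalue $i$. $f$ is minimal if $\mathfrak g=\mathbb Ff\oplus\mathfrak g_{-1/2}\oplus\mathfrak g_0\oplus\mathfrak g_{1/2}\oplus\mathbb Fe$ (equivalently $f$ is a lowest root vector). $\mathfrak g_0^f$ is the centralizer of $f$ in $\mathfrak g_0$; one has the orthogonal decomposition $\mathfrak g_0=\mathfrak g_0^f\oplus\mathbb Fx$, and $a\mapsto a^\sharp$ denotes the projection $\mathfrak g_0\to\mathfrak g_0^f$, i.e. $a=a^\sharp+\frac{(a|x)}{(x|x)}x$. $\omega_-(u,u_1)=(e|[u,u_1])$ for $u,u_1\in\mathfrak g_{-1/2}$. Bases: $\{a_j\}_{j\in J_0},\{a^j\}_{j\in J_0}$ dual bases of $\mathfrak g_0$ and $\{a_i\}_{i\in J_0^f},\{a^i\}_{i\in J_0^f}$ dual bases of $\mathfrak g_0^f$ with respect to $(\cdot|\cdot)$;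 $\{v_k\}_{k\in J_{1/2}},\{v^k\}_{k\in J_{1/2}}$ bases of $\mathfrak g_{1/2}$ with $(f|[v_h,v^k])=\delta_{h,k}$. Classical $\mathcal W$-algebra: $\mathcal V(\mathfrak g)=S(\mathbb F[\partial]\mathfrak g)$ is the algebra of differential polynomials over $\mathfrak g$, with the Poisson vertex algebra (PVA) $\lambda$-bracket determined by $\{a_\lambda b\}_z=[a,b]+(a|b)\lambda+z(s|[a,b])$, $a,b\in\mathfrak g$ ($z\in\mathbb F$ or a formal variable), extended by sesquilinearity ($\{\partial g_\lambda h\}=-\lambda\{g_\lambda h\}$, $\{g_\lambda\partial h\}=(\partial+\lambda)\{g_\lambda h\}$) and the Leibniz rules ($\{g_\lambda h_1h_2\}=\{g_\lambda h_1\}h_2+\{g_\lambda h_2\}h_1$, $\{g_1g_{2\,\lambda}h\}=\{g_{1\,\lambda+\partial}h\}_\to g_2+\{g_{2\,\lambda+\partial}h\}_\to g_1$, the arrow meaning that $\partial$ acts on the right). $\rho:\mathcal V(\mathfrak g)\to\mathcal V(\mathfrak g_{\le\frac12})=S(\mathbb F[\partial]\mathfrak g_{\le\frac12})$ is the differential algebra homomorphism with $\rho(a)=\pi_{\le\frac12}(a)+(f|a)$, $a\in\mathfrak g$, where $\pi_{\le\frac12}:\mathfrak g\to\mathfrak g_{\le\frac12}$ is the projection with kernel $\mathfrak g_{\ge1}$. $\mathcal W=\{g\in\mathcal V(\mathfrak g_{\le\frac12})\mid\rho\{a_\lambda g\}_z=0\ \forall a\in\mathfrak g_{\ge\frac12}\}$,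 a PVA with $\lambda$-bracket $\{g_\lambda h\}_{z,\rho}=\rho\{g_\lambda h\}_z$. Generators of $\mathcal W$ ($'=\partial$): $L=f+x'+\frac12\sum_{j\in J_0}a_ja^j+\sum_{k\in J_{1/2}}v^k[f,v_k]+\frac12\sum_{k\in J_{1/2}}v^k\partial v_k$; $\varphi(a)=a+\frac12\sum_{k\in J_{1/2}}[a,v_k]v^k$ for $a\in\mathfrak g_0^f$; $\psi(u)=u+\frac13\sum_{h,k\in J_{1/2}}[[u,v_h],v_k]v^hv^k+\sum_{k\in J_{1/2}}[u,v_k]v^k+\partial[e,u]$ for $u\in\mathfrak g_{-1/2}$. Also $\tilde L=L-\frac12\sum_{i\in J_0^f}\varphi(a_i)\varphi(a^i)$. An element $L$ of a PVA is a Virasoro element if $\{L_\lambda L\}=(\partial+2\lambda)L+c\lambda^3+\alpha\lambda$ with $c,\alpha\in\mathbb F$. An element $a$ is an $L$-eigenvector of conformal weight $\Delta_a$ if $\{L_\lambda a\}=(\partial+\Delta_a\lambda)a+O(\lambda^2)$, and primary if $\{L_\lambda a\}=(\partial+\Delta_a\lambda)a$. A Virasoro element is an energy momentum element if the PVA has a basis of $L$-eigenvectors. *)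

theory Defs
  imports
    "HOL-Computational_Algebra.Polynomial"
    "HOL-Library.Poly_Mapping"
begin

section \<open>Differential polynomials\<close>

text \<open>
  The algebra of differential polynomials over a finite-dimensional space with basis
  \<open>u\<^sub>i\<close>, \<open>i \<in> 'i\<close>: the polynomial algebra over \<open>'a\<close> in the variables
  \<open>u\<^sub>i\<^sup>(\<^sup>n\<^sup>) = \<partial>\<^sup>n u\<^sub>i\<close>, encoded as pairs \<open>(i, n)\<close>.  A choice of basis identifies
  \<open>S(F[\<partial>]\<gg>)\<close> with this algebra.
\<close>

type_synonym ('a, 'i) dpoly = "(('i \<times> nat) \<Rightarrow>\<^sub>0 nat) \<Rightarrow>\<^sub>0 'a"

definition Cst :: "'a \<Rightarrow> ('a::comm_ring_1, 'i) dpoly" where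
  "Cst c = Poly_Mapping.single 0 c"

definition dvar :: "'i \<Rightarrow> nat \<Rightarrow> ('a::comm_ring_1, 'i) dpoly" where
  "dvar i n = Poly_Mapping.single (Poly_Mapping.single (i, n) 1) 1"

text \<open>
  The derivation with \<open>\<partial> u\<^sub>i\<^sup>(\<^sup>n\<^sup>) = u\<^sub>i\<^sup>(\<^sup>n\<^sup>+\<^sup>1\<^sup>)\<close>.  For every monomial \<open>m\<close> and every variable
  \<open>w\<close> of \<open>m\<close>, one factor \<open>w\<close> is replaced by its derivative.
\<close>

definition D :: "('a::comm_ring_1, 'i) dpoly \<Rightarrow> ('a, 'i) dpoly" where
  "D p = (\<Sum>m\<in>Poly_Mapping.keys p. \<Sum>w\<in>Poly_Mapping.keys m.
     Poly_Mapping.single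
       (m - Poly_Mapping.single w 1 + Poly_Mapping.single (fst w, Suc (snd w)) 1)
       (of_nat (Poly_Mapping.lookup m w) * Poly_Mapping.lookup p m))"

definition dsubst ::
  "('i \<times> nat \<Rightarrow> ('a::comm_ring_1, 'i) dpoly) \<Rightarrow> ('a, 'i) dpoly \<Rightarrow> ('a, 'i) dpoly" where
  "dsubst h p = (\<Sum>m\<in>Poly_Mapping.keys p.
     Cst (Poly_Mapping.lookup p m) * (\<Prod>w\<in>Poly_Mapping.keys m. h w ^ Poly_Mapping.lookup m w))"

interpretation dpoly: vector_space "\<lambda>(c::'a::field) (p::('a, 'i) dpoly). Cst c * p"
proof -
  have add: "Cst (c + d) = Cst c + (Cst d :: ('a, 'i) dpoly)" for c d :: 'a
    by (simp add: Cst_def single_add)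
  have mult: "Cst (c * d) = Cst c * (Cst d :: ('a, 'i) dpoly)" for c d :: 'a
    by (simp add: Cst_def mult_single)
  have one: "Cst 1 = (1 :: ('a, 'i) dpoly)"
    by (simp add: Cst_def)
  show "vector_space (\<lambda>(c::'a) (p::('a, 'i) dpoly). Cst c * p)"
    by unfold_locales (simp_all add: add mult one algebra_simps)
qed

section \<open>\<open>\<lambda>\<close>-brackets\<close>

text \<open>
  An element of \<open>\<V>[\<lambda>]\<close> is a polynomial with coefficients in \<open>\<V>\<close>; its indeterminate is \<open>\<lambda>\<close>.
\<close>

definition lamD :: "('a::comm_ring_1, 'i) dpoly poly \<Rightarrow> ('a, 'i) dpoly poly" where
  "lamD P = map_poly D P + pCons 0 P"

text \<open>The operator \<open>(s \<partial> + t \<lambda>)\<close> applied to an element of \<open>\<V>\<close>.\<close>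

definition DL :: "'a \<Rightarrow> 'a \<Rightarrow> ('a::comm_ring_1, 'i) dpoly \<Rightarrow> ('a, 'i) dpoly poly" where
  "DL s t g = [: Cst s * D g, Cst t * g :]"

text \<open>
  For \<open>P = {g\<^sub>\<lambda> h} = \<Sum>\<^sub>n \<lambda>\<^sup>n P\<^sub>n\<close>, this is
  \<open>{g\<^sub>\<lambda>\<^sub>+\<^sub>\<partial> h}\<^sub>\<rightarrow> k = \<Sum>\<^sub>n P\<^sub>n (\<lambda> + \<partial>)\<^sup>n k\<close>.
\<close>

definition arrow :: "('a::comm_ring_1, 'i) dpoly poly \<Rightarrow> ('a, 'i) dpoly \<Rightarrow> ('a, 'i) dpoly poly" where
  "arrow P k = (\<Sum>n\<le>degree P. smult (coeff P n) ((lamD ^^ n) [:k:]))"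

definition is_lambda_bracket ::
  "(('a::comm_ring_1, 'i) dpoly \<Rightarrow> ('a, 'i) dpoly \<Rightarrow> ('a, 'i) dpoly poly) \<Rightarrow> bool" where
  "is_lambda_bracket B \<longleftrightarrow>
     (\<forall>g g' h. B (g + g') h = B g h + B g' h) \<and>
     (\<forall>g h h'. B g (h + h') = B g h + B g h') \<and>
     (\<forall>c g h. B (Cst c * g) h = smult (Cst c) (B g h)) \<and>
     (\<forall>c g h. B g (Cst c * h) = smult (Cst c) (B g h)) \<and>
     (\<forall>g h. B (D g) h = - pCons 0 (B g h)) \<and>
     (\<forall>g h. B g (D h) = lamD (B g h)) \<and>
     (\<forall>g h1 h2. B g (h1 * h2) = smult h2 (B g h1) + smult h1 (B g h2)) \<and>
     (\<forall>g1 g2 h. B (g1 * g2) h = arrow (B g1 h) g2 + arrow (B g2 h) g1)"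

subsection \<open>Virasoro, primary and energy momentum elements\<close>

text \<open>
  \<open>V\<close> is the underlying subspace of a Poisson vertex algebra with derivation \<open>D\<close> and
  \<open>\<lambda>\<close>-bracket \<open>B\<close>.
\<close>

definition virasoro_element ::
  "('a::field, 'i) dpoly set \<Rightarrow> (('a, 'i) dpoly \<Rightarrow> ('a, 'i) dpoly \<Rightarrow> ('a, 'i) dpoly poly)
    \<Rightarrow> ('a, 'i) dpoly \<Rightarrow> bool" where
  "virasoro_element V B L \<longleftrightarrow> L \<in> V \<and>
     (\<exists>c \<alpha>. B L L = DL 1 2 L + monom (Cst c) 3 + monom (Cst \<alpha>) 1)"

definition eigenvector_of_weight ::
  "('a::field, 'i) dpoly set \<Rightarrow> (('a, 'i) dpoly \<Rightarrow> ('a, 'i) dpoly \<Rightarrow> ('a, 'i) dpoly poly)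
    \<Rightarrow> ('a, 'i) dpoly \<Rightarrow> 'a \<Rightarrow> ('a, 'i) dpoly \<Rightarrow> bool" where
  "eigenvector_of_weight V B L \<Delta> g \<longleftrightarrow> g \<in> V \<and>
     (\<exists>R. B L g = DL 1 \<Delta> g + monom 1 2 * R)"

definition primary_of_weight ::
  "('a::field, 'i) dpoly set \<Rightarrow> (('a, 'i) dpoly \<Rightarrow> ('a, 'i) dpoly \<Rightarrow> ('a, 'i) dpoly poly)
    \<Rightarrow> ('a, 'i) dpoly \<Rightarrow> 'a \<Rightarrow> ('a, 'i) dpoly \<Rightarrow> bool" where
  "primary_of_weight V B L \<Delta> g \<longleftrightarrow> g \<in> V \<and> B L g = DL 1 \<Delta> g"

definition energy_momentum_element ::
  "('a::field, 'i) dpoly set \<Rightarrow> (('a, 'i) dpoly \<Rightarrow> ('a, 'i) dpoly \<Rightarrow> ('a, 'i) dpoly poly)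
    \<Rightarrow> ('a, 'i) dpoly \<Rightarrow> bool" where
  "energy_momentum_element V B L \<longleftrightarrow> virasoro_element V B L \<and>
     (\<exists>S. dpoly.independent S \<and> dpoly.span S = V \<and>
          (\<forall>g\<in>S. \<exists>\<Delta>. eigenvector_of_weight V B L \<Delta> g))"

section \<open>Lie algebras\<close>

locale lie_algebra = vector_space scl
  for scl :: "'a::{alg_closed_field, field_char_0} \<Rightarrow> 'g::ab_group_add \<Rightarrow> 'g" +
  fixes br :: "'g \<Rightarrow> 'g \<Rightarrow> 'g"
  assumes br_add_left: "br (a + a') b = br a b + br a' b"
    and br_add_right: "br a (b + b') = br a b + br a b'"
    and br_scl_left: "br (scl c a) b = scl c (br a b)"
    and br_scl_right: "br a (scl c b) = scl c (br a b)"
    and br_self: "br a a = 0"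
    and jacobi: "br a (br b d) + br b (br d a) + br d (br a b) = 0"
begin

definition family_basis :: "'c set \<Rightarrow> ('c \<Rightarrow> 'g) \<Rightarrow> 'g set \<Rightarrow> bool" where
  "family_basis J w U \<longleftrightarrow> finite J \<and> inj_on w J \<and> independent (w ` J) \<and> span (w ` J) = U"

definition dual_bases ::
  "('g \<Rightarrow> 'g \<Rightarrow> 'a) \<Rightarrow> 'g set \<Rightarrow> 'c set \<Rightarrow> ('c \<Rightarrow> 'g) \<Rightarrow> ('c \<Rightarrow> 'g) \<Rightarrow> bool" where
  "dual_bases F U J w w' \<longleftrightarrow> family_basis J w U \<and> family_basis J w' U \<and>
     (\<forall>h\<in>J. \<forall>k\<in>J. F (w h) (w' k) = (if h = k then 1 else 0))"

definition lie_ideal :: "'g set \<Rightarrow> bool" where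
  "lie_ideal I \<longleftrightarrow> subspace I \<and> (\<forall>a. \<forall>y\<in>I. br a y \<in> I)"

definition simple :: bool where
  "simple \<longleftrightarrow> (\<exists>a b. br a b \<noteq> 0) \<and> (\<forall>I. lie_ideal I \<longrightarrow> I = {0} \<or> I = UNIV)"

text \<open>The eigenspace \<open>\<gg>\<^sub>i\<close> of \<open>ad x\<close>.\<close>

definition gr :: "'g \<Rightarrow> 'a \<Rightarrow> 'g set" where
  "gr x i = {a. br x a = scl i a}"

text \<open>
  \<open>gr_le x m = \<Oplus>\<^sub>k\<^sub>\<le>\<^sub>m \<gg>\<^sub>k\<^sub>/\<^sub>2\<close> and \<open>gr_ge x m = \<Oplus>\<^sub>k\<^sub>\<ge>\<^sub>m \<gg>\<^sub>k\<^sub>/\<^sub>2\<close>: the bound \<open>m\<close> counts half units, so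
  that \<open>\<gg>\<^sub>\<le>\<^sub>1\<^sub>/\<^sub>2\<close> is \<open>gr_le x 1\<close> and \<open>\<gg>\<^sub>\<ge>\<^sub>1\<close> is \<open>gr_ge x 2\<close>.
\<close>

definition gr_le :: "'g \<Rightarrow> int \<Rightarrow> 'g set" where
  "gr_le x m = span (\<Union>k\<in>{..m}. gr x (of_int k / 2))"

definition gr_ge :: "'g \<Rightarrow> int \<Rightarrow> 'g set" where
  "gr_ge x m = span (\<Union>k\<in>{m..}. gr x (of_int k / 2))"

definition proj_le_half :: "'g \<Rightarrow> 'g \<Rightarrow> 'g" where
  "proj_le_half x a = (THE p. p \<in> gr_le x 1 \<and> a - p \<in> gr_ge x 2)"

end

text \<open>
  A finite-dimensional simple Lie algebra with a non-degenerate symmetric invariant bilinear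
  form.  The basis \<open>bas\<close> is arbitrary; it serves to present \<open>\<V>(\<gg>)\<close> as \<^typ>\<open>('a, 'i) dpoly\<close>.
\<close>

locale simple_lie_algebra_with_form = lie_algebra scl br
  for scl :: "'a::{alg_closed_field, field_char_0} \<Rightarrow> 'g::ab_group_add \<Rightarrow> 'g"
    and br :: "'g \<Rightarrow> 'g \<Rightarrow> 'g" +
  fixes frm :: "'g \<Rightarrow> 'g \<Rightarrow> 'a"
    and bas :: "'i::finite \<Rightarrow> 'g"
  assumes simple: "simple"
    and basis: "family_basis UNIV bas UNIV"
    and frm_add: "frm (a + a') b = frm a b + frm a' b"
    and frm_scl: "frm (scl c a) b = c * frm a b"
    and frm_sym: "frm a b = frm b a"
    and frm_invariant: "frm (br a b) d = frm a (br b d)"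
    and frm_nondegenerate: "(\<And>b. frm a b = 0) \<Longrightarrow> a = 0"
begin

definition emb :: "'g \<Rightarrow> ('a, 'i) dpoly" where
  "emb a = (\<Sum>i\<in>UNIV. Cst (representation (range bas) a (bas i)) * dvar i 0)"

text \<open>
  \<open>{a\<^sub>\<lambda> b}\<^sub>z = [a, b] + (a|b) \<lambda> + z (s|[a, b])\<close> on \<open>\<gg>\<close>, extended to \<open>\<V>(\<gg>)\<close> by sesquilinearity
  and the Leibniz rules.
\<close>

definition lambda_bracket ::
  "'g \<Rightarrow> 'a \<Rightarrow> ('a, 'i) dpoly \<Rightarrow> ('a, 'i) dpoly \<Rightarrow> ('a, 'i) dpoly poly" where
  "lambda_bracket s z = (THE B. is_lambda_bracket B \<and>
     (\<forall>a b. B (emb a) (emb b) =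
        [: emb (br a b) + Cst (z * frm s (br a b)), Cst (frm a b) :]))"

text \<open>The differential algebra \<open>\<V>(\<gg>\<^sub>\<le>\<^sub>1\<^sub>/\<^sub>2)\<close>, as a subalgebra of \<open>\<V>(\<gg>)\<close>.\<close>

inductive_set V_le_half :: "'g \<Rightarrow> ('a, 'i) dpoly set" for x where
  gen: "a \<in> gr_le x 1 \<Longrightarrow> (D ^^ n) (emb a) \<in> V_le_half x"
| cst: "Cst c \<in> V_le_half x"
| add: "g \<in> V_le_half x \<Longrightarrow> h \<in> V_le_half x \<Longrightarrow> g + h \<in> V_le_half x"
| mult: "g \<in> V_le_half x \<Longrightarrow> h \<in> V_le_half x \<Longrightarrow> g * h \<in> V_le_half x"

text \<open>The differential algebra homomorphism with \<open>\<rho>(a) = \<pi>\<^sub>\<le>\<^sub>1\<^sub>/\<^sub>2(a) + (f|a)\<close> for \<open>a \<in> \<gg>\<close>.\<close>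

definition rho :: "'g \<Rightarrow> 'g \<Rightarrow> ('a, 'i) dpoly \<Rightarrow> ('a, 'i) dpoly" where
  "rho x f = dsubst (\<lambda>(i, n).
     (D ^^ n) (emb (proj_le_half x (bas i)) + Cst (frm f (bas i))))"

definition W_bracket ::
  "'g \<Rightarrow> 'g \<Rightarrow> 'g \<Rightarrow> 'a \<Rightarrow> ('a, 'i) dpoly \<Rightarrow> ('a, 'i) dpoly \<Rightarrow> ('a, 'i) dpoly poly" where
  "W_bracket x f s z g h = map_poly (rho x f) (lambda_bracket s z g h)"

definition W_algebra :: "'g \<Rightarrow> 'g \<Rightarrow> 'g \<Rightarrow> 'a \<Rightarrow> ('a, 'i) dpoly set" where
  "W_algebra x f s z = {g \<in> V_le_half x. \<forall>a \<in> gr_ge x 1. W_bracket x f s z (emb a) g = 0}"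

end

text \<open>
  The unique decomposition is \<open>\<gg> = Ff \<oplus> \<gg>\<^sub>-\<^sub>1\<^sub>/\<^sub>2 \<oplus> \<gg>\<^sub>0 \<oplus> \<gg>\<^sub>1\<^sub>/\<^sub>2 \<oplus> Fe\<close>; uniqueness of the
  coefficients also forces \<open>e\<close> and \<open>f\<close> to be nonzero.
\<close>

locale minimal_nilpotent = simple_lie_algebra_with_form scl br frm bas
  for scl :: "'a::{alg_closed_field, field_char_0} \<Rightarrow> 'g::ab_group_add \<Rightarrow> 'g"
    and br :: "'g \<Rightarrow> 'g \<Rightarrow> 'g"
    and frm :: "'g \<Rightarrow> 'g \<Rightarrow> 'a"
    and bas :: "'i::finite \<Rightarrow> 'g" +
  fixes e x f :: 'g
  assumes br_e_f: "br e f = scl 2 x"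
    and br_x_e: "br x e = e"
    and br_x_f: "br x f = - f"
    and minimal: "\<And>a. \<exists>!(c, m, n, p, d).
      m \<in> gr x (- (1/2)) \<and> n \<in> gr x 0 \<and> p \<in> gr x (1/2) \<and>
      a = scl c f + m + n + p + scl d e"
begin

definition g0f :: "'g set" where
  "g0f = {a \<in> gr x 0. br a f = 0}"

text \<open>The projection \<open>\<gg>\<^sub>0 \<rightarrow> \<gg>\<^sub>0\<^sup>f\<close>.\<close>

definition sharp :: "'g \<Rightarrow> 'g" where
  "sharp a = a - scl (frm a x / frm x x) x"

definition omega :: "'g \<Rightarrow> 'g \<Rightarrow> 'a" where
  "omega u u1 = frm e (br u u1)"

text \<open>
  The generators \<open>L\<close>, \<open>\<phi>(y)\<close>, \<open>\<psi>(u)\<close> of the W-algebra and the element \<open>L\<close> with a tilde, for dual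
  bases \<open>a, a'\<close> of \<open>\<gg>\<^sub>0\<close>, \<open>c, c'\<close> of \<open>\<gg>\<^sub>0\<^sup>f\<close> and \<open>v, v'\<close> of \<open>\<gg>\<^sub>1\<^sub>/\<^sub>2\<close>, indexed by \<open>J\<close>, \<open>I\<close> and \<open>K\<close>.
  A prime marks an upper index.  The duality of \<open>v, v'\<close> is with respect to
  \<open>(u, w) \<mapsto> (f|[u, w])\<close>.
\<close>

definition L_gen ::
  "'j set \<Rightarrow> ('j \<Rightarrow> 'g) \<Rightarrow> ('j \<Rightarrow> 'g) \<Rightarrow> 'k set \<Rightarrow> ('k \<Rightarrow> 'g) \<Rightarrow> ('k \<Rightarrow> 'g) \<Rightarrow> ('a, 'i) dpoly"
  where
  "L_gen J a a' K v v' = emb f + D (emb x)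
     + Cst (1/2) * (\<Sum>j\<in>J. emb (a j) * emb (a' j))
     + (\<Sum>k\<in>K. emb (v' k) * emb (br f (v k)))
     + Cst (1/2) * (\<Sum>k\<in>K. emb (v' k) * D (emb (v k)))"

definition phi_gen :: "'k set \<Rightarrow> ('k \<Rightarrow> 'g) \<Rightarrow> ('k \<Rightarrow> 'g) \<Rightarrow> 'g \<Rightarrow> ('a, 'i) dpoly" where
  "phi_gen K v v' y = emb y + Cst (1/2) * (\<Sum>k\<in>K. emb (br y (v k)) * emb (v' k))"

definition psi_gen :: "'k set \<Rightarrow> ('k \<Rightarrow> 'g) \<Rightarrow> ('k \<Rightarrow> 'g) \<Rightarrow> 'g \<Rightarrow> ('a, 'i) dpoly" where
  "psi_gen K v v' u = emb u
     + Cst (1/3) * (\<Sum>h\<in>K. \<Sum>k\<in>K. emb (br (br u (v h)) (v k)) * emb (v' h) * emb (v' k))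
     + (\<Sum>k\<in>K. emb (br u (v k)) * emb (v' k))
     + D (emb (br e u))"

definition Lt_gen ::
  "'j set \<Rightarrow> ('j \<Rightarrow> 'g) \<Rightarrow> ('j \<Rightarrow> 'g) \<Rightarrow> 'l set \<Rightarrow> ('l \<Rightarrow> 'g) \<Rightarrow> ('l \<Rightarrow> 'g)
    \<Rightarrow> 'k set \<Rightarrow> ('k \<Rightarrow> 'g) \<Rightarrow> ('k \<Rightarrow> 'g) \<Rightarrow> ('a, 'i) dpoly"
  where
  "Lt_gen J a a' I c c' K v v' = L_gen J a a' K v v'
     - Cst (1/2) * (\<Sum>i\<in>I. phi_gen K v v' (c i) * phi_gen K v v' (c' i))"

end

end

theory Submission
  imports Defs
begin

text \<open>
  Both \<open>L\<close> and the Sugawara type element \<open>\<Lambda> = 1/2 \<Sum> u\<^sub>n u\<^sup>n + x' + z e\<close> of \<open>\<V>(\<gg>)\<close> have the same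
  \<open>\<lambda>\<close>-bracket with every element of \<open>\<W>\<close>, because \<open>{w\<^sub>\<lambda> \<cdot>}\<close> vanishes there for \<open>w \<in> \<gg>\<^sub>\<ge>\<^sub>1\<^sub>/\<^sub>2\<close>.  On \<open>\<gg>\<close> the
  bracket with \<open>\<Lambda>\<close> is explicit, which gives the brackets with \<open>L\<close>.  Its \<open>\<lambda>\<close>-coefficient is a
  derivation that is diagonalizable on \<open>\<V>(\<gg>\<^sub>\<le>\<^sub>1\<^sub>/\<^sub>2)\<close> and preserves \<open>\<W>\<close>, hence \<open>\<W>\<close> has a basis of
  eigenvectors.

  For \<open>{\<psi>(u)\<^sub>\<lambda> \<psi>(u\<^sub>1)}\<close>, both sides are annihilated by the \<open>\<lambda>\<^sup>0\<close>-part of \<open>{w\<^sub>\<lambda> \<cdot>}\<close> for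
  \<open>w \<in> \<gg>\<^sub>1\<^sub>/\<^sub>2\<close>.  An element with this property whose monomials all contain an underived factor from
  \<open>\<gg>\<^sub>1\<^sub>/\<^sub>2\<close> is zero, so it suffices to compare the few terms without such a factor.
\<close>

section \<open>Differential polynomials\<close>

text \<open>The obstacle is direct expansion: L is quadratic, psi is cubic, and their brackets would
  need contractions in every pair of terms. Two features avoid this. \<open>W_bracket\<close> is
  defined on all of V(g), so its left argument may leave W and be traded for a Casimir element,
  where invariance of the form does the work; the summand z e is there to remove the terms z[b, e]
  that the z-part of the bracket produces. And the invariance of {psi_\<lambda> psi} rests on a
  Jacobi identity for the \<lambda>^0-part of {w_\<lambda> .}, a derivation commuting with
  \<partial>, so it can be checked on g. As the \<lambda>-bracket is a definite description, its
  existence and uniqueness have to be proved; uniqueness also yields skew-symmetry, which supplies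
  {phi_\<lambda> L}, {psi_\<lambda> L} and {psi_\<lambda> phi} from the opposite brackets.\<close>

lemma Cst_add: "Cst (c + d) = Cst c + Cst d"
  by (simp add: Cst_def single_add)

lemma Cst_mult: "Cst (c * d) = Cst c * Cst d"
  by (simp add: Cst_def mult_single)

lemma Cst_0 [simp]: "Cst 0 = 0"
  by (simp add: Cst_def)

lemma Cst_1 [simp]: "Cst 1 = 1"
  by (simp add: Cst_def)

lemma Cst_minus: "Cst (- c) = - Cst c"
  by (simp add: Cst_def single_uminus)

lemma Cst_diff: "Cst (c - d) = Cst c - Cst d"
  by (simp add: Cst_def single_diff)

lemma Cst_numeral: "Cst (numeral n) = numeral n"
  by (simp add: Cst_def)

text \<open>Adding a monomial without asking that \<open>m\<close> be new lets additivity of the map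
  in question close every induction step.\<close>

lemma poly_mapping_sum_induct [case_names zero single]:
  fixes p :: "'k \<Rightarrow>\<^sub>0 'b::comm_monoid_add"
  assumes "P 0" and "\<And>p m c. P p \<Longrightarrow> P (Poly_Mapping.single m c + p)"
  shows "P p"
proof (induction p rule: update_induct)
  case const
  show ?case by (rule assms(1))
next
  case (update p m c)
  have "Poly_Mapping.update m c p = Poly_Mapping.single m c + p"
    using update by (intro poly_mapping_eqI)
      (auto simp: lookup_update lookup_add lookup_single when_def in_keys_iff)
  then show ?case using assms(2) update by simp
qed

lemma dpoly_induct [case_names const dvar add mult]:
  fixes p :: "('a::comm_ring_1, 'i) dpoly"
  assumes const: "\<And>c. P (Cst c)" and dvar: "\<And>i n. P (dvar i n)"
    and add: "\<And>p q. P p \<Longrightarrow> P q \<Longrightarrow> P (p + q)"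
    and mult: "\<And>p q. P p \<Longrightarrow> P q \<Longrightarrow> P (p * q)"
  shows "P p"
proof -
  have pow: "P (Poly_Mapping.single (Poly_Mapping.single w k) 1)" for w :: "'i \<times> nat" and k
  proof (induction k)
    case 0
    then show ?case using const[of 1] by (simp add: Cst_def)
  next
    case (Suc k)
    have "Poly_Mapping.single (Poly_Mapping.single w (Suc k)) 1
        = (dvar (fst w) (snd w) :: ('a, 'i) dpoly) * Poly_Mapping.single (Poly_Mapping.single w k) 1"
      by (simp add: dvar_def mult_single single_add[symmetric])
    then show ?case using mult[OF dvar Suc] by simp
  qed
  have mon: "P (Poly_Mapping.single m 1)" for m :: "('i \<times> nat) \<Rightarrow>\<^sub>0 nat"
  proof (induction m rule: poly_mapping_sum_induct)
    case zero
    then show ?case using const[of 1] by (simp add: Cst_def)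
  next
    case (single m w k)
    then show ?case using mult[OF pow[of w k] single] by (simp add: mult_single)
  qed
  show ?thesis
  proof (induction p rule: poly_mapping_sum_induct)
    case zero
    then show ?case using const[of 0] by simp
  next
    case (single p m c)
    have "Poly_Mapping.single m c = Cst c * Poly_Mapping.single m 1"
      by (simp add: Cst_def mult_single)
    then show ?case using add[OF mult[OF const mon] single] by simp
  qed
qed

section \<open>Derivations of differential polynomials with values in a module\<close>

text \<open>Both Leibniz rules of a \<lambda>-bracket say that it is a derivation, but for different
  actions of V on V[\<lambda>]: multiplication of coefficients for the right argument,
  \<open>arrow\<close> for the left one. The locale serves these two and the derivation
  \<open>D\<close> itself.\<close>

locale dpoly_module = module F
  for F :: "('a::comm_ring_1, 'i) dpoly \<Rightarrow> 'm::ab_group_add \<Rightarrow> 'm"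
begin

definition mono_der where
  "mono_der t m c = (\<Sum>w\<in>Poly_Mapping.keys m.
     F (Poly_Mapping.single (m - Poly_Mapping.single w 1) (of_nat (Poly_Mapping.lookup m w) * c)) (t w))"

definition der :: "('i \<times> nat \<Rightarrow> 'm) \<Rightarrow> ('a, 'i) dpoly \<Rightarrow> 'm" where
  "der t p = (\<Sum>m\<in>Poly_Mapping.keys p. mono_der t m (Poly_Mapping.lookup p m))"

lemma mono_der_superset:
  assumes "finite S" "Poly_Mapping.keys m \<subseteq> S"
  shows "mono_der t m c = (\<Sum>w\<in>S.
     F (Poly_Mapping.single (m - Poly_Mapping.single w 1) (of_nat (Poly_Mapping.lookup m w) * c)) (t w))"
  unfolding mono_der_def using assms by (intro sum.mono_neutral_left) (auto simp: in_keys_iff)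

lemma mono_der_add: "mono_der t m (c + d) = mono_der t m c + mono_der t m d"
  by (simp add: mono_der_def algebra_simps single_add sum.distrib)

lemma mono_der_0 [simp]: "mono_der t m 0 = 0"
  by (simp add: mono_der_def)

lemma der_superset:
  assumes "finite S" "Poly_Mapping.keys p \<subseteq> S"
  shows "der t p = (\<Sum>m\<in>S. mono_der t m (Poly_Mapping.lookup p m))"
  unfolding der_def using assms by (intro sum.mono_neutral_left) (auto simp: in_keys_iff)

lemma der_add: "der t (p + q) = der t p + der t q"
proof -
  let ?S = "Poly_Mapping.keys p \<union> Poly_Mapping.keys q"
  have "der t (p + q) = (\<Sum>m\<in>?S. mono_der t m (Poly_Mapping.lookup (p + q) m))"
    by (rule der_superset) (simp_all add: keys_add)
  also have "\<dots> = (\<Sum>m\<in>?S. mono_der t m (Poly_Mapping.lookup p m))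
      + (\<Sum>m\<in>?S. mono_der t m (Poly_Mapping.lookup q m))"
    by (simp add: lookup_add mono_der_add sum.distrib)
  also have "\<dots> = der t p + der t q"
    by (simp add: der_superset[of ?S])
  finally show ?thesis .
qed

lemma der_single: "der t (Poly_Mapping.single m c) = mono_der t m c"
  by (simp add: der_def)

lemma der_zero [simp]: "der t 0 = 0"
  by (simp add: der_def)

lemma mono_der_mult:
  "mono_der t (m + n) (c * d) = F (Poly_Mapping.single m c) (mono_der t n d)
     + F (Poly_Mapping.single n d) (mono_der t m c)"
proof -
  let ?S = "Poly_Mapping.keys m \<union> Poly_Mapping.keys n"
  \<comment> \<open>Exponents are natural numbers with truncated subtraction, so \<open>w\<close>
    must occur in \<open>n\<close>; otherwise the factor \<open>of_nat 0\<close> removes the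
    term.\<close>
  have shift: "m + n - Poly_Mapping.single w 1 = m + (n - Poly_Mapping.single w 1)"
    if "Poly_Mapping.lookup n w \<noteq> 0" for m n :: "('i \<times> nat) \<Rightarrow>\<^sub>0 nat" and w
    using that by (intro poly_mapping_eqI) (auto simp: lookup_add lookup_minus lookup_single when_def)
  have mono: "Poly_Mapping.single (m + n - Poly_Mapping.single w 1) (of_nat (Poly_Mapping.lookup n w) * (c * d))
      = Poly_Mapping.single m c * Poly_Mapping.single (n - Poly_Mapping.single w 1) (of_nat (Poly_Mapping.lookup n w) * d)"
    for m n :: "('i \<times> nat) \<Rightarrow>\<^sub>0 nat" and c d :: 'a and w
    using shift[of n w m] by (cases "Poly_Mapping.lookup n w = 0") (simp_all add: mult_single algebra_simps)
  have "mono_der t (m + n) (c * d) = (\<Sum>w\<in>?S. F (Poly_Mapping.single (m + n - Poly_Mapping.single w 1)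
      (of_nat (Poly_Mapping.lookup (m + n) w) * (c * d))) (t w))"
    by (rule mono_der_superset) (simp_all add: keys_add)
  also have "\<dots> = (\<Sum>w\<in>?S. F (Poly_Mapping.single m c
        * Poly_Mapping.single (n - Poly_Mapping.single w 1) (of_nat (Poly_Mapping.lookup n w) * d)) (t w))
      + (\<Sum>w\<in>?S. F (Poly_Mapping.single n d
        * Poly_Mapping.single (m - Poly_Mapping.single w 1) (of_nat (Poly_Mapping.lookup m w) * c)) (t w))"
    unfolding mono[symmetric]
    by (simp add: lookup_add algebra_simps single_add sum.distrib)
  also have "\<dots> = F (Poly_Mapping.single m c) (mono_der t n d)
     + F (Poly_Mapping.single n d) (mono_der t m c)"
    by (simp add: mono_der_superset[of ?S] scale_sum_right)
  finally show ?thesis .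
qed

lemma der_mult: "der t (p * q) = F p (der t q) + F q (der t p)"
proof (induction p rule: poly_mapping_sum_induct)
  case (single p m c)
  have "der t (Poly_Mapping.single m c * q)
      = F (Poly_Mapping.single m c) (der t q) + F q (der t (Poly_Mapping.single m c))"
  proof (induction q rule: poly_mapping_sum_induct)
    case (single q n d)
    have "der t (Poly_Mapping.single m c * Poly_Mapping.single n d)
      = F (Poly_Mapping.single m c) (mono_der t n d) + F (Poly_Mapping.single n d) (mono_der t m c)"
      by (simp add: mult_single der_single mono_der_mult)
    with single show ?case by (simp add: distrib_left der_add der_single algebra_simps)
  qed simp
  with single show ?case by (simp add: distrib_right der_add algebra_simps)
qed simp

lemma der_Cst [simp]: "der t (Cst c) = 0"
  by (simp add: Cst_def der_single mono_der_def)

lemma der_dvar [simp]: "der t (dvar i n) = t (i, n)"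
  by (simp add: dvar_def der_single mono_der_def single_one)

lemma der_Cst_mult: "der t (Cst c * p) = F (Cst c) (der t p)"
  by (simp add: der_mult)

text \<open>The master formula nests two derivations: an operation on the inner one, in
  \<open>h\<close>, has to be pulled through the outer one, in \<open>g\<close>.\<close>

lemma der_target_linear:
  assumes "\<And>p q. T (p + q) = T p + T q" "\<And>p q. T (F p q) = F p (T q)"
  shows "T (der t p) = der (\<lambda>w. T (t w)) p"
proof -
  interpret T: additive T by standard (rule assms(1))
  show ?thesis by (simp add: der_def mono_der_def T.sum assms(2))
qed

end

interpretation times_module: dpoly_module "(*)"
  by standard (simp_all add: algebra_simps)

interpretation smult_module: dpoly_module smult
  by standard (simp_all add: smult_add_right smult_add_left)

text \<open>These instances of associativity loop together with \<open>mult.assoc\<close> and \<open>Cst_mult\<close>.\<close>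

declare times_module.scale_scale [simp del] dpoly.scale_scale [simp del]

section \<open>The derivation of the algebra of differential polynomials\<close>

lemma D_eq_der: "D = times_module.der (\<lambda>w. dvar (fst w) (Suc (snd w)))"
  by (rule ext) (simp add: D_def times_module.der_def times_module.mono_der_def dvar_def mult_single)

lemma D_add: "D (p + q) = D p + D q"
  by (simp add: D_eq_der times_module.der_add)

lemma D_mult: "D (p * q) = p * D q + q * D p"
  by (simp add: D_eq_der times_module.der_mult)

lemma D_Cst [simp]: "D (Cst c) = 0"
  by (simp add: D_eq_der)

lemma D_dvar [simp]: "D (dvar i n) = dvar i (Suc n)"
  by (simp add: D_eq_der)

interpretation D: additive D
  by standard (rule D_add)

lemma D_0 [simp]: "D 0 = 0" by (rule D.zero)

lemma D_1 [simp]: "D 1 = 0"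
  using D_Cst[of 1] by simp

lemma D_Cst_mult: "D (Cst c * p) = Cst c * D p"
  by (simp add: D_mult)

lemma dvar_D_power: "dvar i n = (D ^^ n) (dvar i 0)"
  by (induction n) (simp_all flip: D_dvar)

text \<open>Sesquilinearity in abstract form: \<open>T\<close> stands for \<lambda> + \<partial> on
  the right argument and for -\<lambda> on the left one, and it is enough that the values at
  successive derivatives of a variable differ by \<open>T\<close>.\<close>

lemma (in dpoly_module) der_D:
  assumes "\<And>Q Q'. T (Q + Q') = T Q + T Q'" "\<And>p Q. T (F p Q) = F (D p) Q + F p (T Q)"
    and "\<And>i n. T (t (i, n)) = t (i, Suc n)"
  shows "der t (D p) = T (der t p)"
proof -
  interpret T: additive T by standard (rule assms(1))
  show ?thesis
    by (induction p rule: dpoly_induct)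
      (simp_all add: assms T.zero der_add D_add D_mult der_mult algebra_simps)
qed

section \<open>Substitution homomorphisms\<close>

lemma dsubst_mono_superset:
  assumes "finite S" "Poly_Mapping.keys m \<subseteq> S"
  shows "(\<Prod>w\<in>Poly_Mapping.keys m. h w ^ Poly_Mapping.lookup m w) = (\<Prod>w\<in>S. h w ^ Poly_Mapping.lookup m w)"
  using assms by (intro prod.mono_neutral_left) (auto simp: in_keys_iff)

lemma dsubst_superset:
  assumes "finite S" "Poly_Mapping.keys p \<subseteq> S"
  shows "dsubst h p = (\<Sum>m\<in>S. Cst (Poly_Mapping.lookup p m)
     * (\<Prod>w\<in>Poly_Mapping.keys m. h w ^ Poly_Mapping.lookup m w))"
  unfolding dsubst_def using assms by (intro sum.mono_neutral_left) (auto simp: in_keys_iff)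

lemma dsubst_add: "dsubst h (p + q) = dsubst h p + dsubst h q"
proof -
  let ?S = "Poly_Mapping.keys p \<union> Poly_Mapping.keys q"
  have "dsubst h (p + q) = (\<Sum>m\<in>?S. Cst (Poly_Mapping.lookup (p + q) m)
      * (\<Prod>w\<in>Poly_Mapping.keys m. h w ^ Poly_Mapping.lookup m w))"
    by (rule dsubst_superset) (simp_all add: keys_add)
  then show ?thesis
    by (simp add: dsubst_superset[of ?S] lookup_add Cst_add sum.distrib algebra_simps)
qed

lemma dsubst_single: "dsubst h (Poly_Mapping.single m c)
    = Cst c * (\<Prod>w\<in>Poly_Mapping.keys m. h w ^ Poly_Mapping.lookup m w)"
  by (simp add: dsubst_def)

lemma dsubst_0 [simp]: "dsubst h 0 = 0"
  by (simp add: dsubst_def)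

lemma dsubst_mult_single: "dsubst h (Poly_Mapping.single m c * Poly_Mapping.single n d)
    = dsubst h (Poly_Mapping.single m c) * dsubst h (Poly_Mapping.single n d)"
proof -
  let ?S = "Poly_Mapping.keys m \<union> Poly_Mapping.keys n"
  have "(\<Prod>w\<in>Poly_Mapping.keys (m + n). h w ^ Poly_Mapping.lookup (m + n) w)
     = (\<Prod>w\<in>?S. h w ^ Poly_Mapping.lookup (m + n) w)"
    by (rule dsubst_mono_superset) (simp_all add: keys_add)
  also have "\<dots> = (\<Prod>w\<in>?S. h w ^ Poly_Mapping.lookup m w) * (\<Prod>w\<in>?S. h w ^ Poly_Mapping.lookup n w)"
    by (simp add: lookup_add power_add prod.distrib)
  also have "\<dots> = (\<Prod>w\<in>Poly_Mapping.keys m. h w ^ Poly_Mapping.lookup m w)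
      * (\<Prod>w\<in>Poly_Mapping.keys n. h w ^ Poly_Mapping.lookup n w)"
    by (intro arg_cong2[where f = "(*)"] dsubst_mono_superset[symmetric]) auto
  finally show ?thesis
    by (simp only: mult_single dsubst_single Cst_mult mult.assoc mult.left_commute)
qed

lemma dsubst_mult: "dsubst h (p * q) = dsubst h p * dsubst h q"
proof (induction p rule: poly_mapping_sum_induct)
  case (single p m c)
  have "dsubst h (Poly_Mapping.single m c * q) = dsubst h (Poly_Mapping.single m c) * dsubst h q"
    by (induction q rule: poly_mapping_sum_induct)
      (simp_all add: distrib_left dsubst_add dsubst_mult_single)
  with single show ?case by (simp add: distrib_right dsubst_add)
qed simp

lemma dsubst_Cst [simp]: "dsubst h (Cst c) = Cst c"
  by (simp add: Cst_def[of c] dsubst_single)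

lemma dsubst_dvar [simp]: "dsubst h (dvar i n) = h (i, n)"
  by (simp add: dvar_def dsubst_single)

lemma dsubst_D:
  assumes "\<And>i n. D (h (i, n)) = h (i, Suc n)"
  shows "dsubst h (D p) = D (dsubst h p)"
  by (induction p rule: dpoly_induct)
    (simp_all add: D_add D_mult dsubst_add dsubst_mult assms)

section \<open>Calculus of polynomials in \<open>\<lambda>\<close>\<close>

lemma lamD_pCons: "lamD (pCons p P) = pCons (D p) (lamD P + [:p:])"
  by (simp add: lamD_def map_poly_pCons)

lemma lamD_add: "lamD (P + Q) = lamD P + lamD Q"
proof -
  have "map_poly D (P + Q) = map_poly D P + map_poly D Q"
    by (rule poly_eqI) (simp add: coeff_map_poly D_add)
  then show ?thesis by (simp add: lamD_def algebra_simps)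
qed

interpretation lamD: additive lamD
  by standard (rule lamD_add)

lemma lamD_0 [simp]: "lamD 0 = 0" by (rule lamD.zero)

lemma lamD_pCons_0 [simp]: "lamD (pCons 0 P) = pCons 0 (lamD P)"
  by (simp add: lamD_def map_poly_pCons)

lemma lamD_const: "lamD [:p:] = [:D p, p:]"
  by (simp add: lamD_pCons)

lemma lamD_smult: "lamD (smult p P) = smult (D p) P + smult p (lamD P)"
proof -
  have "map_poly D (smult p P) = smult (D p) P + smult p (map_poly D P)"
    by (rule poly_eqI) (simp add: coeff_map_poly D_mult mult.commute add.commute)
  then show ?thesis by (simp add: lamD_def smult_add_right add.assoc)
qed

lemma lamD_smult_Cst: "lamD (smult (Cst c) P) = smult (Cst c) (lamD P)"
  by (simp add: lamD_smult)

lemma poly_induct_shift [case_names const add shift]: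
  fixes P :: "'a::comm_semiring_0 poly"
  assumes "\<And>p. R [:p:]" "\<And>P Q. R P \<Longrightarrow> R Q \<Longrightarrow> R (P + Q)" "\<And>P. R P \<Longrightarrow> R (pCons 0 P)"
  shows "R P"
proof (induction P)
  case 0
  then show ?case using assms(1)[of 0] by simp
next
  case (pCons p P)
  have "pCons p P = [:p:] + pCons 0 P" by simp
  then show ?case using assms(2)[OF assms(1)[of p] assms(3)[OF pCons.IH]] by simp
qed

lemma sum_pCons_0: "(\<Sum>n\<in>A. pCons 0 (G n)) = pCons 0 (\<Sum>n\<in>A. G n)"
  by (induct A rule: infinite_finite_induct) simp_all

lemma arrow_upto:
  assumes "degree P \<le> N"
  shows "arrow P k = (\<Sum>n\<le>N. smult (coeff P n) ((lamD ^^ n) [:k:]))"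
  unfolding arrow_def using assms
  by (intro sum.mono_neutral_left) (auto simp: coeff_eq_0)

lemma arrow_add_left: "arrow (P + Q) k = arrow P k + arrow Q k"
proof -
  let ?N = "max (degree P) (degree Q)"
  have "arrow (P + Q) k = (\<Sum>n\<le>?N. smult (coeff (P + Q) n) ((lamD ^^ n) [:k:]))"
    by (rule arrow_upto) (rule degree_add_le_max)
  then show ?thesis
    by (simp add: arrow_upto[of _ ?N] smult_add_left sum.distrib)
qed

lemma arrow_smult: "arrow (smult p P) k = smult p (arrow P k)"
proof -
  have "arrow (smult p P) k = (\<Sum>n\<le>degree P. smult (coeff (smult p P) n) ((lamD ^^ n) [:k:]))"
    by (rule arrow_upto) (rule degree_smult_le)
  then show ?thesis by (simp add: arrow_def smult_module.scale_sum_right)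
qed

interpretation arrow: additive "\<lambda>P. arrow P k" for k
  by standard (rule arrow_add_left)

lemma arrow_0_left [simp]: "arrow 0 k = 0" by (rule arrow.zero)

lemma lamD_power_add: "(lamD ^^ n) (P + Q) = (lamD ^^ n) P + (lamD ^^ n) Q"
  by (induction n) (simp_all add: lamD_add)

lemma lamD_power_pCons_0: "(lamD ^^ n) (pCons 0 P) = pCons 0 ((lamD ^^ n) P)"
  by (induction n) simp_all

lemma lamD_power_smult_Cst: "(lamD ^^ n) (smult (Cst c) P) = smult (Cst c) ((lamD ^^ n) P)"
  by (induction n) (simp_all add: lamD_smult_Cst)

lemma arrow_add_right: "arrow P (k + l) = arrow P k + arrow P l"
proof -
  have "[:k + l:] = [:k:] + [:l:]" by simp
  then show ?thesis
    by (simp only: arrow_def lamD_power_add smult_add_right sum.distrib)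
qed

lemma arrow_const [simp]: "arrow [:p:] k = [:p * k:]"
  by (simp add: arrow_def)

text \<open>One of the factors \<lambda> + \<partial> may be applied to \<open>k\<close> before the
  others. With \<open>arrow_const\<close> this recursion replaces the defining sum in the later
  inductions.\<close>

lemma arrow_shift: "arrow (pCons 0 P) k = arrow P (D k) + pCons 0 (arrow P k)"
proof -
  have split: "[:D k, k:] = [:D k:] + pCons 0 [:k:]" by simp
  have "arrow (pCons 0 P) k = (\<Sum>n\<le>Suc (degree P). smult (coeff (pCons 0 P) n) ((lamD ^^ n) [:k:]))"
    by (rule arrow_upto) (rule degree_pCons_le)
  also have "\<dots> = (\<Sum>n\<le>degree P. smult (coeff P n) ((lamD ^^ n) (lamD [:k:])))"
    by (subst sum.atMost_Suc_shift) (simp del: funpow.simps add: funpow_Suc_right)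
  also have "\<dots> = arrow P (D k) + (\<Sum>n\<le>degree P. pCons 0 (smult (coeff P n) ((lamD ^^ n) [:k:])))"
    unfolding lamD_const split lamD_power_add lamD_power_pCons_0
    by (simp add: smult_add_right sum.distrib arrow_def)
  also have "(\<Sum>n\<le>degree P. pCons 0 (smult (coeff P n) ((lamD ^^ n) [:k:]))) = pCons 0 (arrow P k)"
    by (simp add: arrow_def sum_pCons_0)
  finally show ?thesis .
qed

interpretation arrow_right: additive "arrow P" for P
  by standard (rule arrow_add_right)

lemma arrow_0_right [simp]: "arrow P 0 = 0" by (rule arrow_right.zero)

lemma arrow_1 [simp]: "arrow P 1 = P"
  by (induction P rule: poly_induct_shift) (simp_all add: arrow_add_left arrow_shift)

lemma arrow_lamD: "arrow (lamD P) k = lamD (arrow P k)"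
proof (induction P arbitrary: k rule: poly_induct_shift)
  case (const p)
  have "[:D p, p:] = [:D p:] + pCons 0 [:p:]" by simp
  then show ?case
    by (simp only: lamD_const arrow_add_left arrow_const arrow_shift) (simp add: lamD_const D_mult mult.commute)
qed (simp_all add: lamD_add arrow_add_left arrow_shift)

text \<open>In P(\<lambda> + \<partial>)g the second substitution adds the derivation acting on
  \<open>k\<close> to the one acting on \<open>g\<close>, and their sum is \<partial> on the
  product. Hence \<open>arrow\<close> is a module action of the commutative algebra V.\<close>

lemma arrow_arrow: "arrow (arrow P g) k = arrow P (g * k)"
proof (induction P arbitrary: g k rule: poly_induct_shift)
  case (shift P)
  have "arrow (arrow (pCons 0 P) g) k = arrow P (D g * k) + (arrow P (g * D k) + pCons 0 (arrow P (g * k)))"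
    by (simp only: arrow_shift arrow_add_left shift)
  then show ?case
    by (simp add: arrow_shift D_mult arrow_add_right mult.commute add_ac)
next
  case (const p)
  show ?case by (simp only: arrow_const mult.assoc)
next
  case (add P Q)
  show ?case by (simp only: arrow_add_left add)
qed

lemma arrow_Cst: "arrow P (Cst c * k) = smult (Cst c) (arrow P k)"
proof -
  have "[:Cst c * k:] = smult (Cst c) [:k:]" by simp
  then show ?thesis
    by (simp only: arrow_def lamD_power_smult_Cst smult_module.scale_sum_right) (simp add: mult.commute)
qed

interpretation arrow_module: dpoly_module "\<lambda>k P. arrow P k"
  by standard (simp_all add: arrow_add_left arrow_add_right arrow_arrow mult.commute)

text \<open>\<open>skew P\<close> is the result of substituting \<open>-\<lambda>-\<partial>\<close> for \<open>\<lambda>\<close>, with \<open>\<partial>\<close> acting on the coefficients.\<close>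

definition skew :: "('a::comm_ring_1, 'i) dpoly poly \<Rightarrow> ('a, 'i) dpoly poly" where
  "skew P = fold_coeffs (\<lambda>p Q. [:p:] - lamD Q) P 0"

lemma skew_pCons: "skew (pCons p P) = [:p:] - lamD (skew P)"
  by (cases "P = 0 \<and> p = 0") (auto simp: skew_def)

lemma skew_0 [simp]: "skew 0 = 0"
  by (simp add: skew_def)

lemma skew_const [simp]: "skew [:p:] = [:p:]"
  by (simp add: skew_pCons)

lemma skew_shift [simp]: "skew (pCons 0 P) = - lamD (skew P)"
  by (simp add: skew_pCons)

lemma skew_add: "skew (P + Q) = skew P + skew Q"
proof (induction P arbitrary: Q)
  case (pCons p P)
  obtain q Q' where Q: "Q = pCons q Q'" by (cases Q)
  have "[:p + q:] = [:p:] + [:q:]" by simp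
  with pCons Q show ?case by (simp add: skew_pCons lamD_add)
qed simp

interpretation skew: additive skew
  by standard (rule skew_add)

text \<open>Together with \<open>skew_lamD\<close> and \<open>skew_arrow\<close>:
  \<open>skew\<close> interchanges the two actions of V on V[\<lambda>], and \<lambda> + \<partial>
  with -\<lambda>.\<close>

lemma skew_smult: "skew (smult g P) = arrow (skew P) g"
proof (induction P rule: poly_induct_shift)
  case (const p)
  then show ?case by (simp add: mult.commute)
qed (simp_all add: smult_add_right skew_add arrow_add_left arrow_lamD arrow.minus)

lemma skew_lamD: "skew (lamD P) = - pCons 0 (skew P)"
proof (induction P rule: poly_induct_shift)
  case (const p)
  then show ?case by (simp add: lamD_const skew_pCons)
next
  case (shift P)
  then show ?case by (simp add: lamD.minus)
qed (simp_all add: lamD_add skew_add)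

lemma skew_arrow: "skew (arrow P k) = smult k (skew P)"
proof (induction P arbitrary: k rule: poly_induct_shift)
  case (shift P)
  then show ?case by (simp add: arrow_shift skew_add lamD_smult algebra_simps)
qed (simp_all add: arrow_add_left skew_add smult_add_right mult.commute)

section \<open>Existence and uniqueness of \<open>\<lambda>\<close>-brackets\<close>

lemma arrow_Cst_eq [simp]: "arrow P (Cst c) = smult (Cst c) P"
  using arrow_Cst[of P c 1] by simp

definition var_bracket ::
  "('i \<Rightarrow> 'i \<Rightarrow> ('a::comm_ring_1, 'i) dpoly poly) \<Rightarrow> 'i \<Rightarrow> ('a, 'i) dpoly \<Rightarrow> ('a, 'i) dpoly poly" where
  "var_bracket P i = smult_module.der (\<lambda>(j, n). (lamD ^^ n) (P i j))"

text \<open>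
  \<open>{g\<^sub>\<lambda> h} = \<Sum> \<partial>h/\<partial>u\<^sub>j\<^sup>(\<^sup>n\<^sup>) (\<lambda> + \<partial>)\<^sup>n {u\<^sub>i \<^sub>\<lambda>\<^sub>+\<^sub>\<partial> u\<^sub>j}\<^sub>\<rightarrow> (-\<lambda> - \<partial>)\<^sup>m \<partial>g/\<partial>u\<^sub>i\<^sup>(\<^sup>m\<^sup>)\<close>, read as a
  derivation in \<open>g\<close> with values in \<open>\<V>[\<lambda>]\<close>, on which \<open>k \<in> \<V>\<close> acts by \<open>Q \<mapsto> arrow Q k\<close>.
\<close>

definition master_bracket ::
  "('i \<Rightarrow> 'i \<Rightarrow> ('a::comm_ring_1, 'i) dpoly poly) \<Rightarrow> ('a, 'i) dpoly \<Rightarrow> ('a, 'i) dpoly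
    \<Rightarrow> ('a, 'i) dpoly poly" where
  "master_bracket P g h =
     arrow_module.der (\<lambda>(i, m). ((\<lambda>Q. pCons 0 (- Q)) ^^ m) (var_bracket P i h)) g"

lemma neg_pCons_add: "pCons 0 (- (P + Q)) = pCons 0 (- P) + pCons 0 (- Q :: 'a::ab_group_add poly)"
  by (rule poly_eqI) (simp add: coeff_pCons split: nat.split)

lemma neg_shift_add: "((\<lambda>Q. pCons 0 (- Q)) ^^ m) (P + Q)
    = ((\<lambda>Q. pCons 0 (- Q)) ^^ m) P + ((\<lambda>Q. pCons 0 (- Q)) ^^ m) (Q :: 'a::ab_group_add poly)"
  by (induction m) (simp_all only: funpow_0 funpow.simps(2) comp_apply neg_pCons_add)

lemma neg_shift_smult: "((\<lambda>Q. pCons 0 (- Q)) ^^ m) (smult p P)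
    = smult p (((\<lambda>Q. pCons 0 (- Q)) ^^ m) (P :: 'a::comm_ring_1 poly))"
  by (induction m) simp_all

lemma neg_shift_lamD: "((\<lambda>Q. pCons 0 (- Q)) ^^ m) (lamD P) = lamD (((\<lambda>Q. pCons 0 (- Q)) ^^ m) P)"
  by (induction m) (simp_all add: lamD.minus)

lemma der_target_add:
  "arrow_module.der (\<lambda>w. t w + s w) p = arrow_module.der t p + arrow_module.der s p"
  by (simp add: arrow_module.der_def arrow_module.mono_der_def arrow_add_left sum.distrib)

lemma der_target_smult:
  "arrow_module.der (\<lambda>w. smult q (t w)) p = smult q (arrow_module.der t p)"
  by (rule arrow_module.der_target_linear[symmetric]) (simp_all add: smult_add_right arrow_smult)

lemma der_target_lamD:
  "arrow_module.der (\<lambda>w. lamD (t w)) p = lamD (arrow_module.der t p)"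
  by (rule arrow_module.der_target_linear[symmetric]) (simp_all add: lamD_add arrow_lamD)

lemma is_lambda_bracket_master: "is_lambda_bracket (master_bracket P)"
proof -
  have var_D: "var_bracket P i (D h) = lamD (var_bracket P i h)" for i h
    unfolding var_bracket_def
    by (rule smult_module.der_D) (simp_all add: lamD_add lamD_smult)
  have var_Cst: "var_bracket P i (Cst c * h) = smult (Cst c) (var_bracket P i h)" for i c h
    by (simp add: var_bracket_def smult_module.der_Cst_mult)
  have D_left: "master_bracket P (D g) h = - pCons 0 (master_bracket P g h)" for g h
    unfolding master_bracket_def
    unfolding minus_pCons minus_zero
    by (rule arrow_module.der_D) (rule neg_pCons_add, simp_all add: arrow_shift arrow.minus)
  show ?thesis
    unfolding is_lambda_bracket_def
  proof (intro conjI allI)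
    fix g g' h h' c
    show "master_bracket P (g + g') h = master_bracket P g h + master_bracket P g' h"
      by (simp add: master_bracket_def arrow_module.der_add)
    show "master_bracket P g (h + h') = master_bracket P g h + master_bracket P g h'"
      by (simp add: master_bracket_def var_bracket_def smult_module.der_add neg_shift_add
          case_prod_unfold der_target_add)
    show "master_bracket P (Cst c * g) h = smult (Cst c) (master_bracket P g h)"
      by (simp add: master_bracket_def arrow_module.der_Cst_mult)
    show "master_bracket P g (Cst c * h) = smult (Cst c) (master_bracket P g h)"
      by (simp add: master_bracket_def var_Cst neg_shift_smult case_prod_unfold der_target_smult)
    show "master_bracket P (D g) h = - pCons 0 (master_bracket P g h)"
      by (rule D_left)
    show "master_bracket P g (D h) = lamD (master_bracket P g h)"
      by (simp add: master_bracket_def var_D neg_shift_lamD case_prod_unfold der_target_lamD)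
    show "master_bracket P g (h * h') = smult h' (master_bracket P g h) + smult h (master_bracket P g h')"
      by (simp add: master_bracket_def var_bracket_def smult_module.der_mult neg_shift_add neg_shift_smult
          case_prod_unfold der_target_add der_target_smult add.commute)
    show "master_bracket P (g * g') h = arrow (master_bracket P g h) g' + arrow (master_bracket P g' h) g"
      by (simp add: master_bracket_def arrow_module.der_mult add.commute)
  qed
qed

lemma master_bracket_dvar: "master_bracket P (dvar i 0) (dvar j 0) = P i j"
  by (simp add: master_bracket_def var_bracket_def)

section \<open>Uniqueness and skew-symmetry of \<lambda>-brackets\<close>

locale abstract_lambda_bracket =
  fixes B :: "('a::comm_ring_1, 'i) dpoly \<Rightarrow> ('a, 'i) dpoly \<Rightarrow> ('a, 'i) dpoly poly"
  assumes is_lambda_bracket: "is_lambda_bracket B"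
begin

lemmas add_left = is_lambda_bracket[unfolded is_lambda_bracket_def, THEN conjunct1, rule_format]
  and add_right = is_lambda_bracket[unfolded is_lambda_bracket_def, THEN conjunct2, THEN conjunct1, rule_format]
  and Cst_mult_left = is_lambda_bracket[unfolded is_lambda_bracket_def, THEN conjunct2, THEN conjunct2, THEN conjunct1, rule_format]
  and Cst_mult_right = is_lambda_bracket[unfolded is_lambda_bracket_def, THEN conjunct2, THEN conjunct2, THEN conjunct2, THEN conjunct1, rule_format]
  and D_left = is_lambda_bracket[unfolded is_lambda_bracket_def, THEN conjunct2, THEN conjunct2, THEN conjunct2, THEN conjunct2, THEN conjunct1, rule_format]
  and D_right = is_lambda_bracket[unfolded is_lambda_bracket_def, THEN conjunct2, THEN conjunct2, THEN conjunct2, THEN conjunct2, THEN conjunct2, THEN conjunct1, rule_format]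
  and mult_right = is_lambda_bracket[unfolded is_lambda_bracket_def, THEN conjunct2, THEN conjunct2, THEN conjunct2, THEN conjunct2, THEN conjunct2, THEN conjunct2, THEN conjunct1, rule_format]
  and mult_left = is_lambda_bracket[unfolded is_lambda_bracket_def, THEN conjunct2, THEN conjunct2, THEN conjunct2, THEN conjunct2, THEN conjunct2, THEN conjunct2, THEN conjunct2, rule_format]

sublocale left: additive "\<lambda>g. B g h" for h
  by standard (rule add_left)

sublocale right: additive "B g" for g
  by standard (rule add_right)

lemma Cst_right [simp]: "B g (Cst c) = 0"
proof -
  have "B g (1 * 1) = B g 1 + B g 1" by (simp only: mult_right smult_1_left)
  then have "B g 1 = 0" by simp
  then show ?thesis using Cst_mult_right[of g c 1] by simp
qed

lemma Cst_left [simp]: "B (Cst c) h = 0"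
proof -
  have "B (1 * 1) h = B 1 h + B 1 h" by (simp only: mult_left arrow_1)
  then have "B 1 h = 0" by simp
  then show ?thesis using Cst_mult_left[of c 1 h] by simp
qed

text \<open>Passing to \<open>-{h\<^sub>-\<^sub>\<lambda>\<^sub>-\<^sub>\<partial> g}\<close> exchanges the axioms of a \<open>\<lambda>\<close>-bracket in pairs.\<close>

lemma is_lambda_bracket_skew: "is_lambda_bracket (\<lambda>g h. - skew (B h g))"
  unfolding is_lambda_bracket_def
  by (intro conjI allI)
    (simp_all add: add_left add_right Cst_mult_left Cst_mult_right D_left D_right mult_left mult_right
      skew_add skew.minus skew_smult skew_lamD skew_arrow lamD.minus arrow.minus)

end

text \<open>Sesquilinearity extends agreement to derivatives of the variables and the Leibniz rules
  extend it to polynomials, first on the right, then on the left.\<close>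

lemma lambda_bracket_eqI:
  assumes "abstract_lambda_bracket B" "abstract_lambda_bracket B'"
    and gen: "\<And>i j. B (dvar i 0) (dvar j 0) = B' (dvar i 0) (dvar j 0)"
  shows "B = B'"
proof -
  interpret B: abstract_lambda_bracket B by fact
  interpret B': abstract_lambda_bracket B' by fact
  have right_D: "B (dvar i 0) ((D ^^ n) (dvar j 0)) = B' (dvar i 0) ((D ^^ n) (dvar j 0))" for i j n
    by (induction n) (simp_all add: gen B.D_right B'.D_right del: D_dvar)
  have right: "B (dvar i 0) h = B' (dvar i 0) h" for i h
  proof (induction h rule: dpoly_induct)
    case (dvar j n)
    show ?case using right_D[of i n j] by (simp only: dvar_D_power[of j n])
  qed (simp_all add: B.add_right B'.add_right B.mult_right B'.mult_right)
  have left_D: "B ((D ^^ n) (dvar i 0)) h = B' ((D ^^ n) (dvar i 0)) h" for i n h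
    by (induction n) (simp_all add: right B.D_left B'.D_left del: D_dvar)
  have "B g h = B' g h" for g h
  proof (induction g rule: dpoly_induct)
    case (dvar i n)
    show ?case using left_D[of n i h] by (simp only: dvar_D_power[of i n])
  qed (simp_all add: B.add_left B'.add_left B.mult_left B'.mult_left)
  then show ?thesis by blast
qed

lemma (in abstract_lambda_bracket) skew_symmetric:
  assumes "\<And>i j. B (dvar i 0) (dvar j 0) = - skew (B (dvar j 0) (dvar i 0))"
  shows "B g h = - skew (B h g)"
proof -
  have "abstract_lambda_bracket (\<lambda>g h. - skew (B h g))"
    by standard (rule is_lambda_bracket_skew)
  from lambda_bracket_eqI[OF abstract_lambda_bracket_axioms this assms] show ?thesis by metis
qed

section \<open>Simple Lie algebras with an invariant form\<close>

context lie_algebra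
begin

sublocale br_left: additive "\<lambda>a. br a b" for b
  by standard (rule br_add_left)

sublocale br_right: additive "br a" for a
  by standard (rule br_add_right)

lemma br_skew: "br b a = - br a b"
proof -
  have "br (a + b) (a + b) = br a a + br a b + (br b a + br b b)"
    by (simp only: br_add_left br_add_right add_ac)
  then show ?thesis by (simp add: br_self eq_neg_iff_add_eq_0 add.commute)
qed

lemma br_jacobi: "br a (br b d) = br (br a b) d + br b (br a d)"
proof -
  have "br a (br b d) = - br b (br d a) - br d (br a b)"
    using jacobi[of a b d] by (simp add: algebra_simps eq_neg_iff_add_eq_0)
  then show ?thesis using br_skew[of d "br a b"] br_skew[of a d] by (simp add: br_right.minus)
qed

end

context simple_lie_algebra_with_form
begin

sublocale frm_left: additive "\<lambda>a. frm a b" for b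
  by standard (rule frm_add)

lemma frm_add_right: "frm a (b + b') = frm a b + frm a b'"
  by (simp add: frm_sym[of a] frm_add)

sublocale frm_right: additive "frm a" for a
  by standard (rule frm_add_right)

lemma frm_scl_right: "frm a (scl c b) = c * frm a b"
  by (simp add: frm_sym[of a] frm_scl)

lemma independent_bas: "independent (range bas)" and span_bas: "span (range bas) = UNIV"
  and inj_bas: "inj bas"
  using basis by (auto simp: family_basis_def)

lemma emb_bas: "emb (bas i) = dvar i 0"
proof -
  have "emb (bas i) = (\<Sum>j\<in>UNIV. if i = j then dvar i 0 else 0)"
    unfolding emb_def using independent_bas inj_bas
    by (intro sum.cong) (auto simp: representation_basis inj_eq)
  then show ?thesis by simp
qed

lemma emb_add: "emb (a + b) = emb a + emb b"
  using independent_bas span_bas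
  by (simp add: emb_def representation_add Cst_add algebra_simps sum.distrib)

lemma emb_scl: "emb (scl c a) = Cst c * emb a"
  using independent_bas span_bas
  by (simp add: emb_def representation_scale Cst_mult sum_distrib_left mult.assoc)

sublocale emb: additive emb
  by standard (rule emb_add)

lemma bas_induct [case_names bas add scl]:
  assumes "\<And>i. P (bas i)" "\<And>a b. P a \<Longrightarrow> P b \<Longrightarrow> P (a + b)" "\<And>c a. P a \<Longrightarrow> P (scl c a)"
  shows "P a"
proof -
  have zero: "P 0" using assms(3)[OF assms(1), of 0] by simp
  have "a \<in> span (range bas)" by (simp add: span_bas)
  then show ?thesis
  proof (induction a rule: span_induct_alt)
    case (step c b y)
    then show ?case using assms by blast
  qed (rule zero)
qed

definition gen_bracket :: "'g \<Rightarrow> 'a \<Rightarrow> 'g \<Rightarrow> 'g \<Rightarrow> ('a, 'i) dpoly poly" where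
  "gen_bracket s z a b = [: emb (br a b) + Cst (z * frm s (br a b)), Cst (frm a b) :]"

lemma gen_bracket_add_left: "gen_bracket s z (a + a') b = gen_bracket s z a b + gen_bracket s z a' b"
  by (simp add: gen_bracket_def br_add_left emb_add frm_add frm_add_right Cst_add algebra_simps)

lemma gen_bracket_add_right: "gen_bracket s z a (b + b') = gen_bracket s z a b + gen_bracket s z a b'"
  by (simp add: gen_bracket_def br_add_right emb_add frm_add frm_add_right Cst_add algebra_simps)

lemma gen_bracket_scl_left: "gen_bracket s z (scl c a) b = smult (Cst c) (gen_bracket s z a b)"
  by (simp add: gen_bracket_def br_scl_left emb_scl frm_scl frm_scl_right Cst_mult algebra_simps)

lemma gen_bracket_scl_right: "gen_bracket s z a (scl c b) = smult (Cst c) (gen_bracket s z a b)"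
  by (simp add: gen_bracket_def br_scl_right emb_scl frm_scl frm_scl_right Cst_mult algebra_simps)

lemma lambda_bracket_emb_extend:
  assumes "abstract_lambda_bracket B" and "\<And>i j. B (emb (bas i)) (emb (bas j)) = gen_bracket s z (bas i) (bas j)"
  shows "B (emb a) (emb b) = gen_bracket s z a b"
proof -
  interpret abstract_lambda_bracket B by fact
  have "B (emb (bas i)) (emb b) = gen_bracket s z (bas i) b" for i
    by (induction b rule: bas_induct)
      (simp_all add: assms emb_add emb_scl add_right Cst_mult_right gen_bracket_add_right gen_bracket_scl_right)
  then show ?thesis
    by (induction a rule: bas_induct)
      (simp_all add: emb_add emb_scl add_left Cst_mult_left gen_bracket_add_left gen_bracket_scl_left)
qed

text \<open>\<open>lambda_bracket\<close> is a definite description; the master formula provides the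
  bracket and \<open>lambda_bracket_eqI\<close> its uniqueness. The formula knows only basis
  vectors, hence the extension by bilinearity.\<close>

lemma lambda_bracket_spec:
  "is_lambda_bracket (lambda_bracket s z)
   \<and> (\<forall>a b. lambda_bracket s z (emb a) (emb b) = gen_bracket s z a b)"
proof -
  let ?B = "master_bracket (\<lambda>i j. gen_bracket s z (bas i) (bas j))"
  have B: "abstract_lambda_bracket ?B"
    by standard (rule is_lambda_bracket_master)
  have "\<exists>!B. is_lambda_bracket B \<and> (\<forall>a b. B (emb a) (emb b) = gen_bracket s z a b)"
  proof (rule ex1I)
    have "?B (emb a) (emb b) = gen_bracket s z a b" for a b
      by (rule lambda_bracket_emb_extend[OF B]) (simp add: emb_bas master_bracket_dvar)
    then show "is_lambda_bracket ?B \<and> (\<forall>a b. ?B (emb a) (emb b) = gen_bracket s z a b)"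
      by (simp add: is_lambda_bracket_master)
  next
    fix B assume "is_lambda_bracket B \<and> (\<forall>a b. B (emb a) (emb b) = gen_bracket s z a b)"
    then have "abstract_lambda_bracket B" "B (dvar i 0) (dvar j 0) = gen_bracket s z (bas i) (bas j)" for i j
      by (auto simp: abstract_lambda_bracket.intro simp flip: emb_bas)
    then show "B = ?B"
      by (intro lambda_bracket_eqI[OF _ B]) (simp_all add: master_bracket_dvar)
  qed
  from theI'[OF this] show ?thesis
    unfolding lambda_bracket_def gen_bracket_def[symmetric] .
qed

end

section \<open>The grading of a minimal nilpotent element\<close>

lemma ex1_eq: "\<exists>!q. P q \<Longrightarrow> P a \<Longrightarrow> P b \<Longrightarrow> a = b"
  by blast

text \<open>The pairing \<open>F\<close> is kept abstract because it is applied both to the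
  symmetric form and to the skew form (f|[y, w]) on g_{1/2}; for the latter the order of the
  arguments in the two expansions matters.\<close>

lemma (in lie_algebra) dual_bases_expand:
  assumes dual: "dual_bases F U J w w'" and y: "y \<in> U"
    and add_left: "\<And>a b d. F (a + b) d = F a d + F b d" and scl_left: "\<And>c a d. F (scl c a) d = c * F a d"
    and add_right: "\<And>a b d. F d (a + b) = F d a + F d b" and scl_right: "\<And>c a d. F d (scl c a) = c * F d a"
  shows "(\<Sum>k\<in>J. scl (F (w k) y) (w' k)) = y" and "(\<Sum>k\<in>J. scl (F y (w' k)) (w k)) = y"
proof -
  have fin: "finite J" and span: "span (w ` J) = U" "span (w' ` J) = U"
    and delta: "\<And>h k. h \<in> J \<Longrightarrow> k \<in> J \<Longrightarrow> F (w h) (w' k) = (if h = k then 1 else 0)"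
    using dual by (auto simp: dual_bases_def family_basis_def)
  have zero: "F d 0 = 0" "F 0 d = 0" for d
    using scl_right[of d 0 0] scl_left[of 0 0 d] by simp_all
  have "y \<in> span (w' ` J)" using y span by simp
  then show "(\<Sum>k\<in>J. scl (F (w k) y) (w' k)) = y"
  proof (induction y rule: span_induct_alt)
    case base
    then show ?case by (simp add: zero)
  next
    case (step d b y)
    then obtain j where j: "j \<in> J" "b = w' j" by blast
    have "(\<Sum>k\<in>J. scl (F (w k) b) (w' k)) = (\<Sum>k\<in>J. if k = j then w' j else 0)"
      by (rule sum.cong) (auto simp: j delta)
    then have "(\<Sum>k\<in>J. scl (F (w k) b) (w' k)) = b" using j fin by simp
    then have "scl d (\<Sum>k\<in>J. scl (F (w k) b) (w' k)) = scl d b" by simp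
    then show ?case using step
      by (simp add: add_right scl_right scale_left_distrib sum.distrib scale_sum_right)
  qed
  have "y \<in> span (w ` J)" using y span by simp
  then show "(\<Sum>k\<in>J. scl (F y (w' k)) (w k)) = y"
  proof (induction y rule: span_induct_alt)
    case base
    then show ?case by (simp add: zero)
  next
    case (step d b y)
    then obtain j where j: "j \<in> J" "b = w j" by blast
    have "(\<Sum>k\<in>J. scl (F b (w' k)) (w k)) = (\<Sum>k\<in>J. if k = j then w j else 0)"
      by (rule sum.cong) (auto simp: j delta)
    then have "(\<Sum>k\<in>J. scl (F b (w' k)) (w k)) = b" using j fin by simp
    then have "scl d (\<Sum>k\<in>J. scl (F b (w' k)) (w k)) = scl d b" by simp
    then show ?case using step
      by (simp add: add_left scl_left scale_left_distrib sum.distrib scale_sum_right)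
  qed
qed

lemma (in lie_algebra) dual_bases_mem:
  assumes "dual_bases F U J w w'" "k \<in> J"
  shows "w k \<in> U" "w' k \<in> U"
  using assms span_base by (auto simp: dual_bases_def family_basis_def)

context minimal_nilpotent
begin

abbreviation g :: "'a \<Rightarrow> 'g set" where "g \<equiv> gr x"

lemma gr_subspace: "subspace (g i)"
  by (rule subspaceI) (simp_all add: gr_def br_right.zero br_add_right br_scl_right scale_right_distrib mult.commute)

lemmas gr_0 [simp] = subspace_0[OF gr_subspace]
  and gr_add = subspace_add[OF gr_subspace]
  and gr_scl = subspace_scale[OF gr_subspace]
  and gr_diff = subspace_diff[OF gr_subspace]

lemma e_gr: "e \<in> g 1" and f_gr: "f \<in> g (- 1)" and x_gr: "x \<in> g 0"
  by (simp_all add: gr_def br_x_e br_x_f br_self)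

lemma br_gr: "a \<in> g i \<Longrightarrow> b \<in> g j \<Longrightarrow> br a b \<in> g (i + j)"
  unfolding gr_def mem_Collect_eq
  by (simp only: br_jacobi[of x a b] br_scl_left br_scl_right scale_left_distrib)

lemma br_gr': "a \<in> g i \<Longrightarrow> b \<in> g j \<Longrightarrow> i + j = k \<Longrightarrow> br a b \<in> g k"
  using br_gr by blast

lemma gr_decomp:
  obtains c m n p d where "m \<in> g (- (1/2))" "n \<in> g 0" "p \<in> g (1/2)"
    "a = scl c f + m + n + p + scl d e"
proof -
  obtain q where "case q of (c, m, n, p, d) \<Rightarrow> m \<in> g (- (1/2)) \<and> n \<in> g 0 \<and> p \<in> g (1/2) \<and>
      a = scl c f + m + n + p + scl d e"
    using ex1_implies_ex[OF minimal[of a]] by blast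
  then show ?thesis by (cases q) (auto intro: that)
qed

lemma gr_decomp_unique:
  assumes "m \<in> g (- (1/2))" "n \<in> g 0" "p \<in> g (1/2)" "scl c f + m + n + p + scl d e = 0"
  shows "c = 0" "m = 0" "n = 0" "p = 0" "d = 0"
proof -
  let ?P = "\<lambda>(c, m, n, p, d). m \<in> g (- (1/2)) \<and> n \<in> g 0 \<and> p \<in> g (1/2) \<and>
      0 = scl c f + m + n + p + scl d e"
  have "?P (c, m, n, p, d)" "?P (0, 0, 0, 0, 0)" using assms by simp_all
  with minimal[of 0] have "(c, m, n, p, d) = (0, 0, 0, 0, 0)" by (rule ex1_eq)
  then show "c = 0" "m = 0" "n = 0" "p = 0" "d = 0" by auto
qed

text \<open>Applying ad x to the decomposition and subtracting \<open>scl i a\<close> gives a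
  decomposition of 0, whose components vanish by uniqueness. This decides which eigenspaces are zero
  and shows that g_1 and g_{-1} are lines.\<close>

lemma gr_components:
  assumes "a \<in> g i" "m \<in> g (- (1/2))" "n \<in> g 0" "p \<in> g (1/2)" "a = scl c f + m + n + p + scl d e"
  shows "(i + 1) * c = 0" "scl (i + 1/2) m = 0" "scl i n = 0" "scl (i - 1/2) p = 0" "(i - 1) * d = 0"
proof -
  have br_x: "br x m = scl (- (1/2)) m" "br x n = 0" "br x p = scl (1/2) p"
    using assms by (auto simp: gr_def)
  have "br x a = scl (- c) f + scl (- (1/2)) m + scl (1/2) p + scl d e"
    using assms by (simp add: br_add_right br_scl_right br_x_e br_x_f br_x)
  moreover have "br x a = scl i a" using assms by (simp add: gr_def)
  ultimately have "scl i a - (scl (- c) f + scl (- (1/2)) m + scl (1/2) p + scl d e) = 0" by simp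
  then have "scl ((i + 1) * c) f + scl (i + 1/2) m + scl i n + scl (i - 1/2) p + scl ((i - 1) * d) e = 0"
    by (simp add: assms(5) algebra_simps)
  from gr_decomp_unique[OF _ _ _ this]
  show "(i + 1) * c = 0" "scl (i + 1/2) m = 0" "scl i n = 0" "scl (i - 1/2) p = 0" "(i - 1) * d = 0"
    using assms by (simp_all add: gr_scl)
qed

lemma gr_trivial:
  assumes "a \<in> g i" "i \<notin> {-1, -(1/2), 0, 1/2, 1}"
  shows "a = 0"
proof -
  obtain c m n p d where d: "m \<in> g (- (1/2))" "n \<in> g 0" "p \<in> g (1/2)" "a = scl c f + m + n + p + scl d e"
    by (rule gr_decomp)
  show ?thesis using gr_components[OF assms(1) d] assms(2) d(4)
    by (auto simp: add_eq_0_iff2)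
qed

lemma gr_half_int_trivial:
  assumes "b \<in> g (of_int k / 2)" "k > 2"
  shows "b = 0"
proof -
  have "of_int k / 2 \<notin> {-1, -(1/2), 0, 1/2, 1 :: 'a}"
    using assms(2) of_int_eq_iff[of k "-2", where ?'a = 'a] of_int_eq_iff[of k "-1", where ?'a = 'a]
      of_int_eq_iff[of k 0, where ?'a = 'a] of_int_eq_iff[of k 1, where ?'a = 'a]
      of_int_eq_iff[of k 2, where ?'a = 'a]
    by (auto simp: field_simps)
  then show ?thesis using gr_trivial assms(1) by blast
qed

lemma gr_one: assumes "a \<in> g 1" obtains d where "a = scl d e"
proof -
  obtain c m n p d where d: "m \<in> g (- (1/2))" "n \<in> g 0" "p \<in> g (1/2)" "a = scl c f + m + n + p + scl d e"
    by (rule gr_decomp)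
  show ?thesis using gr_components[OF assms d] d(4) that[of d] by auto
qed

lemma gr_minus_one: assumes "a \<in> g (- 1)" obtains c where "a = scl c f"
proof -
  obtain c m n p d where d: "m \<in> g (- (1/2))" "n \<in> g 0" "p \<in> g (1/2)" "a = scl c f + m + n + p + scl d e"
    by (rule gr_decomp)
  show ?thesis using gr_components[OF assms d] d(4) that[of c] by (auto simp: add_eq_0_iff2)
qed

lemma gr_sum_induct [case_names hom add]:
  assumes hom: "\<And>i a. i \<in> {-1, -(1/2), 0, 1/2, 1} \<Longrightarrow> a \<in> g i \<Longrightarrow> P a"
    and add: "\<And>a b. P a \<Longrightarrow> P b \<Longrightarrow> P (a + b)"
  shows "P a"
proof -
  obtain c m n p d where d: "m \<in> g (- (1/2))" "n \<in> g 0" "p \<in> g (1/2)" "a = scl c f + m + n + p + scl d e"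
    by (rule gr_decomp)
  have "P (scl c f)" "P m" "P n" "P p" "P (scl d e)"
    using d hom[of "-1" "scl c f"] hom[of 1 "scl d e"] e_gr f_gr by (auto intro: hom gr_scl)
  then show ?thesis unfolding d(4) by (intro add)
qed

lemma e_nonzero: "e \<noteq> 0"
proof
  assume "e = 0"
  then have "scl 0 f + 0 + 0 + 0 + scl 1 e = 0" by simp
  from gr_decomp_unique(5)[OF gr_0 gr_0 gr_0 this] show False by simp
qed

lemma frm_gr:
  assumes "a \<in> g i" "b \<in> g j" "i + j \<noteq> 0"
  shows "frm a b = 0"
proof -
  have "i * frm a b = frm (br x a) b" using assms by (simp add: gr_def frm_scl)
  also have "\<dots> = - frm a (br x b)"
    by (simp add: br_skew[of x] frm_left.minus frm_invariant)
  also have "\<dots> = - (j * frm a b)" using assms by (simp add: gr_def frm_scl_right)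
  finally have "(i + j) * frm a b = 0" by (simp add: algebra_simps)
  then show ?thesis using assms by simp
qed

lemma frm_e_f: "frm e f = 2 * frm x x"
proof -
  have "2 * frm x x = frm (br e f) x" by (simp add: br_e_f frm_scl)
  also have "\<dots> = frm e (br f x)" by (rule frm_invariant)
  also have "br f x = f" using br_x_f by (simp add: br_skew[of x])
  finally show ?thesis ..
qed

lemma frm_f_e: "frm f e = 2 * frm x x"
  by (simp add: frm_sym[of f] frm_e_f)

text \<open>(e|f) = 2(x|x), and e pairs only with g_{-1} = Ff; if (x|x) were 0, e would lie in the
  radical of the form.\<close>

lemma frm_x_x [simp]: "frm x x \<noteq> 0"
proof
  assume "frm x x = 0"
  then have ef: "frm e f = 0" by (simp add: frm_e_f)
  have "frm e b = 0" for b
  proof (induction b rule: gr_sum_induct)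
    case (hom i b)
    show ?case
    proof (cases "i = -1")
      case True
      then obtain c where "b = scl c f" using hom gr_minus_one by blast
      then show ?thesis by (simp add: frm_scl_right ef)
    next
      case False
      then show ?thesis using hom frm_gr[OF e_gr, of b i] by (simp add: add_eq_0_iff)
    qed
  qed (simp add: frm_add_right)
  then show False using frm_nondegenerate e_nonzero by blast
qed

section \<open>The skew form on g_{1/2} and brackets of homogeneous elements\<close>

definition om :: "'g \<Rightarrow> 'g \<Rightarrow> 'a" where
  "om v w = frm f (br v w)"

lemma om_add_left: "om (v + v') w = om v w + om v' w"
  and om_add_right: "om v (w + w') = om v w + om v w'"
  and om_scl_left: "om (scl d v) w = d * om v w"
  and om_scl_right: "om v (scl d w) = d * om v w"
  by (simp_all add: om_def br_add_left br_add_right br_scl_left br_scl_right frm_add_right frm_scl_right)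

lemma om_skew: "om w v = - om v w"
  by (simp add: om_def br_skew[of w v] frm_right.minus)

text \<open>g_1 is the line Fe, so the bracket is determined by its pairing with f, and (f|e) =
  2(x|x) is the denominator. The next three lemmas argue in the same way.\<close>

lemma br_half_half: assumes "v \<in> g (1/2)" "w \<in> g (1/2)" shows "br v w = scl (om v w / (2 * frm x x)) e"
proof -
  have "br v w \<in> g 1" using br_gr[OF assms] by simp
  then obtain d where d: "br v w = scl d e" by (rule gr_one)
  then show ?thesis by (simp add: om_def frm_scl_right frm_f_e)
qed

lemma br_mhalf_mhalf: assumes "u \<in> g (- (1/2))" "u1 \<in> g (- (1/2))"
  shows "br u u1 = scl (omega u u1 / (2 * frm x x)) f"
proof -
  have "br u u1 \<in> g (- 1)" using br_gr[OF assms] by simp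
  then obtain d where d: "br u u1 = scl d f" by (rule gr_minus_one)
  then show ?thesis by (simp add: omega_def frm_scl_right frm_e_f)
qed

lemma br_zero_e: assumes "a \<in> g 0" shows "br a e = scl (frm x a / frm x x) e"
proof -
  have "br a e \<in> g 1" using br_gr[OF assms e_gr] by simp
  then obtain d where d: "br a e = scl d e" by (rule gr_one)
  have "frm f (br a e) = frm (br e f) a"
    by (simp add: frm_sym[of f] frm_invariant) (metis frm_invariant frm_sym)
  then show ?thesis using d by (simp add: br_e_f frm_scl frm_scl_right frm_f_e field_simps)
qed

lemma br_zero_f: assumes "a \<in> g 0" shows "br a f = scl (- (frm x a / frm x x)) f"
proof -
  have "br a f \<in> g (-1)" using br_gr[OF assms f_gr] by simp
  then obtain d where d: "br a f = scl d f" by (rule gr_minus_one)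
  have "frm e (br a f) = - frm (br e f) a"
    by (simp add: br_skew[of f a] frm_right.minus frm_invariant)
  then have "d * frm x x = - frm x a" using d by (simp add: br_e_f frm_scl frm_scl_right frm_e_f)
  then have "d = - (frm x a / frm x x)" by (simp add: field_simps)
  then show ?thesis using d by simp
qed

lemma br_vanish: "a \<in> g i \<Longrightarrow> b \<in> g j \<Longrightarrow> i + j \<notin> {-1, -(1/2), 0, 1/2, 1} \<Longrightarrow> br a b = 0"
  using br_gr gr_trivial by blast

lemma br_f_mhalf: "u \<in> g (- (1/2)) \<Longrightarrow> br f u = 0"
  using br_vanish[OF f_gr] by (simp add: field_simps)

lemma br_e_half: "v \<in> g (1/2) \<Longrightarrow> br e v = 0"
  using br_vanish[OF e_gr] by (simp add: field_simps)

lemma br_f_br_e: assumes u: "u \<in> g (- (1/2))" shows "br f (br e u) = u"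
proof -
  have "br f (br e u) = br (br f e) u + br e (br f u)" by (rule br_jacobi)
  also have "br f e = - scl 2 x" by (simp add: br_skew[of e f] br_e_f flip: br_e_f)
  finally have "br f (br e u) = - scl 2 (br x u)"
    using u by (simp add: br_f_mhalf br_right.zero br_left.minus br_scl_left)
  then show ?thesis using u by (simp add: gr_def)
qed

lemma br_e_br_f: assumes v: "v \<in> g (1/2)" shows "br e (br f v) = v"
proof -
  have "br e (br f v) = br (br e f) v + br f (br e v)" by (rule br_jacobi)
  then show ?thesis using v by (simp add: br_e_half br_right.zero br_e_f br_scl_left gr_def)
qed

section \<open>The homomorphism \<open>\<rho>\<close>\<close>

text \<open>\<open>proj_le_half\<close> is a definite description over spans of eigenspaces for
  infinitely many half-integers. Elements of these spans have to be brought into the form given by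
  \<open>minimal\<close> before uniqueness applies.\<close>

lemma proj_le_half_decomp:
  assumes "m \<in> g (- (1/2))" "n \<in> g 0" "p \<in> g (1/2)"
  shows "proj_le_half x (scl c f + m + n + p + scl d e) = scl c f + m + n + p"
  unfolding proj_le_half_def
proof (rule the_equality)
  have mem: "b \<in> gr_le x 1" if "b \<in> g (of_int k / 2)" "k \<le> 1" for b k
    using that unfolding gr_le_def by (intro span_base) auto
  have "scl c f \<in> gr_le x 1" "m \<in> gr_le x 1" "n \<in> gr_le x 1" "p \<in> gr_le x 1"
    using assms f_gr gr_scl mem[of "scl c f" "-2"] mem[of m "-1"] mem[of n 0] mem[of p 1] by auto
  moreover have "scl d e \<in> gr_ge x 2"
    unfolding gr_ge_def using gr_scl[OF e_gr] by (intro span_base UN_I[of 2]) auto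
  ultimately show "scl c f + m + n + p \<in> gr_le x 1
      \<and> scl c f + m + n + p + scl d e - (scl c f + m + n + p) \<in> gr_ge x 2"
    unfolding gr_le_def by (auto intro: span_add)
next
  fix q assume q: "q \<in> gr_le x 1 \<and> scl c f + m + n + p + scl d e - q \<in> gr_ge x 2"
  have le: "\<exists>c m n p. m \<in> g (- (1/2)) \<and> n \<in> g 0 \<and> p \<in> g (1/2) \<and> b = scl c f + m + n + p"
    if "b \<in> gr_le x 1" for b
    using that unfolding gr_le_def
  proof (induction b rule: span_induct_alt)
    case base
    show ?case by (rule exI[of _ 0], rule exI[of _ 0], rule exI[of _ 0], rule exI[of _ 0]) simp
  next
    case (step r b y)
    obtain k where k: "k \<le> 1" "b \<in> g (of_int k / 2)" using step(1) by auto
    obtain c m n p d where d: "m \<in> g (- (1/2))" "n \<in> g 0" "p \<in> g (1/2)" "b = scl c f + m + n + p + scl d e"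
      by (rule gr_decomp)
    have "(of_int k :: 'a) / 2 \<noteq> 1" using k(1) by (simp add: field_simps of_int_eq_numeral_iff)
    then have "d = 0" using gr_components(5)[OF k(2) d] by simp
    moreover obtain c' m' n' p' where "m' \<in> g (- (1/2))" "n' \<in> g 0" "p' \<in> g (1/2)" "y = scl c' f + m' + n' + p'"
      using step(2) by blast
    ultimately show ?case using d
      by (intro exI[of _ "r * c + c'"] exI[of _ "scl r m + m'"] exI[of _ "scl r n + n'"] exI[of _ "scl r p + p'"])
        (auto simp: algebra_simps intro: gr_add gr_scl)
  qed
  have ge: "\<exists>d. b = scl d e" if "b \<in> gr_ge x 2" for b
    using that unfolding gr_ge_def
  proof (induction b rule: span_induct_alt)
    case base
    show ?case by (rule exI[of _ 0]) simp
  next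
    case (step r b y)
    obtain k where k: "k \<ge> 2" "b \<in> g (of_int k / 2)" using step(1) by auto
    have "\<exists>d. b = scl d e"
    proof (cases "k = 2")
      case True
      then show ?thesis using k gr_one[of b] by auto
    next
      case False
      then have "b = 0" using gr_half_int_trivial[OF k(2)] k(1) by simp
      then show ?thesis by (intro exI[of _ 0]) auto
    qed
    then show ?case using step(2) by (metis scale_left_distrib scale_scale)
  qed
  obtain c' m' n' p' d' where c': "m' \<in> g (- (1/2))" "n' \<in> g 0" "p' \<in> g (1/2)" "q = scl c' f + m' + n' + p'"
    and d': "scl c f + m + n + p + scl d e - q = scl d' e"
    using q le ge by blast
  then have "scl (c - c') f + (m - m') + (n - n') + (p - p') + scl (d - d') e = 0"
    by (simp add: algebra_simps)
  from gr_decomp_unique[OF _ _ _ this] have "c = c'" "m = m'" "n = n'" "p = p'"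
    using assms c' by (auto intro: gr_diff)
  then show "q = scl c f + m + n + p" using c' by simp
qed

lemma gr_le_oneI:
  assumes "i \<in> {-1, -(1/2), 0, 1/2}" "a \<in> g i"
  shows "a \<in> gr_le x 1"
proof -
  have "\<exists>k \<le> 1. i = of_int k / 2"
    using assms(1) by (elim insertE emptyE) (rule exI[of _ "-2"] exI[of _ "-1"] exI[of _ 0] exI[of _ 1], simp)+
  then obtain k where k: "k \<le> 1" "i = of_int k / 2" by blast
  have "a \<in> g (of_int k / 2)" using assms(2) unfolding k(2) .
  then show ?thesis using k(1) unfolding gr_le_def by (blast intro: span_base)
qed

lemma proj_le_half_add: "proj_le_half x (a + b) = proj_le_half x a + proj_le_half x b"
proof -
  obtain c m n p d where d: "m \<in> g (- (1/2))" "n \<in> g 0" "p \<in> g (1/2)" "a = scl c f + m + n + p + scl d e"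
    by (rule gr_decomp)
  obtain c' m' n' p' d' where d': "m' \<in> g (- (1/2))" "n' \<in> g 0" "p' \<in> g (1/2)" "b = scl c' f + m' + n' + p' + scl d' e"
    by (rule gr_decomp)
  have "a + b = scl (c + c') f + (m + m') + (n + n') + (p + p') + scl (d + d') e"
    by (simp add: d d' algebra_simps)
  moreover have "proj_le_half x \<dots> = scl (c + c') f + (m + m') + (n + n') + (p + p')"
    using d d' by (intro proj_le_half_decomp gr_add)
  moreover have "proj_le_half x a = scl c f + m + n + p" "proj_le_half x b = scl c' f + m' + n' + p'"
    unfolding d(4) d'(4) by (intro proj_le_half_decomp d d')+
  ultimately show ?thesis by (simp add: algebra_simps)
qed

lemma proj_le_half_scl: "proj_le_half x (scl r a) = scl r (proj_le_half x a)"
proof -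
  obtain c m n p d where d: "m \<in> g (- (1/2))" "n \<in> g 0" "p \<in> g (1/2)" "a = scl c f + m + n + p + scl d e"
    by (rule gr_decomp)
  have "scl r a = scl (r * c) f + scl r m + scl r n + scl r p + scl (r * d) e"
    by (simp add: d algebra_simps)
  moreover have "proj_le_half x \<dots> = scl (r * c) f + scl r m + scl r n + scl r p"
    using d by (intro proj_le_half_decomp gr_scl)
  moreover have "proj_le_half x a = scl c f + m + n + p"
    unfolding d(4) using d by (intro proj_le_half_decomp)
  ultimately show ?thesis by (simp add: algebra_simps)
qed

lemma proj_le_half_hom:
  assumes "i \<in> {-1, -(1/2), 0, 1/2}" "a \<in> g i"
  shows "proj_le_half x a = a"
proof -
  consider "i = - 1" | "i = - (1/2)" | "i = 0" | "i = 1/2" using assms(1) by blast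
  then show ?thesis
  proof cases
    case 1
    then obtain c where "a = scl c f" using assms(2) gr_minus_one by blast
    then show ?thesis using proj_le_half_decomp[of 0 0 0 c 0] by simp
  next
    case 2
    then show ?thesis using assms(2) proj_le_half_decomp[of a 0 0 0 0] by simp
  next
    case 3
    then show ?thesis using assms(2) proj_le_half_decomp[of 0 a 0 0 0] by simp
  next
    case 4
    show ?thesis using assms(2)[unfolded 4] proj_le_half_decomp[of 0 0 a 0 0] by simp
  qed
qed

abbreviation R :: "('a, 'i) dpoly \<Rightarrow> ('a, 'i) dpoly" where "R \<equiv> rho x f"

lemma R_add: "R (p + q) = R p + R q"
  and R_mult: "R (p * q) = R p * R q"
  and R_Cst [simp]: "R (Cst c) = Cst c"
  and R_0 [simp]: "R 0 = 0"
  by (simp_all add: rho_def dsubst_add dsubst_mult)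

lemma R_D: "R (D p) = D (R p)"
  unfolding rho_def by (rule dsubst_D) simp

sublocale R: additive R
  by standard (rule R_add)

lemma R_emb: "R (emb a) = emb (proj_le_half x a) + Cst (frm f a)"
proof (induction a rule: bas_induct)
  case (bas i)
  then show ?case by (simp add: emb_bas rho_def)
next
  case (add a b)
  then show ?case by (simp add: emb_add R_add proj_le_half_add frm_add_right Cst_add)
next
  case (scl c a)
  then show ?case
    by (simp add: emb_scl R_mult proj_le_half_scl frm_scl_right Cst_mult distrib_left)
qed

lemma R_emb_hom:
  assumes "i \<in> {-1, -(1/2), 0, 1/2}" "a \<in> g i"
  shows "R (emb a) = emb a"
proof -
  have "- (1/2) \<noteq> (1 :: 'a)" by (simp add: field_simps)
  then have "frm f a = 0" using assms(1) by (intro frm_gr[OF f_gr assms(2)]) auto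
  then show ?thesis using assms by (simp add: R_emb proj_le_half_hom)
qed

lemma R_emb_e [simp]: "R (emb e) = Cst (2 * frm x x)"
  using proj_le_half_decomp[of 0 0 0 0 1] by (simp add: R_emb emb.zero frm_f_e)

lemma R_emb_gr_le: assumes "a \<in> gr_le x 1" shows "R (emb a) = emb a"
  using assms unfolding gr_le_def
proof (induction a rule: span_induct_alt)
  case base
  show ?case by (simp add: emb.zero)
next
  case (step c b y)
  obtain k where k: "k \<le> 1" "b \<in> g (of_int k / 2)" using step(1) by auto
  obtain c m n p d where d: "m \<in> g (- (1/2))" "n \<in> g 0" "p \<in> g (1/2)" "b = scl c f + m + n + p + scl d e"
    by (rule gr_decomp)
  have "(of_int k :: 'a) / 2 \<noteq> 1" using k(1) by (simp add: field_simps of_int_eq_numeral_iff)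
  then have "d = 0" using gr_components(5)[OF k(2) d] by simp
  then have "R (emb b) = emb b"
    using R_emb_hom[of "-1" "scl c f"] R_emb_hom[of "-(1/2)" m] R_emb_hom[of 0 n] R_emb_hom[of "1/2" p]
      d f_gr gr_scl
    by (simp add: emb_add R_add)
  then show ?case using step by (simp add: emb_add emb_scl R_add R_mult)
qed

lemma R_D_power: "R ((D ^^ n) p) = (D ^^ n) (R p)"
  by (induction n) (simp_all add: R_D)

abbreviation V :: "('a, 'i) dpoly set" where "V \<equiv> V_le_half x"

lemma R_V: "q \<in> V \<Longrightarrow> R q = q"
  by (induction q rule: V_le_half.induct) (simp_all add: R_add R_mult R_emb_gr_le R_D_power)

lemma R_mem_V: "R q \<in> V"
proof (induction q rule: dpoly_induct)
  case (dvar i n)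
  obtain c m r p d where d: "m \<in> g (- (1/2))" "r \<in> g 0" "p \<in> g (1/2)" "bas i = scl c f + m + r + p + scl d e"
    by (rule gr_decomp)
  have D_power_add: "(D ^^ n) (p + q) = (D ^^ n) p + (D ^^ n) q" for p q :: "('a, 'i) dpoly"
    by (induction n) (simp_all add: D_add)
  have D_power_Cst: "(D ^^ n) (Cst c) \<in> V" for c
  proof (cases n)
    case (Suc k)
    have "(D ^^ k) (0 :: ('a, 'i) dpoly) = 0" by (induction k) simp_all
    with Suc show ?thesis using V_le_half.cst[of 0] by (simp add: funpow_Suc_right del: funpow.simps)
  qed (simp add: V_le_half.cst)
  have dvar: "dvar i n = (D ^^ n) (emb (bas i))" by (simp add: emb_bas flip: dvar_D_power)
  have "R (dvar i n) = (D ^^ n) (emb (scl c f)) + (D ^^ n) (emb m) + (D ^^ n) (emb r) + (D ^^ n) (emb p)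
      + (D ^^ n) (Cst (frm f (bas i)))"
    unfolding dvar R_D_power R_emb D_power_add by (simp add: d proj_le_half_decomp emb_add D_power_add)
  also have "\<dots> \<in> V"
    using d f_gr by (intro V_le_half.add V_le_half.gen D_power_Cst) (auto intro: gr_le_oneI gr_scl)
  finally show ?case .
qed (simp_all add: R_add R_mult V_le_half.intros)

text \<open>\<open>rho\<close> is a projection onto V, so membership in the inductively defined
  subalgebra becomes a fixed-point equation that can be simplified.\<close>

lemma V_iff: "q \<in> V \<longleftrightarrow> R q = q"
  using R_V R_mem_V[of q] by auto

abbreviation RP :: "('a, 'i) dpoly poly \<Rightarrow> ('a, 'i) dpoly poly" where "RP \<equiv> map_poly R"

lemma RP_add: "RP (P + Q) = RP P + RP Q"
  by (rule poly_eqI) (simp add: coeff_map_poly R_add)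

sublocale RP: additive RP
  by standard (rule RP_add)

lemma RP_pCons: "RP (pCons p P) = pCons (R p) (RP P)"
  by (simp add: map_poly_pCons)

lemma RP_smult: "RP (smult p P) = smult (R p) (RP P)"
  by (rule poly_eqI) (simp add: coeff_map_poly R_mult)

lemma RP_lamD: "RP (lamD P) = lamD (RP P)"
  by (induction P) (simp_all add: lamD_pCons RP_pCons RP_add R_D)

lemma RP_arrow: "RP (arrow P k) = arrow (RP P) (R k)"
proof (induction P arbitrary: k rule: poly_induct_shift)
  case (shift P)
  then show ?case by (simp add: arrow_shift RP_add RP_pCons R_D)
qed (simp_all add: RP_pCons R_mult RP_add arrow_add_left)

lemma RP_skew: "RP (skew P) = skew (RP P)"
  by (induction P rule: poly_induct_shift)
    (simp_all add: RP_pCons skew_add RP_add RP_lamD RP.minus)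

end

section \<open>The bracket of the W-algebra\<close>

locale minimal_W = minimal_nilpotent scl br frm bas e x f
  for scl :: "'a::{alg_closed_field, field_char_0} \<Rightarrow> 'g::ab_group_add \<Rightarrow> 'g"
    and br :: "'g \<Rightarrow> 'g \<Rightarrow> 'g"
    and frm :: "'g \<Rightarrow> 'g \<Rightarrow> 'a"
    and bas :: "'i::finite \<Rightarrow> 'g"
    and e x f :: 'g +
  fixes z :: 'a
    and J0 :: "'j set" and al al' :: "'j \<Rightarrow> 'g"
    and I0 :: "'l set" and cl cl' :: "'l \<Rightarrow> 'g"
    and K :: "'k set" and v v' :: "'k \<Rightarrow> 'g"
  assumes dual_g0: "dual_bases frm (g 0) J0 al al'"
    and dual_g0f: "dual_bases frm g0f I0 cl cl'"
    and dual_half: "dual_bases (\<lambda>y w. frm f (br y w)) (g (1/2)) K v v'"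
begin

declare emb.minus [simp] emb.zero [simp] frm_left.minus [simp] frm_left.zero [simp] frm_right.minus [simp]
  frm_right.zero [simp] br_left.minus [simp] br_left.zero [simp] br_right.minus [simp] br_right.zero [simp]
  R.minus [simp] Cst_minus [simp]

abbreviation B :: "('a, 'i) dpoly \<Rightarrow> ('a, 'i) dpoly \<Rightarrow> ('a, 'i) dpoly poly" where
  "B \<equiv> lambda_bracket e z"

sublocale B: abstract_lambda_bracket B
  by standard (simp add: lambda_bracket_spec)

lemma B_emb: "B (emb a) (emb b) = [: emb (br a b) + Cst (z * frm e (br a b)), Cst (frm a b) :]"
  using lambda_bracket_spec[of e z] by (simp add: gen_bracket_def)

lemma B_skew: "B h k = - skew (B k h)"
proof (rule B.skew_symmetric)
  fix i j
  show "B (dvar i 0) (dvar j 0) = - skew (B (dvar j 0) (dvar i 0))"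
    by (simp add: B_emb skew_pCons lamD_const br_skew[of "bas i" "bas j"] emb.minus frm_right.minus Cst_minus
        frm_sym[of "bas j"] flip: emb_bas)
qed

abbreviation WB :: "('a, 'i) dpoly \<Rightarrow> ('a, 'i) dpoly \<Rightarrow> ('a, 'i) dpoly poly" where
  "WB \<equiv> W_bracket x f e z"

abbreviation W :: "('a, 'i) dpoly set" where
  "W \<equiv> W_algebra x f e z"

lemma WB_add_left: "WB (q + q') h = WB q h + WB q' h"
  and WB_add_right: "WB q (h + h') = WB q h + WB q h'"
  and WB_Cst_mult_left: "WB (Cst c * q) h = smult (Cst c) (WB q h)"
  and WB_Cst_mult_right: "WB q (Cst c * h) = smult (Cst c) (WB q h)"
  and WB_D_left: "WB (D q) h = - pCons 0 (WB q h)"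
  and WB_D_right: "WB q (D h) = lamD (WB q h)"
  and WB_mult_right: "WB q (h * h') = smult (R h') (WB q h) + smult (R h) (WB q h')"
  and WB_mult_left: "WB (q * q') h = arrow (WB q h) (R q') + arrow (WB q' h) (R q)"
  and WB_Cst_left [simp]: "WB (Cst c) h = 0"
  and WB_Cst_right [simp]: "WB q (Cst c) = 0"
  by (simp_all add: W_bracket_def B.add_left B.add_right B.Cst_mult_left B.Cst_mult_right B.D_left B.D_right
      B.mult_left B.mult_right RP_add RP_smult RP_lamD RP_arrow RP_pCons RP.minus)

lemma WB_emb: "WB (emb a) (emb b) = [: R (emb (br a b)) + Cst (z * frm e (br a b)), Cst (frm a b) :]"
  by (simp add: W_bracket_def B_emb RP_pCons R_add)

lemma WB_skew: "WB h k = - skew (WB k h)"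
  using B_skew[of h k] by (simp add: W_bracket_def RP.minus RP_skew)

sublocale WB_left: additive "\<lambda>q. WB q h" for h
  by standard (rule WB_add_left)

sublocale WB_right: additive "WB q" for q
  by standard (rule WB_add_right)

lemma WB_sum_right: "WB q (\<Sum>i\<in>A. h i) = (\<Sum>i\<in>A. WB q (h i))"
  by (rule WB_right.sum)

lemma WB_emb_add: "WB (emb (a + b)) h = WB (emb a) h + WB (emb b) h"
  by (simp add: emb_add WB_add_left)

lemma WB_emb_scl: "WB (emb (scl c a)) h = smult (Cst c) (WB (emb a) h)"
  by (simp add: emb_scl WB_Cst_mult_left)

lemma half_cancel: "(1::'a) + - (1/2) = 1/2" "- (1/2) + (1::'a) = 1/2" "- 1 + 1/2 = - (1/2 :: 'a)"
  "(1/2 :: 'a) + - 1 = - (1/2)" "- (1/2) + - (1/2) = (-1 :: 'a)" "1/2 + 1/2 = (1::'a)"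
  by (simp_all add: field_simps)

lemma br_e_mhalf_gr: "u \<in> g (- (1/2)) \<Longrightarrow> br e u \<in> g (1/2)"
  using br_gr'[OF e_gr _ half_cancel(1)] by blast

lemma br_f_half_gr: "w \<in> g (1/2) \<Longrightarrow> br f w \<in> g (- (1/2))"
  using br_gr'[OF f_gr _ half_cancel(3)] by blast

lemma br_gr_zero [intro]:
  "a \<in> g 0 \<Longrightarrow> b \<in> g i \<Longrightarrow> br a b \<in> g i" "b \<in> g i \<Longrightarrow> a \<in> g 0 \<Longrightarrow> br b a \<in> g i"
  "u \<in> g (- (1/2)) \<Longrightarrow> w \<in> g (1/2) \<Longrightarrow> br u w \<in> g 0" "w \<in> g (1/2) \<Longrightarrow> u \<in> g (- (1/2)) \<Longrightarrow> br w u \<in> g 0"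
  using br_gr'[of a 0 b i i] br_gr'[of b i a 0 i] br_gr'[of u "-(1/2)" w "1/2" 0] br_gr'[of w "1/2" u "-(1/2)" 0]
  by simp_all

declare br_gr_zero [simp] br_e_mhalf_gr [simp] br_f_half_gr [simp]

lemma R_half [simp]: "w \<in> g (1/2) \<Longrightarrow> R (emb w) = emb w"
  and R_zero [simp]: "w \<in> g 0 \<Longrightarrow> R (emb w) = emb w"
  and R_mhalf [simp]: "w \<in> g (- (1/2)) \<Longrightarrow> R (emb w) = emb w"
  and R_f [simp]: "R (emb f) = emb f"
  using R_emb_hom[of "1/2" w] R_emb_hom[of 0 w] R_emb_hom[of "-(1/2)" w] R_emb_hom[of "-1" f] f_gr
  by auto

section \<open>Brackets of g_{1/2} and of e with each graded piece\<close>

lemma frm_e_gr: "a \<in> g i \<Longrightarrow> i \<noteq> - 1 \<Longrightarrow> frm e a = 0"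
  using frm_gr[OF e_gr, of a i] by (simp add: add_eq_0_iff)

text \<open>[w, y] is a multiple of e, which \<open>rho\<close> turns into the constant 2(x|x); this
  cancels the denominator in \<open>br_half_half\<close>. So on factors from g_{1/2} the operator
  {w_\<lambda> .} is a contraction with \<open>om\<close>.\<close>

lemma T_half_half: assumes "w \<in> g (1/2)" "y \<in> g (1/2)" shows "WB (emb w) (emb y) = [:Cst (om w y):]"
proof -
  have "frm w y = 0" using assms by (rule frm_gr) simp
  moreover have "frm e e = 0" using frm_gr[OF e_gr e_gr] by simp
  ultimately show ?thesis using assms
    by (simp add: WB_emb br_half_half emb_scl R_mult frm_scl_right flip: Cst_mult)
qed

lemma T_half_zero: assumes "w \<in> g (1/2)" "y \<in> g 0" shows "WB (emb w) (emb y) = [:emb (br w y):]"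
proof -
  have br: "br w y \<in> g (1/2)" using assms by blast
  have "frm w y = 0" using assms by (rule frm_gr) simp
  moreover have "frm e (br w y) = 0" using frm_gr[OF e_gr br] by (simp add: field_simps)
  ultimately show ?thesis using br by (simp add: WB_emb)
qed

lemma T_half_mhalf: assumes "w \<in> g (1/2)" "y \<in> g (- (1/2))"
  shows "WB (emb w) (emb y) = [:emb (br w y), Cst (frm w y):]"
proof -
  have br: "br w y \<in> g 0" using assms by blast
  have "frm e (br w y) = 0" using frm_gr[OF e_gr br] by simp
  then show ?thesis using br by (simp add: WB_emb)
qed

lemma T_half_f: assumes "w \<in> g (1/2)" shows "WB (emb w) (emb f) = [:emb (br w f):]"
proof -
  have br: "br w f \<in> g (- (1/2))" by (rule br_gr'[OF assms f_gr half_cancel(4)])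
  have "frm w f = 0" using frm_gr[OF assms f_gr] by (simp add: field_simps)
  moreover have "frm e (br w f) = 0" using frm_gr[OF e_gr br] by (simp add: field_simps)
  ultimately show ?thesis using br by (simp add: WB_emb)
qed

lemma T_e_half: assumes "y \<in> g (1/2)" shows "WB (emb e) (emb y) = 0"
  using assms frm_gr[OF e_gr assms] by (simp add: WB_emb br_e_half emb.zero frm_right.zero field_simps)

lemma T_e_zero: assumes "y \<in> g 0" shows "WB (emb e) (emb y) = [:Cst (- 2 * frm x y):]"
proof -
  have "frm e y = 0" using frm_gr[OF e_gr assms] by simp
  moreover have "frm e e = 0" using frm_gr[OF e_gr e_gr] by simp
  moreover have "br e y = scl (- (frm x y / frm x x)) e"
    using br_zero_e[OF assms] br_skew[of e y] by simp
  ultimately show ?thesis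
    by (simp add: WB_emb emb_scl R_mult frm_scl_right mult.commute flip: Cst_mult)
qed

lemma T_e_mhalf: assumes "y \<in> g (- (1/2))" shows "WB (emb e) (emb y) = [:emb (br e y):]"
  using assms frm_gr[OF e_gr assms] frm_gr[OF e_gr br_e_mhalf_gr[OF assms]] br_e_mhalf_gr[OF assms]
  by (simp add: WB_emb field_simps)

lemma T_e_f: "WB (emb e) (emb f) = [:Cst 2 * emb x, Cst (2 * frm x x):]"
  using x_gr frm_gr[OF e_gr x_gr] by (simp add: WB_emb br_e_f emb_scl R_mult frm_scl_right frm_e_f)

section \<open>Contractions with dual bases\<close>

text \<open>Lets the contraction rules be stated once for any expression that is linear in the
  contracted vector.\<close>

definition lin :: "('g \<Rightarrow> ('a, 'i) dpoly) \<Rightarrow> bool" where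
  "lin G \<longleftrightarrow> (\<forall>a b. G (a + b) = G a + G b) \<and> (\<forall>c a. G (scl c a) = Cst c * G a)"

lemma lin_sum: assumes "lin G" shows "G (\<Sum>k\<in>A. scl (F k) (w k)) = (\<Sum>k\<in>A. Cst (F k) * G (w k))"
proof -
  interpret G: additive G using assms by unfold_locales (simp add: lin_def)
  show ?thesis using assms by (simp add: G.sum lin_def)
qed

lemmas lin_simps = emb_add emb_scl br_add_left br_add_right br_scl_left br_scl_right
  om_add_left om_add_right om_scl_left om_scl_right frm_add frm_add_right frm_scl frm_scl_right
  D_add D_Cst_mult Cst_add Cst_mult

lemma finite_K [simp]: "finite K" and v_gr [simp]: "k \<in> K \<Longrightarrow> v k \<in> g (1/2)" "k \<in> K \<Longrightarrow> v' k \<in> g (1/2)"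
  and finite_J0 [simp]: "finite J0" and al_gr [simp]: "j \<in> J0 \<Longrightarrow> al j \<in> g 0" "j \<in> J0 \<Longrightarrow> al' j \<in> g 0"
  and finite_I0 [simp]: "finite I0" and cl_gr: "i \<in> I0 \<Longrightarrow> cl i \<in> g0f" "i \<in> I0 \<Longrightarrow> cl' i \<in> g0f"
  using dual_half dual_g0 dual_g0f dual_bases_mem[OF dual_half] dual_bases_mem[OF dual_g0] dual_bases_mem[OF dual_g0f]
  by (auto simp: dual_bases_def family_basis_def)

lemma expand_half: assumes "y \<in> g (1/2)"
  shows "(\<Sum>k\<in>K. scl (om (v k) y) (v' k)) = y" "(\<Sum>k\<in>K. scl (om y (v' k)) (v k)) = y"
  using dual_bases_expand[OF dual_half assms] by (simp_all add: om_def lin_simps)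

lemma expand_g0: assumes "y \<in> g 0"
  shows "(\<Sum>k\<in>J0. scl (frm (al k) y) (al' k)) = y" "(\<Sum>k\<in>J0. scl (frm y (al' k)) (al k)) = y"
  using dual_bases_expand[OF dual_g0 assms] by (simp_all add: lin_simps)

lemma expand_g0f: assumes "y \<in> g0f"
  shows "(\<Sum>k\<in>I0. scl (frm (cl k) y) (cl' k)) = y" "(\<Sum>k\<in>I0. scl (frm y (cl' k)) (cl k)) = y"
  using dual_bases_expand[OF dual_g0f assms] by (simp_all add: lin_simps)

lemma contract_half: assumes "lin G" "y \<in> g (1/2)"
  shows "(\<Sum>k\<in>K. Cst (om (v k) y) * G (v' k)) = G y" "(\<Sum>k\<in>K. Cst (om y (v k)) * G (v' k)) = - G y"
    "(\<Sum>k\<in>K. Cst (om y (v' k)) * G (v k)) = G y"  "(\<Sum>k\<in>K. Cst (om (v' k) y) * G (v k)) = - G y"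
proof -
  show 1: "(\<Sum>k\<in>K. Cst (om (v k) y) * G (v' k)) = G y" and 2: "(\<Sum>k\<in>K. Cst (om y (v' k)) * G (v k)) = G y"
    using expand_half[OF assms(2)] lin_sum[OF assms(1), of "\<lambda>k. om (v k) y" v' K]
      lin_sum[OF assms(1), of "\<lambda>k. om y (v' k)" v K] by simp_all
  show "(\<Sum>k\<in>K. Cst (om y (v k)) * G (v' k)) = - G y" "(\<Sum>k\<in>K. Cst (om (v' k) y) * G (v k)) = - G y"
    using 1 2 by (simp_all add: om_skew[of y "v _"] om_skew[of "v' _" y] Cst_minus sum_negf)
qed

lemma contract_g0: assumes "lin G" "y \<in> g 0"
  shows "(\<Sum>k\<in>J0. Cst (frm (al k) y) * G (al' k)) = G y" "(\<Sum>k\<in>J0. Cst (frm y (al k)) * G (al' k)) = G y"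
    "(\<Sum>k\<in>J0. Cst (frm y (al' k)) * G (al k)) = G y"  "(\<Sum>k\<in>J0. Cst (frm (al' k) y) * G (al k)) = G y"
  using expand_g0[OF assms(2)] lin_sum[OF assms(1), of "\<lambda>k. frm (al k) y" al' J0]
    lin_sum[OF assms(1), of "\<lambda>k. frm y (al' k)" al J0] by (simp_all add: frm_sym[of y "al _"] frm_sym[of "al' _" y])

text \<open>Since \<open>om\<close> is skew, the tensor of the dual bases, the sum of
  \<open>v k\<close> \<otimes> \<open>v' k\<close>, is antisymmetric.\<close>

lemma half_swap:
  assumes "\<And>y. lin (\<lambda>w. G w y)" "\<And>w. lin (G w)"
  shows "(\<Sum>k\<in>K. G (v' k) (v k)) = - (\<Sum>k\<in>K. G (v k) (v' k))"
proof -
  have "(\<Sum>k\<in>K. G (v' k) (v k)) = (\<Sum>k\<in>K. \<Sum>h\<in>K. Cst (om (v h) (v k)) * G (v' k) (v' h))"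
    by (rule sum.cong) (simp_all add: contract_half[OF assms(2)])
  also have "\<dots> = (\<Sum>h\<in>K. \<Sum>k\<in>K. Cst (om (v h) (v k)) * G (v' k) (v' h))"
    by (rule sum.swap)
  also have "\<dots> = (\<Sum>h\<in>K. - G (v h) (v' h))"
    using contract_half(2)[OF assms(1)] by (intro sum.cong) simp_all
  finally show ?thesis by (simp add: sum_negf)
qed

lemma half_swap_sym:
  assumes "\<And>y. lin (\<lambda>w. G w y)" "\<And>w. lin (G w)" "\<And>y w. G y w = G w y"
  shows "(\<Sum>k\<in>K. G (v k) (v' k)) = 0"
proof -
  have "(\<Sum>k\<in>K. G (v k) (v' k)) = - (\<Sum>k\<in>K. G (v k) (v' k))"
    using half_swap[OF assms(1,2)] by (simp add: assms(3)[of "v' _"])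
  then have "Cst 2 * (\<Sum>k\<in>K. G (v k) (v' k)) = 0"
    by (simp add: Cst_numeral eq_neg_iff_add_eq_0)
  then have "Cst (1/2) * (Cst 2 * (\<Sum>k\<in>K. G (v k) (v' k))) = 0" by simp
  then show ?thesis by (simp only: mult.assoc[symmetric] Cst_mult[symmetric]) simp
qed

text \<open>ad f and ad e are mutually inverse between g_{1/2} and g_{-1/2}, so the pairing of these
  two spaces is \<open>om\<close> in disguise, and sums over \<open>K\<close> with coefficients
  (u|v_k) can be contracted.\<close>

lemma frm_u_om: assumes "u \<in> g (- (1/2))" "w \<in> g (1/2)" shows "frm u w = om (br e u) w"
proof -
  have "om (br e u) w = frm (br f (br e u)) w" by (simp add: om_def frm_invariant)
  then show ?thesis using assms by (simp add: br_f_br_e)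
qed

lemma contract_u: assumes "lin G" "u \<in> g (- (1/2))"
  shows "(\<Sum>k\<in>K. Cst (frm u (v k)) * G (v' k)) = - G (br e u)"
    "(\<Sum>k\<in>K. Cst (frm u (v' k)) * G (v k)) = G (br e u)"
  using contract_half[OF assms(1) br_e_mhalf_gr[OF assms(2)]] assms(2)
  by (simp_all add: frm_u_om cong: sum.cong)

lemma frm_x_br: assumes "u \<in> g (- (1/2))" shows "frm x (br u w) = - (1/2) * frm u w"
proof -
  have "frm x (br u w) = frm (br x u) w" by (simp add: frm_invariant)
  then show ?thesis using assms by (simp add: gr_def frm_scl frm_left.minus)
qed

text \<open>[w, y] lies in Fe, on which a acts by the scalar (x|a)/(x|x). Elements of g_0^f
  therefore preserve \<open>om\<close>; for general a the scalar is the source of the correction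
  term in \<open>contract_br\<close>.\<close>

lemma om_br_zero: assumes "a \<in> g 0" "w \<in> g (1/2)" "y \<in> g (1/2)"
  shows "om w (br a y) = frm x a / frm x x * om w y - om (br a w) y"
proof -
  have "om (br a w) y + om w (br a y) = frm f (br a (br w y))"
    by (simp add: om_def br_jacobi[of a w y] frm_add_right)
  also have "\<dots> = om w y / (2 * frm x x) * frm f (br a e)"
    using assms by (simp add: br_half_half br_scl_right frm_scl_right)
  also have "\<dots> = frm x a / frm x x * om w y"
    using assms by (simp add: br_zero_e frm_scl_right frm_f_e)
  finally show ?thesis by (simp add: algebra_simps)
qed

section \<open>The generators lie in the W-algebra\<close>

abbreviation L :: "('a, 'i) dpoly" where "L \<equiv> L_gen J0 al al' K v v'"
abbreviation ph :: "'g \<Rightarrow> ('a, 'i) dpoly" where "ph \<equiv> phi_gen K v v'"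
abbreviation ps :: "'g \<Rightarrow> ('a, 'i) dpoly" where "ps \<equiv> psi_gen K v v'"

lemma g0f_gr [simp]: "a \<in> g0f \<Longrightarrow> a \<in> g 0"
  by (simp add: g0f_def)

lemma g0f_f [simp]: "a \<in> g0f \<Longrightarrow> br a f = 0" "a \<in> g0f \<Longrightarrow> br f a = 0"
  using br_skew[of f a] by (simp_all add: g0f_def del: g0f_gr)

lemma f_nonzero: "f \<noteq> 0"
  using frm_e_f by (auto simp: frm_right.zero)

lemma g0f_x [simp]: assumes "a \<in> g0f" shows "frm x a = 0"
  using br_zero_f[of a] assms f_nonzero by (auto simp: minus_equation_iff[of _ 0])

lemma g0f_e [simp]: assumes "a \<in> g0f" shows "br a e = 0" "br e a = 0"
  using br_zero_e[of a] assms br_skew[of e a] by simp_all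

lemma g0fI: assumes "a \<in> g 0" "frm x a = 0" shows "a \<in> g0f"
  unfolding g0f_def mem_Collect_eq using br_zero_f[OF assms(1)] assms by simp

lemma sum_const_poly: "(\<Sum>k\<in>A. [:p k:]) = [:\<Sum>k\<in>A. p k:]"
  by (induct A rule: infinite_finite_induct) simp_all

lemma Cst_half_double: "Cst (1/2) * (2 * p) = (p :: ('a, 'i) dpoly)"
proof -
  have "Cst (1/2) * (2 * p) = Cst (1/2 * 2) * p"
    by (simp only: Cst_mult Cst_numeral mult.assoc)
  then show ?thesis by simp
qed

lemma contract_br: assumes "lin G" "a \<in> g 0" "w \<in> g (1/2)"
  shows "(\<Sum>k\<in>K. Cst (om w (br a (v k))) * G (v' k)) = G (br a w) - Cst (frm x a / frm x x) * G w"
proof -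
  define c where "c = frm x a / frm x x"
  have "(\<Sum>k\<in>K. Cst (om w (br a (v k))) * G (v' k))
    = (\<Sum>k\<in>K. Cst c * (Cst (om w (v k)) * G (v' k)) - Cst (om (br a w) (v k)) * G (v' k))"
    using assms by (intro sum.cong) (simp_all add: om_br_zero Cst_diff Cst_mult left_diff_distrib mult.assoc flip: c_def)
  then show ?thesis using assms contract_half[OF assms(1)]
    by (simp add: sum_subtractf flip: sum_distrib_left c_def)
qed

lemma gr_ge_one:
  assumes "b \<in> gr_ge x 1" obtains w d where "w \<in> g (1/2)" "b = w + scl d e"
proof -
  have "\<exists>w d. w \<in> g (1/2) \<and> b = w + scl d e"
    using assms unfolding gr_ge_def
  proof (induction b rule: span_induct_alt)
    case base
    show ?case by (rule exI[of _ 0], rule exI[of _ 0]) simp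
  next
    case (step r b y)
    obtain k where k: "k \<ge> 1" "b \<in> g (of_int k / 2)" using step(1) by auto
    have "\<exists>w d. w \<in> g (1/2) \<and> b = w + scl d e"
    proof (cases "k = 1 \<or> k = 2")
      case True
      then show ?thesis
      proof
        assume "k = 1"
        then have "b \<in> g (1/2) \<and> b = b + scl 0 e" using k(2) by simp
        then show ?thesis by blast
      next
        assume "k = 2"
        then have "b \<in> g 1" using k(2) by simp
        then obtain d where "b = scl d e" by (rule gr_one)
        then have "0 \<in> g (1/2) \<and> b = 0 + scl d e" by simp
        then show ?thesis by blast
      qed
    next
      case False
      then have "b = 0" using gr_half_int_trivial[OF k(2)] k(1) by simp
      then show ?thesis by (intro exI[of _ 0]) auto
    qed
    then obtain w d w' d' where "w \<in> g (1/2)" "w' \<in> g (1/2)" "b = w + scl d e" "y = w' + scl d' e"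
      using step(2) by blast
    then show ?case
      by (intro exI[of _ "scl r w + w'"] exI[of _ "r * d + d'"]) (simp add: gr_add gr_scl algebra_simps)
  qed
  then show ?thesis using that by blast
qed

lemma gr_ge_oneI: "w \<in> g (1/2) \<Longrightarrow> w \<in> gr_ge x 1" "e \<in> gr_ge x 1"
  using e_gr UN_I[of 1 "{1..}" w "\<lambda>k. g (of_int k / 2)"] UN_I[of 2 "{1..}" e "\<lambda>k. g (of_int k / 2)"]
  unfolding gr_ge_def by (auto intro: span_base)

lemma W_iff: "q \<in> W \<longleftrightarrow> q \<in> V \<and> (\<forall>w\<in>g (1/2). WB (emb w) q = 0) \<and> WB (emb e) q = 0"
proof
  assume "q \<in> W"
  then show "q \<in> V \<and> (\<forall>w\<in>g (1/2). WB (emb w) q = 0) \<and> WB (emb e) q = 0"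
    by (simp add: W_algebra_def gr_ge_oneI)
next
  assume q: "q \<in> V \<and> (\<forall>w\<in>g (1/2). WB (emb w) q = 0) \<and> WB (emb e) q = 0"
  have "WB (emb b) q = 0" if b: "b \<in> gr_ge x 1" for b
  proof -
    obtain w d where "w \<in> g (1/2)" "b = w + scl d e" using gr_ge_one[OF b] .
    with q show ?thesis by (simp add: WB_emb_add WB_emb_scl)
  qed
  with q show "q \<in> W" by (simp add: W_algebra_def)
qed

text \<open>Both factors of the quadratic term contract to [a, w], so the coefficient 1/2 is what
  cancels [w, a] from the linear term.\<close>

lemma T_phi_half: assumes a: "a \<in> g0f" and w: "w \<in> g (1/2)" shows "WB (emb w) (ph a) = 0"
proof -
  have "WB (emb w) (\<Sum>k\<in>K. emb (br a (v k)) * emb (v' k))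
      = [:(\<Sum>k\<in>K. Cst (om w (br a (v k))) * emb (v' k)) + (\<Sum>k\<in>K. Cst (om w (v' k)) * emb (br a (v k))):]"
    using assms by (simp add: WB_sum_right WB_mult_right T_half_half sum_const_poly sum.distrib mult.commute
        cong: sum.cong)
  also have "(\<Sum>k\<in>K. Cst (om w (br a (v k))) * emb (v' k)) = emb (br a w)"
    using contract_br[of emb a w] assms by (simp add: lin_def lin_simps)
  also have "(\<Sum>k\<in>K. Cst (om w (v' k)) * emb (br a (v k))) = emb (br a w)"
    by (rule contract_half(3)[OF _ w]) (simp add: lin_def lin_simps)
  finally show ?thesis using assms
    by (simp add: phi_gen_def WB_add_right WB_Cst_mult_right T_half_zero distrib_left Cst_half_double
        br_skew[of w a] emb.minus)
qed

lemma T_phi_e: assumes a: "a \<in> g0f" shows "WB (emb e) (ph a) = 0"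
  using assms by (simp add: phi_gen_def WB_add_right WB_Cst_mult_right WB_sum_right WB_mult_right T_e_zero T_e_half
      cong: sum.cong)

text \<open>\<open>br u (v h)\<close> lies in g_0 but in general not in g_0^f, so
  \<open>contract_br\<close> leaves a multiple of w; summed over h it becomes the product with
  [e, u].\<close>

lemma contract_cubic: assumes u: "u \<in> g (- (1/2))" and w: "w \<in> g (1/2)"
  shows "(\<Sum>h\<in>K. \<Sum>k\<in>K. Cst (om w (br (br u (v h)) (v k))) * (emb (v' h) * emb (v' k)))
    = (\<Sum>k\<in>K. emb (br (br u (v k)) w) * emb (v' k)) - Cst (1 / (2 * frm x x)) * (emb (br e u) * emb w)"
proof -
  have "(\<Sum>h\<in>K. \<Sum>k\<in>K. Cst (om w (br (br u (v h)) (v k))) * (emb (v' h) * emb (v' k)))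
    = (\<Sum>h\<in>K. emb (v' h) * (\<Sum>k\<in>K. Cst (om w (br (br u (v h)) (v k))) * emb (v' k)))"
    by (simp add: sum_distrib_left algebra_simps)
  also have "\<dots> = (\<Sum>h\<in>K. emb (v' h) * (emb (br (br u (v h)) w) - Cst (frm x (br u (v h)) / frm x x) * emb w))"
    using assms by (intro sum.cong refl arg_cong2[where f = "(*)"] contract_br) (simp_all add: lin_def lin_simps)
  also have "\<dots> = (\<Sum>h\<in>K. emb (br (br u (v h)) w) * emb (v' h)
      + Cst (1 / (2 * frm x x)) * emb w * (Cst (frm u (v h)) * emb (v' h)))"
  proof (rule sum.cong)
    fix h
    have "Cst (frm x (br u (v h)) / frm x x) = - (Cst (1 / (2 * frm x x)) * (Cst (frm u (v h)) :: ('a, 'i) dpoly))"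
      by (simp add: frm_x_br[OF u] flip: Cst_mult)
    then show "emb (v' h) * (emb (br (br u (v h)) w) - Cst (frm x (br u (v h)) / frm x x) * emb w)
      = emb (br (br u (v h)) w) * emb (v' h) + Cst (1 / (2 * frm x x)) * emb w * (Cst (frm u (v h)) * emb (v' h))"
      by (simp add: algebra_simps)
  qed simp
  also have "\<dots> = (\<Sum>k\<in>K. emb (br (br u (v k)) w) * emb (v' k)) - Cst (1 / (2 * frm x x)) * (emb (br e u) * emb w)"
    unfolding sum.distrib sum_distrib_left[symmetric] using contract_u(1)[of emb u] u
    by (simp add: lin_def lin_simps mult.assoc mult.commute)
  finally show ?thesis .
qed

text \<open>Jacobi moves w past \<open>v k\<close>. The remainder [u, [w, v_k]] is a multiple of
  [u, e], and its sum is opposite to the correction in \<open>contract_cubic\<close>, so that the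
  two cancel in the next lemma.\<close>

lemma contract_cubic': assumes u: "u \<in> g (- (1/2))" and w: "w \<in> g (1/2)"
  shows "(\<Sum>k\<in>K. emb (br (br u w) (v k)) * emb (v' k))
    = (\<Sum>k\<in>K. emb (br (br u (v k)) w) * emb (v' k)) + Cst (1 / (2 * frm x x)) * (emb (br e u) * emb w)"
proof -
  have "emb (br (br u w) (v k)) = emb (br (br u (v k)) w) - Cst (1 / (2 * frm x x)) * emb (br e u) * Cst (om w (v k))"
    if "k \<in> K" for k
  proof -
    have "br u (br w (v k)) = br (br u w) (v k) + br w (br u (v k))" by (rule br_jacobi)
    then have "br (br u w) (v k) = br (br u (v k)) w + br u (br w (v k))"
      by (simp add: br_skew[of w "br u (v k)"])
    also have "br u (br w (v k)) = scl (- (om w (v k) / (2 * frm x x))) (br e u)"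
      using w that by (simp add: br_half_half br_scl_right br_skew[of u e])
    finally have "emb (br (br u w) (v k))
        = emb (br (br u (v k)) w) + Cst (- (om w (v k) / (2 * frm x x))) * emb (br e u)"
      by (simp only: emb_add emb_scl)
    moreover have "Cst (- (om w (v k) / (2 * frm x x)))
        = - (Cst (1 / (2 * frm x x)) * (Cst (om w (v k)) :: ('a, 'i) dpoly))"
      by (simp flip: Cst_mult)
    ultimately show ?thesis by (simp only: mult.assoc mult.commute) simp
  qed
  then have "(\<Sum>k\<in>K. emb (br (br u w) (v k)) * emb (v' k)) = (\<Sum>k\<in>K. emb (br (br u (v k)) w) * emb (v' k)
      - Cst (1 / (2 * frm x x)) * emb (br e u) * (Cst (om w (v k)) * emb (v' k)))"
    by (intro sum.cong) (simp_all add: left_diff_distrib mult.assoc)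
  then show ?thesis using contract_half(2)[of emb w] w
    by (simp add: lin_def lin_simps sum_subtractf mult.assoc flip: sum_distrib_left)
qed

lemma T_psi_half: assumes u: "u \<in> g (- (1/2))" and w: "w \<in> g (1/2)" shows "WB (emb w) (ps u) = 0"
proof -
  let ?Y = "\<lambda>h k. br (br u (v h)) (v k)"
  let ?Z = "\<Sum>k\<in>K. emb (br (br u (v k)) w) * emb (v' k)"
  let ?r = "Cst (1 / (2 * frm x x)) * (emb (br e u) * emb w)"
  have "WB (emb w) (\<Sum>h\<in>K. \<Sum>k\<in>K. emb (?Y h k) * emb (v' h) * emb (v' k))
    = [:(\<Sum>h\<in>K. \<Sum>k\<in>K. Cst (om w (?Y h k)) * (emb (v' h) * emb (v' k)))
        + (\<Sum>h\<in>K. \<Sum>k\<in>K. Cst (om w (v' h)) * (emb (?Y h k) * emb (v' k)))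
        + (\<Sum>h\<in>K. \<Sum>k\<in>K. Cst (om w (v' k)) * (emb (?Y h k) * emb (v' h))):]"
    using assms by (simp add: WB_sum_right WB_mult_right R_mult T_half_half sum_const_poly sum.distrib algebra_simps
        cong: sum.cong)
  also have "(\<Sum>h\<in>K. \<Sum>k\<in>K. Cst (om w (v' h)) * (emb (?Y h k) * emb (v' k))) = ?Z + ?r"
  proof (subst sum.swap)
    have "(\<Sum>k\<in>K. \<Sum>h\<in>K. Cst (om w (v' h)) * (emb (?Y h k) * emb (v' k)))
        = (\<Sum>k\<in>K. emb (br (br u w) (v k)) * emb (v' k))"
      by (intro sum.cong refl contract_half(3)[OF _ w]) (simp add: lin_def lin_simps algebra_simps)
    then show "(\<Sum>k\<in>K. \<Sum>h\<in>K. Cst (om w (v' h)) * (emb (?Y h k) * emb (v' k))) = ?Z + ?r"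
      using contract_cubic'[OF u w] by simp
  qed
  also have "(\<Sum>h\<in>K. \<Sum>k\<in>K. Cst (om w (v' k)) * (emb (?Y h k) * emb (v' h))) = ?Z"
    by (intro sum.cong refl contract_half(3)[OF _ w]) (simp add: lin_def lin_simps algebra_simps)
  also have "(\<Sum>h\<in>K. \<Sum>k\<in>K. Cst (om w (?Y h k)) * (emb (v' h) * emb (v' k))) = ?Z - ?r"
    by (rule contract_cubic[OF u w])
  \<comment> \<open>One \<open>?Z\<close> for each of the three factors: this is the reason for the
    coefficient 1/3 in \<open>psi_gen\<close>.\<close>
  also have "?Z - ?r + (?Z + ?r) + ?Z = Cst 3 * ?Z" by (simp add: Cst_numeral)
  finally have cubic: "WB (emb w) (\<Sum>h\<in>K. \<Sum>k\<in>K. emb (?Y h k) * emb (v' h) * emb (v' k)) = [:Cst 3 * ?Z:]" .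
  have "WB (emb w) (\<Sum>k\<in>K. emb (br u (v k)) * emb (v' k))
    = [:(\<Sum>k\<in>K. emb (br w (br u (v k))) * emb (v' k)) + (\<Sum>k\<in>K. Cst (om w (v' k)) * emb (br u (v k))):]"
    using assms by (simp add: WB_sum_right WB_mult_right T_half_half T_half_zero sum_const_poly sum.distrib mult.commute
        cong: sum.cong)
  also have "(\<Sum>k\<in>K. emb (br w (br u (v k))) * emb (v' k)) = - ?Z"
    by (simp add: br_skew[of w] emb.minus sum_negf)
  also have "(\<Sum>k\<in>K. Cst (om w (v' k)) * emb (br u (v k))) = emb (br u w)"
    by (rule contract_half(3)[OF _ w]) (simp add: lin_def lin_simps)
  finally have quad: "WB (emb w) (\<Sum>k\<in>K. emb (br u (v k)) * emb (v' k)) = [:- ?Z + emb (br u w):]" .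
  \<comment> \<open>The \<lambda>-terms of u and of the derivative of [e, u] cancel; the last
    summand of \<open>psi_gen\<close> is there for this.\<close>
  have "frm w u = - om w (br e u)"
    using assms by (simp add: frm_sym[of w] frm_u_om om_skew[of w])
  then have "WB (emb w) (emb u) + WB (emb w) (D (emb (br e u))) = [:emb (br w u):]"
    using assms by (simp add: WB_D_right T_half_half T_half_mhalf lamD_const Cst_minus)
  moreover have "Cst (1/3) * (Cst 3 * ?Z) = ?Z"
    by (simp add: Cst_mult[symmetric] flip: mult.assoc)
  moreover have "WB (emb w) (ps u) = WB (emb w) (emb u) + WB (emb w) (D (emb (br e u)))
      + smult (Cst (1/3)) [:Cst 3 * ?Z:] + [:- ?Z + emb (br u w):]"
    by (simp only: psi_gen_def WB_add_right WB_Cst_mult_right cubic quad add_ac)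
  ultimately show ?thesis by (simp add: br_skew[of w u])
qed

lemma T_psi_e: assumes u: "u \<in> g (- (1/2))" shows "WB (emb e) (ps u) = 0"
proof -
  have "WB (emb e) (\<Sum>k\<in>K. emb (br u (v k)) * emb (v' k)) = [:\<Sum>k\<in>K. Cst (frm u (v k)) * emb (v' k):]"
    using assms by (simp add: WB_sum_right WB_mult_right T_e_zero T_e_half sum_const_poly frm_x_br mult.commute
        cong: sum.cong)
  also have "(\<Sum>k\<in>K. Cst (frm u (v k)) * emb (v' k)) = - emb (br e u)"
    by (rule contract_u(1)[OF _ u]) (simp add: lin_def lin_simps)
  finally show ?thesis using u
    by (simp add: psi_gen_def WB_add_right WB_Cst_mult_right WB_sum_right WB_mult_right WB_D_right T_e_half T_e_mhalf
      cong: sum.cong)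
qed

lemma sum_linear_poly: "(\<Sum>k\<in>A. [:p k, q k:]) = [:\<Sum>k\<in>A. p k, \<Sum>k\<in>A. q k:]"
  by (induct A rule: infinite_finite_induct) simp_all

text \<open>Expanding [w, b] in \<open>v'\<close> gives the coefficients ([[f, v_k], w]|b), so the
  sum over the basis of g_0 collapses to a sum over \<open>K\<close>. In this form it can cancel
  against the term of L with [f, v_k].\<close>

lemma contract_al: assumes w: "w \<in> g (1/2)"
  shows "(\<Sum>j\<in>J0. emb (br w (al j)) * emb (al' j)) = (\<Sum>k\<in>K. emb (br (br f (v k)) w) * emb (v' k))" (is ?A)
    and "(\<Sum>j\<in>J0. emb (br w (al' j)) * emb (al j)) = (\<Sum>k\<in>K. emb (br (br f (v k)) w) * emb (v' k))" (is ?B)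
proof -
  have expand: "emb (br w b) = (\<Sum>k\<in>K. Cst (frm (br (br f (v k)) w) b) * emb (v' k))" if "b \<in> g 0" for b
  proof -
    have "om (v k) (br w b) = frm (br (br f (v k)) w) b" for k
      by (simp add: om_def frm_invariant)
    then show ?thesis
      using contract_half(1)[of emb "br w b"] that w by (simp add: lin_def lin_simps)
  qed
  have lin: "lin emb" by (simp add: lin_def lin_simps)
  have "(\<Sum>j\<in>J0. emb (br w (al j)) * emb (al' j))
      = (\<Sum>j\<in>J0. \<Sum>k\<in>K. emb (v' k) * (Cst (frm (br (br f (v k)) w) (al j)) * emb (al' j)))"
    by (simp add: expand sum_distrib_right sum_distrib_left mult.commute mult.left_commute cong: sum.cong)
  also have "\<dots> = (\<Sum>k\<in>K. emb (v' k) * (\<Sum>j\<in>J0. Cst (frm (br (br f (v k)) w) (al j)) * emb (al' j)))"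
    by (subst sum.swap) (simp add: sum_distrib_left)
  also have "\<dots> = (\<Sum>k\<in>K. emb (v' k) * emb (br (br f (v k)) w))"
    using w by (intro sum.cong refl arg_cong2[where f = "(*)"] contract_g0(2)[OF lin]) simp
  finally show ?A by (simp add: mult.commute)
  have "(\<Sum>j\<in>J0. emb (br w (al' j)) * emb (al j))
      = (\<Sum>j\<in>J0. \<Sum>k\<in>K. emb (v' k) * (Cst (frm (br (br f (v k)) w) (al' j)) * emb (al j)))"
    by (simp add: expand sum_distrib_right sum_distrib_left mult.commute mult.left_commute cong: sum.cong)
  also have "\<dots> = (\<Sum>k\<in>K. emb (v' k) * (\<Sum>j\<in>J0. Cst (frm (br (br f (v k)) w) (al' j)) * emb (al j)))"
    by (subst sum.swap) (simp add: sum_distrib_left)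
  also have "\<dots> = (\<Sum>k\<in>K. emb (v' k) * emb (br (br f (v k)) w))"
    using w by (intro sum.cong refl arg_cong2[where f = "(*)"] contract_g0(3)[OF lin]) simp
  finally show ?B by (simp add: mult.commute)
qed

lemma sum_v_v': "(\<Sum>k\<in>K. emb (v' k) * emb (v k)) = 0"
  using half_swap_sym[of "\<lambda>a b. emb b * emb a"]
  by (simp add: lin_def lin_simps algebra_simps)

lemma br_x_half [simp]: "w \<in> g (1/2) \<Longrightarrow> br w x = scl (- (1/2)) w"
  by (simp add: br_skew[of w x] gr_def)

lemma T_L_half: assumes w: "w \<in> g (1/2)" shows "WB (emb w) L = 0"
proof -
  let ?Z = "\<Sum>k\<in>K. emb (br (br f (v k)) w) * emb (v' k)"
  have sugawara: "WB (emb w) (\<Sum>j\<in>J0. emb (al j) * emb (al' j)) = [:2 * ?Z:]"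
    using w contract_al[OF w]
    by (simp add: WB_sum_right WB_mult_right T_half_zero sum_const_poly sum.distrib mult.commute cong: sum.cong)
  have frm: "frm w (br f y) = - om w y" for y
    by (simp add: om_def br_skew[of w f] flip: frm_invariant)
  have "WB (emb w) (\<Sum>k\<in>K. emb (v' k) * emb (br f (v k)))
    = [:(\<Sum>k\<in>K. Cst (om w (v' k)) * emb (br f (v k))) - ?Z, - (\<Sum>k\<in>K. Cst (om w (v k)) * emb (v' k)):]"
    using w by (simp add: WB_sum_right WB_mult_right T_half_half T_half_mhalf sum_linear_poly sum.distrib frm
        br_skew[of w "br f _"] sum_negf sum_subtractf mult.commute cong: sum.cong)
  also have "\<dots> = [:emb (br f w) - ?Z, emb w:]"
    using contract_half(3)[of "\<lambda>y. emb (br f y)" w] contract_half(2)[of emb w] w by (simp add: lin_def lin_simps)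
  finally have quad: "WB (emb w) (\<Sum>k\<in>K. emb (v' k) * emb (br f (v k))) = [:emb (br f w) - ?Z, emb w:]" .
  have "WB (emb w) (\<Sum>k\<in>K. emb (v' k) * D (emb (v k)))
    = [:\<Sum>k\<in>K. Cst (om w (v' k)) * D (emb (v k)), \<Sum>k\<in>K. Cst (om w (v k)) * emb (v' k):]"
    using w by (simp add: WB_sum_right WB_mult_right WB_D_right R_D T_half_half sum_linear_poly lamD_const
        mult.commute cong: sum.cong)
  also have "\<dots> = [:D (emb w), - emb w:]"
    using contract_half(3)[of "\<lambda>y. D (emb y)" w] contract_half(2)[of emb w] w by (simp add: lin_def lin_simps)
  finally have ferm: "WB (emb w) (\<Sum>k\<in>K. emb (v' k) * D (emb (v k))) = [:D (emb w), - emb w:]" .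
  have "WB (emb w) (D (emb x)) = [:- (Cst (1/2) * D (emb w)), - (Cst (1/2) * emb w):]"
    using w x_gr by (simp add: WB_D_right T_half_zero lamD_const emb_scl D.minus D_Cst_mult)
  \<comment> \<open>The cancellations: \<open>?Z\<close> of the g_0-part against the mixed term,
    [w, f] against [f, w], \<partial>w with -1/2 + 1/2, and \<lambda>w with -1/2 + 1 - 1/2.\<close>
  then have "WB (emb w) L = [:emb (br w f):] + [:- (Cst (1/2) * D (emb w)), - (Cst (1/2) * emb w):]
      + smult (Cst (1/2)) [:2 * ?Z:] + [:emb (br f w) - ?Z, emb w:] + smult (Cst (1/2)) [:D (emb w), - emb w:]"
    unfolding L_gen_def WB_add_right WB_Cst_mult_right sugawara quad ferm T_half_f[OF w] by simp
  moreover have "emb w = Cst (1/2) * emb w + Cst (1/2) * emb w"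
    using Cst_half_double[of "emb w"] by (simp only: mult_2 distrib_left)
  ultimately show ?thesis
    by (simp add: br_skew[of w f] Cst_half_double)
qed

lemma T_L_e: "WB (emb e) L = 0"
proof -
  have "WB (emb e) (\<Sum>j\<in>J0. emb (al j) * emb (al' j))
    = [:(\<Sum>j\<in>J0. Cst (frm x (al j)) * emb (al' j)) * Cst (-2) + (\<Sum>j\<in>J0. Cst (frm x (al' j)) * emb (al j)) * Cst (-2):]"
    by (simp add: WB_sum_right WB_mult_right T_e_zero sum_const_poly sum.distrib sum_distrib_left sum_negf sum_subtractf
        Cst_mult algebra_simps cong: sum.cong)
  also have "\<dots> = [:- (2 * (2 * emb x)):]"
    using contract_g0[of emb x] x_gr by (simp add: lin_def lin_simps Cst_numeral)
  finally have sugawara: "WB (emb e) (\<Sum>j\<in>J0. emb (al j) * emb (al' j)) = [:- (2 * (2 * emb x)):]" .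
  have quad: "WB (emb e) (\<Sum>k\<in>K. emb (v' k) * emb (br f (v k))) = 0"
    by (simp add: WB_sum_right WB_mult_right T_e_half T_e_mhalf br_e_br_f sum_const_poly sum_v_v' cong: sum.cong)
  have ferm: "WB (emb e) (\<Sum>k\<in>K. emb (v' k) * D (emb (v k))) = 0"
    by (simp add: WB_sum_right WB_mult_right T_e_half WB_D_right cong: sum.cong)
  have "WB (emb e) (D (emb x)) = [:0, - Cst (2 * frm x x):]"
    using x_gr by (simp add: WB_D_right T_e_zero lamD_const D.minus)
  then show ?thesis
    unfolding L_gen_def WB_add_right WB_Cst_mult_right sugawara quad ferm T_e_f
    using Cst_half_double[of "2 * emb x"] by (simp add: Cst_numeral)
qed

lemma R_ph [simp]: "a \<in> g0f \<Longrightarrow> R (ph a) = ph a"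
  by (simp add: phi_gen_def R_add R_mult R.sum cong: sum.cong)

lemma R_ps [simp]: "u \<in> g (- (1/2)) \<Longrightarrow> R (ps u) = ps u"
  by (simp add: psi_gen_def R_add R_mult R.sum R_D cong: sum.cong)

lemma R_L [simp]: "R L = L"
  using x_gr by (simp add: L_gen_def R_add R_mult R.sum R_D cong: sum.cong)

lemma ph_W: "a \<in> g0f \<Longrightarrow> ph a \<in> W" and ps_W: "u \<in> g (- (1/2)) \<Longrightarrow> ps u \<in> W" and L_W: "L \<in> W"
  by (simp_all add: W_iff V_iff T_phi_half T_phi_e T_psi_half T_psi_e T_L_half T_L_e)

lemma W_half: "q \<in> W \<Longrightarrow> w \<in> g (1/2) \<Longrightarrow> WB (emb w) q = 0"
  and W_e: "q \<in> W \<Longrightarrow> WB (emb e) q = 0"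
  and W_R: "q \<in> W \<Longrightarrow> R q = q"
  by (simp_all add: W_iff V_iff)

section \<open>The Virasoro element\<close>

text \<open>Invariance of the form makes the coefficients (P_m|[P_n, b]) antisymmetric in m and n,
  while \<open>G\<close> is symmetric; the sum is its own negative.\<close>

lemma casimir_invariant:
  fixes N :: "'n set" and P Q :: "'n \<Rightarrow> 'g"
  assumes complete: "\<And>b. (\<Sum>n\<in>N. scl (frm (P n) b) (Q n)) = b"
    and lin: "\<And>b. lin (\<lambda>a. G a b)" and sym: "\<And>a b. G a b = G b a"
  shows "(\<Sum>n\<in>N. G (br (P n) b) (Q n)) = 0"
proof -
  have expand: "G (br (P n) b) (Q n) = (\<Sum>m\<in>N. Cst (frm (P m) (br (P n) b)) * G (Q m) (Q n))" for n
    using lin_sum[OF lin, of "\<lambda>m. frm (P m) (br (P n) b)" Q N "Q n"] by (simp add: complete)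
  have anti: "frm (P m) (br (P n) b) = - frm (P n) (br (P m) b)" for m n
    by (simp add: br_skew[of "P m" "P n"] flip: frm_invariant)
  let ?S = "\<Sum>n\<in>N. \<Sum>m\<in>N. Cst (frm (P m) (br (P n) b)) * G (Q m) (Q n)"
  have flip: "Cst (frm (P n) (br (P m) b)) * G (Q n) (Q m) = - (Cst (frm (P m) (br (P n) b)) * G (Q m) (Q n))" for m n
    by (simp only: anti[of n m] sym[of "Q n" "Q m"] Cst_minus mult_minus_left)
  have "?S = (\<Sum>n\<in>N. \<Sum>m\<in>N. Cst (frm (P n) (br (P m) b)) * G (Q n) (Q m))"
    by (rule sum.swap)
  also have "\<dots> = (\<Sum>n\<in>N. \<Sum>m\<in>N. - (Cst (frm (P m) (br (P n) b)) * G (Q m) (Q n)))"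
    by (intro sum.cong refl flip)
  also have "\<dots> = - ?S" by (simp add: sum_negf)
  finally have "?S + ?S = 0" by (simp only: eq_neg_iff_add_eq_0)
  then have "Cst (1/2) * (2 * ?S) = 0" by (simp only: mult_2 mult_zero_right)
  then show ?thesis by (simp only: Cst_half_double expand)
qed

lemma casimir_swap:
  fixes N :: "'n set" and P Q :: "'n \<Rightarrow> 'g"
  assumes complete: "\<And>b. (\<Sum>n\<in>N. scl (frm (P n) b) (Q n)) = b"
    and lin: "\<And>b. lin (\<lambda>a. G a b)" "\<And>a. lin (G a)"
  shows "(\<Sum>n\<in>N. G (Q n) (P n)) = (\<Sum>n\<in>N. G (P n) (Q n))"
proof -
  have "(\<Sum>n\<in>N. G (Q n) (P n)) = (\<Sum>n\<in>N. \<Sum>m\<in>N. Cst (frm (P m) (P n)) * G (Q n) (Q m))"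
    using lin_sum[OF lin(2), of _ "\<lambda>m. frm (P m) (P _)" Q N] by (simp add: complete)
  also have "\<dots> = (\<Sum>m\<in>N. \<Sum>n\<in>N. Cst (frm (P n) (P m)) * G (Q n) (Q m))"
    by (subst sum.swap) (simp add: frm_sym)
  also have "\<dots> = (\<Sum>n\<in>N. G (P n) (Q n))"
    using lin_sum[OF lin(1), of "\<lambda>m. frm (P m) (P _)" Q N] by (simp add: complete)
  finally show ?thesis .
qed

text \<open>Index set of a homogeneous pair of dual bases of g: \<open>J0\<close> for g_0,
  \<open>K\<close> twice for the pairs \<open>v' k\<close>, [f, v_k] in both orders, and two indices
  for e and f, scaled by 1/(e|f). Built from the given bases rather than from \<open>bas\<close>,
  the Casimir element can be compared with L summand by summand.\<close>

definition cas_index :: "('j + 'k + 'k + bool) set" where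
  "cas_index = J0 <+> (K <+> (K <+> UNIV))"

definition cas_left :: "'j + 'k + 'k + bool \<Rightarrow> 'g" where
  "cas_left = case_sum al (case_sum v' (case_sum (\<lambda>k. br f (v k)) (\<lambda>b. if b then e else f)))"

definition cas_right :: "'j + 'k + 'k + bool \<Rightarrow> 'g" where
  "cas_right = case_sum al' (case_sum (\<lambda>k. br f (v k)) (case_sum v' (\<lambda>b. scl (1 / (2 * frm x x)) (if b then f else e))))"

lemma sum_cas_index: "(\<Sum>n\<in>cas_index. G (cas_left n) (cas_right n)) = (\<Sum>j\<in>J0. G (al j) (al' j)) + (\<Sum>k\<in>K. G (v' k) (br f (v k)))
   + (\<Sum>k\<in>K. G (br f (v k)) (v' k)) + (G e (scl (1 / (2 * frm x x)) f) + G f (scl (1 / (2 * frm x x)) e))"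
  by (simp add: cas_index_def cas_left_def cas_right_def sum.Plus UNIV_bool add.assoc add.commute[of "G f _"])

text \<open>A homogeneous b pairs only with the block of opposite degree, so one block of
  \<open>sum_cas_index\<close> survives in each case.\<close>

lemma cas_index_complete: "(\<Sum>n\<in>cas_index. scl (frm (cas_left n) b) (cas_right n)) = b"
proof (induction b rule: gr_sum_induct)
  case (hom i b)
  have zero: "frm a b = 0" if "a \<in> g j" "j + i \<noteq> 0" for a j
    using frm_gr[OF that(1) hom(2) that(2)] .
  have zero0: "(\<Sum>j\<in>J0. scl (frm (al j) b) (al' j)) = 0" if "i \<noteq> 0"
    by (rule sum.neutral) (use zero[of _ 0] that in auto)
  have zero1: "(\<Sum>k\<in>K. scl (frm (v' k) b) (br f (v k))) = 0" if "1/2 + i \<noteq> 0"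
    by (rule sum.neutral) (use zero[of _ "1/2"] that in auto)
  have zero2: "(\<Sum>k\<in>K. scl (frm (br f (v k)) b) (v' k)) = 0" if "- (1/2) + i \<noteq> 0"
    by (rule sum.neutral) (use zero[of _ "- (1/2)"] that in auto)
  have half: "- (1/2) + - (1/2) \<noteq> (0::'a)" "1/2 + 1/2 \<noteq> (0::'a)" "- (1/2) + -1 \<noteq> (0::'a)" "1/2 + -1 \<noteq> (0::'a)"
    "1/2 + 0 \<noteq> (0::'a)" "1/2 + 1 \<noteq> (0::'a)" "- (1/2) + 1 \<noteq> (0::'a)"
    by (simp_all only: half_cancel) (simp_all add: field_simps)
  note sum_cas_index' = sum_cas_index[of "\<lambda>p q. scl (frm p b) q"]
  consider "i = - 1" | "i = - (1/2)" | "i = 0" | "i = 1/2" | "i = 1" using hom(1) by blast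
  then show ?case
  proof cases
    case 1
    obtain c where b: "b = scl c f" using hom(2) gr_minus_one unfolding 1 by blast
    have "frm f b = 0" using zero[OF f_gr] 1 by simp
    moreover have "i \<noteq> 0" "1/2 + i \<noteq> 0" "- (1/2) + i \<noteq> 0" using 1 half by simp_all
    ultimately show ?thesis
      unfolding sum_cas_index'
      by (simp add: zero0 zero1 zero2) (simp add: b frm_scl_right frm_e_f)
  next
    case 2
    have b: "b \<in> g (- (1/2))" using hom(2) unfolding 2 .
    have "frm f b = 0" "frm e b = 0" using zero[OF f_gr] zero[OF e_gr] 2 by (simp_all add: field_simps)
    moreover have "i \<noteq> 0" "- (1/2) + i \<noteq> 0" using 2 half by simp_all
    moreover have "(\<Sum>k\<in>K. scl (frm (v' k) b) (br f (v k))) = br f (\<Sum>k\<in>K. scl (om (br e b) (v' k)) (v k))"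
      using b by (simp add: br_right.sum br_scl_right frm_sym[of "v' _" b] frm_u_om cong: sum.cong)
    moreover have "\<dots> = b" using b by (simp add: expand_half br_f_br_e)
    ultimately show ?thesis unfolding sum_cas_index' by (simp add: zero0 zero2)
  next
    case 3
    have b: "b \<in> g 0" using hom(2) unfolding 3 .
    have "frm f b = 0" "frm e b = 0" using zero[OF f_gr] zero[OF e_gr] 3 by simp_all
    moreover have "1/2 + i \<noteq> 0" "- (1/2) + i \<noteq> 0" using 3 by simp_all
    ultimately show ?thesis using b unfolding sum_cas_index' by (simp add: zero1 zero2 expand_g0)
  next
    case 4
    have b: "b \<in> g (1/2)" using hom(2) unfolding 4 .
    have "frm f b = 0" "frm e b = 0" using zero[OF f_gr] zero[OF e_gr] 4 by (simp_all add: field_simps)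
    moreover have "i \<noteq> 0" "1/2 + i \<noteq> 0" unfolding 4 using half by simp_all
    moreover have "frm (br f y) b = om y b" for y by (simp add: om_def frm_invariant)
    ultimately show ?thesis using b unfolding sum_cas_index' by (simp add: zero0 zero1 expand_half)
  next
    case 5
    obtain c where b: "b = scl c e" using hom(2) gr_one unfolding 5 by blast
    have "frm e b = 0" using zero[OF e_gr] 5 by simp
    moreover have "i \<noteq> 0" "1/2 + i \<noteq> 0" "- (1/2) + i \<noteq> 0" using 5 half by simp_all
    ultimately show ?thesis
      unfolding sum_cas_index'
      by (simp add: zero0 zero1 zero2) (simp add: b frm_scl_right frm_f_e)
  qed
qed (simp add: frm_add_right scale_left_distrib sum.distrib)

text \<open>In the bracket with b, the sum alone gives every b the weight 1,
  \<open>D (emb x)\<close> shifts it by -i for b in g_i, and z e removes the term z[b, e] that the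
  sum produces.\<close>

definition Lam :: "('a, 'i) dpoly" where
  "Lam = Cst (1/2) * (\<Sum>n\<in>cas_index. emb (cas_left n) * emb (cas_right n)) + D (emb x) + Cst z * emb e"

lemma half_sum_poly: "smult (Cst (1/2)) (P + P) = (P :: ('a, 'i) dpoly poly)"
proof -
  have "Cst (1/2) + Cst (1/2) = (1 :: ('a, 'i) dpoly)" by (simp flip: Cst_add)
  then show ?thesis by (metis smult_add_right smult_add_left smult_1_left)
qed

lemma half_double_poly: "smult (Cst (1/2)) (2 * P) = (P :: ('a, 'i) dpoly poly)"
  by (simp only: mult_2 half_sum_poly)

lemma B_Lam_emb:
  assumes b: "b \<in> g i"
  shows "B Lam (emb b) = [:D (emb b), Cst (1 - i) * emb b + Cst (2 * z * frm e b), - Cst (frm x b):]"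
proof -
  define c where "c b1 b2 = emb (br b1 b2) + Cst (z * frm e (br b1 b2))" for b1 b2
  have B_arrow: "arrow (B (emb p) (emb b)) (emb q)
      = [:c p b * emb q + Cst (frm p b) * D (emb q), Cst (frm p b) * emb q:]" for p q
  proof -
    have "B (emb p) (emb b) = [:c p b:] + pCons 0 [:Cst (frm p b):]" by (simp add: B_emb c_def)
    then show ?thesis by (simp only: arrow_add_left arrow_shift arrow_const) simp
  qed
  have lin_c: "lin (\<lambda>p. c p b * emb q)" "lin (\<lambda>q. c p b * emb q)" for p q
    by (simp_all add: lin_def lin_simps c_def algebra_simps)
  have lin_D: "lin (\<lambda>p. Cst (frm p b) * D (emb q))" "lin (\<lambda>q. Cst (frm p b) * D (emb q))"
     "lin (\<lambda>p. Cst (frm p b) * emb q)" "lin (\<lambda>q. Cst (frm p b) * emb q)" for p q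
    by (simp_all add: lin_def lin_simps algebra_simps)
  have "(\<Sum>n\<in>cas_index. c (cas_left n) b * emb (cas_right n)) = (\<Sum>n\<in>cas_index. emb (br (cas_left n) b) * emb (cas_right n))
      + Cst z * (\<Sum>n\<in>cas_index. Cst (frm (cas_left n) (br b e)) * emb (cas_right n))"
  proof -
    have "frm e (br p b) = frm p (br b e)" for p by (simp add: frm_sym[of e] frm_invariant)
    then show ?thesis by (simp add: c_def sum.distrib sum_distrib_left Cst_mult distrib_right mult.assoc)
  qed
  also have "(\<Sum>n\<in>cas_index. emb (br (cas_left n) b) * emb (cas_right n)) = 0"
    using casimir_invariant[OF cas_index_complete, of "\<lambda>p q. emb p * emb q"]
    by (simp add: lin_def lin_simps algebra_simps)
  also have "(\<Sum>n\<in>cas_index. Cst (frm (cas_left n) (br b e)) * emb (cas_right n)) = emb (br b e)"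
    using lin_sum[of emb "\<lambda>n. frm (cas_left n) (br b e)" cas_right cas_index] by (simp add: lin_def lin_simps cas_index_complete)
  finally have sum1: "(\<Sum>n\<in>cas_index. c (cas_left n) b * emb (cas_right n)) = Cst z * emb (br b e)" by simp
  have sum2: "(\<Sum>n\<in>cas_index. Cst (frm (cas_left n) b) * D (emb (cas_right n))) = D (emb b)"
    using lin_sum[of "\<lambda>q. D (emb q)" "\<lambda>n. frm (cas_left n) b" cas_right cas_index] by (simp add: lin_def lin_simps cas_index_complete)
  have sum3: "(\<Sum>n\<in>cas_index. Cst (frm (cas_left n) b) * emb (cas_right n)) = emb b"
    using lin_sum[of emb "\<lambda>n. frm (cas_left n) b" cas_right cas_index] by (simp add: lin_def lin_simps cas_index_complete)
  have sums: "(\<Sum>n\<in>cas_index. arrow (B (emb (cas_left n)) (emb b)) (emb (cas_right n))) = [:Cst z * emb (br b e) + D (emb b), emb b:]"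
    by (simp add: B_arrow sum_linear_poly sum.distrib sum1 sum2 sum3)
  have sums': "(\<Sum>n\<in>cas_index. arrow (B (emb (cas_right n)) (emb b)) (emb (cas_left n))) = [:Cst z * emb (br b e) + D (emb b), emb b:]"
    using casimir_swap[OF cas_index_complete lin_c] casimir_swap[OF cas_index_complete lin_D(1,2)]
      casimir_swap[OF cas_index_complete lin_D(3,4)]
    by (simp add: B_arrow sum_linear_poly sum.distrib sum1 sum2 sum3)
  have "B (Cst (1/2) * (\<Sum>n\<in>cas_index. emb (cas_left n) * emb (cas_right n))) (emb b)
      = smult (Cst (1/2)) ([:Cst z * emb (br b e) + D (emb b), emb b:] + [:Cst z * emb (br b e) + D (emb b), emb b:])"
    by (subst B.Cst_mult_left) (simp only: B.left.sum B.mult_left sum.distrib sums sums')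
  then have sugawara: "B (Cst (1/2) * (\<Sum>n\<in>cas_index. emb (cas_left n) * emb (cas_right n))) (emb b)
      = [:Cst z * emb (br b e) + D (emb b), emb b:]"
    by (simp only: half_sum_poly)
  define t :: "('a, 'i) dpoly" where "t = Cst (z * frm e b)"
  \<comment> \<open>(e|b) is nonzero only for i = -1. Hence x' and z e contribute equal
    \<lambda>-terms, which add up to 2z(e|b).\<close>
  have "i * frm e b = - frm e b"
    using frm_e_gr[OF b] by (cases "i = - 1") simp_all
  then have "Cst (z * (i * frm e b)) = - t" by (simp add: t_def)
  then have bracket_x: "B (D (emb x)) (emb b) = [:0, t - Cst i * emb b, - Cst (frm x b):]"
    using b by (simp add: B.D_left B_emb gr_def emb_scl frm_scl_right)
  have "frm e (br e b) = 0" by (simp add: br_self flip: frm_invariant)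
  then have bracket_e: "B (Cst z * emb e) (emb b) = [:- (Cst z * emb (br b e)), t:]"
    by (simp add: B.Cst_mult_left B_emb br_skew[of e b] Cst_mult t_def)
  have "2 * z * frm e b = z * frm e b + z * frm e b" by simp
  then have double: "Cst (2 * z * frm e b) = t + t" by (simp only: Cst_add t_def)
  show ?thesis
    unfolding Lam_def B.add_left sugawara bracket_x bracket_e double
    by (simp add: Cst_diff left_diff_distrib)
qed

text \<open>By \<open>WB_mult_left\<close> one factor is bracketed while the other goes through
  \<open>rho\<close>, and a bracketed e or element of g_{1/2} gives 0. So the pair e, f contributes
  f alone, because \<open>rho\<close> sends e/(e|f) to 1, the two orders of each pair from
  \<open>K\<close> contribute the same, and the last sum of L contributes nothing.\<close>

lemma WB_L: assumes q: "q \<in> W" shows "WB L q = WB Lam q"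
proof -
  have arr: "arrow (WB (emb (scl (1 / (2 * frm x x)) b)) q) p = smult (Cst (1 / (2 * frm x x))) (arrow (WB (emb b) q) p)" for b p
    by (simp add: WB_emb_scl arrow_smult)
  have R_sc: "R (emb (scl (1 / (2 * frm x x)) e)) = 1"
    by (simp add: emb_scl R_mult flip: Cst_mult)
  let ?A = "\<Sum>j\<in>J0. arrow (WB (emb (al j)) q) (emb (al' j)) + arrow (WB (emb (al' j)) q) (emb (al j))"
  let ?F = "\<Sum>k\<in>K. arrow (WB (emb (br f (v k))) q) (emb (v' k))"
  have "WB (\<Sum>n\<in>cas_index. emb (cas_left n) * emb (cas_right n)) q = ?A + (?F + ?F) + (WB (emb f) q + WB (emb f) q)"
    using q
    by (simp add: sum_cas_index[of "\<lambda>p q. emb p * emb q"] WB_add_left WB_left.sum WB_mult_left W_half W_e arr R_sc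
        WB_emb_scl flip: Cst_mult cong: sum.cong)
  then have "WB Lam q = smult (Cst (1/2)) ?A + ?F + WB (emb f) q - pCons 0 (WB (emb x) q)"
    using q by (simp add: Lam_def WB_add_left WB_Cst_mult_left WB_D_left W_e smult_add_right half_double_poly)
  moreover have "WB L q = smult (Cst (1/2)) ?A + ?F + WB (emb f) q - pCons 0 (WB (emb x) q)"
    using q by (simp add: L_gen_def WB_add_left WB_Cst_mult_left WB_D_left WB_left.sum WB_mult_left W_half
        cong: sum.cong)
  ultimately show ?thesis by simp
qed

text \<open>\<open>P\<close> collects everything from \<lambda>^2 on. It is carried along explicitly
  because the single summands of a generator need not be primary even when their sum is.\<close>

definition wt :: "'a \<Rightarrow> ('a, 'i) dpoly \<Rightarrow> ('a, 'i) dpoly poly \<Rightarrow> bool" where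
  "wt \<Delta> q P \<longleftrightarrow> R q = q \<and> WB Lam q = pCons (D q) (pCons (Cst \<Delta> * q) P)"

lemma wt_add: "wt \<Delta> p P \<Longrightarrow> wt \<Delta> q Q \<Longrightarrow> wt \<Delta> (p + q) (P + Q)"
  by (simp add: wt_def R_add WB_add_right D_add distrib_left)

lemma wt_zero: "wt \<Delta> 0 0"
  by (simp add: wt_def WB_right.zero)

lemma wt_sum: "(\<And>k. k \<in> A \<Longrightarrow> wt \<Delta> (p k) (P k)) \<Longrightarrow> wt \<Delta> (\<Sum>k\<in>A. p k) (\<Sum>k\<in>A. P k)"
  by (induct A rule: infinite_finite_induct) (simp_all add: wt_add wt_zero)

lemma wt_Cst_mult: "wt \<Delta> p P \<Longrightarrow> wt \<Delta> (Cst c * p) (smult (Cst c) P)"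
  by (simp add: wt_def R_mult WB_Cst_mult_right D_Cst_mult mult.left_commute)

lemma wt_mult: "wt \<Delta> p P \<Longrightarrow> wt \<Delta>' q Q \<Longrightarrow> \<Delta> + \<Delta>' = \<Delta>'' \<Longrightarrow> wt \<Delta>'' (p * q) (smult q P + smult p Q)"
  by (auto simp add: wt_def R_mult WB_mult_right D_mult Cst_add algebra_simps)

lemma wt_D: "wt \<Delta> p P \<Longrightarrow> \<Delta> + 1 = \<Delta>' \<Longrightarrow> wt \<Delta>' (D p) ([:Cst \<Delta> * p:] + lamD P)"
  by (auto simp add: wt_def R_D WB_D_right lamD_pCons D_mult Cst_add algebra_simps)

section \<open>Conformal weights of the generators\<close>

lemma wt_emb:
  assumes "b \<in> g i" "i \<in> {-1, -(1/2), 0, 1/2}" "frm e b = 0" "\<Delta> = 1 - i"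
  shows "wt \<Delta> (emb b) [:- Cst (frm x b):]"
proof -
  have "R (emb b) = emb b" using assms by (intro R_emb_hom)
  then show ?thesis using assms by (simp add: wt_def W_bracket_def B_Lam_emb RP_pCons R_D R_mult)
qed

lemma wt_half: "w \<in> g (1/2) \<Longrightarrow> wt (1/2) (emb w) 0"
  using wt_emb[of w "1/2" "1/2"] frm_e_gr[of w "1/2"] frm_gr[OF x_gr, of w "1/2"] by (simp add: field_simps)

lemma wt_0: "w \<in> g 0 \<Longrightarrow> wt 1 (emb w) [:- Cst (frm x w):]"
  using wt_emb[of w 0 1] frm_e_gr[of w 0] by simp

lemma wt_mhalf: "w \<in> g (- (1/2)) \<Longrightarrow> wt (3/2) (emb w) 0"
  using wt_emb[of w "- (1/2)" "3/2"] frm_e_gr[of w "- (1/2)"] frm_gr[OF x_gr, of w "- (1/2)"]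
  by (simp add: field_simps)

lemma R_numeral [simp]: "R (numeral n) = numeral n"
  using R_Cst[of "numeral n"] by (simp add: Cst_numeral)

text \<open>For f the term 2z(e|f) = 4(x|x)z spoils the eigenvector equation. As constants have
  weight 0, half of it added to f restores weight 2; this is where the summand 4(x|x)z\<lambda> of
  {L_\<lambda> L} comes from.\<close>

lemma wt_f: "wt 2 (emb f + Cst (2 * frm x x * z)) 0"
proof -
  have "frm x f = 0" using frm_gr[OF x_gr f_gr] by simp
  moreover have "Cst (2 * z * (2 * frm x x)) = (2 * Cst (2 * frm x x * z) :: ('a, 'i) dpoly)"
    by (simp add: Cst_numeral[symmetric] ac_simps flip: Cst_mult)
  ultimately show ?thesis
    by (simp add: wt_def B.add_right W_bracket_def B_Lam_emb[OF f_gr] RP_pCons R_D R_add R_mult frm_e_f D_add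
        Cst_numeral distrib_left)
qed

text \<open>At \<lambda>^2 the x from x' cancels the -x from the g_0-part; the -(x|x)\<lambda>^3 of
  x' has no counterpart and remains as the central term.\<close>

lemma wt_L: "wt 2 (L + Cst (2 * frm x x * z)) [:0, - Cst (frm x x):]"
proof -
  have "wt 2 (D (emb x)) ([:Cst 1 * emb x:] + lamD [:- Cst (frm x x):])"
    by (rule wt_D[OF wt_0[OF x_gr]]) simp
  then have 1: "wt 2 (D (emb x)) [:emb x, - Cst (frm x x):]"
    by (simp add: lamD_const D.minus)
  have "wt 2 (Cst (1/2) * (\<Sum>j\<in>J0. emb (al j) * emb (al' j)))
     (smult (Cst (1/2)) (\<Sum>j\<in>J0. smult (emb (al' j)) [:- Cst (frm x (al j)):] + smult (emb (al j)) [:- Cst (frm x (al' j)):]))"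
    by (intro wt_Cst_mult wt_sum wt_mult[where \<Delta> = 1 and \<Delta>' = 1] wt_0) auto
  moreover have "(\<Sum>j\<in>J0. smult (emb (al' j)) [:- Cst (frm x (al j)):] + smult (emb (al j)) [:- Cst (frm x (al' j)):])
      = [:- (2 * emb x):]"
    using contract_g0[of emb x] x_gr
    by (simp add: lin_def lin_simps sum_const_poly sum.distrib sum_negf sum_subtractf mult.commute[of "emb _"])
  ultimately have 2: "wt 2 (Cst (1/2) * (\<Sum>j\<in>J0. emb (al j) * emb (al' j))) [:- emb x:]"
    by (simp add: Cst_half_double)
  have 3: "wt 2 (\<Sum>k\<in>K. emb (v' k) * emb (br f (v k))) (\<Sum>k\<in>K. smult (emb (br f (v k))) 0 + smult (emb (v' k)) 0)"
    by (intro wt_sum wt_mult[where \<Delta> = "1/2" and \<Delta>' = "3/2"] wt_half wt_mhalf) auto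
  have "wt 2 (Cst (1/2) * (\<Sum>k\<in>K. emb (v' k) * D (emb (v k))))
     (smult (Cst (1/2)) (\<Sum>k\<in>K. smult (D (emb (v k))) 0 + smult (emb (v' k)) ([:Cst (1/2) * emb (v k):] + lamD 0)))"
    by (intro wt_Cst_mult wt_sum wt_mult[where \<Delta> = "1/2" and \<Delta>' = "3/2"] wt_half wt_D[OF wt_half]) auto
  moreover have "(\<Sum>k\<in>K. emb (v' k) * (Cst (1/2) * emb (v k))) = Cst (1/2) * (\<Sum>k\<in>K. emb (v' k) * emb (v k))"
    by (simp only: sum_distrib_left mult.left_commute)
  ultimately have 4: "wt 2 (Cst (1/2) * (\<Sum>k\<in>K. emb (v' k) * D (emb (v k)))) 0"
    by (simp add: sum_const_poly sum_v_v')
  from wt_add[OF wt_add[OF wt_add[OF wt_add[OF wt_f 1] 2] 3] 4]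
  show ?thesis by (simp add: L_gen_def add_ac)
qed

lemma bracket_L_L: "WB L L = DL 1 2 L - monom (Cst (frm x x)) 3 + monom (Cst (4 * frm x x * z)) 1"
proof -
  have "WB L L = pCons (D L) (pCons (Cst 2 * (L + Cst (2 * frm x x * z))) [:0, - Cst (frm x x):])"
    using wt_L by (simp add: wt_def WB_L[OF L_W] WB_add_right D_add)
  moreover have "Cst 2 * Cst (2 * frm x x * z) = (Cst (4 * frm x x * z) :: ('a, 'i) dpoly)"
    by (simp add: mult.assoc flip: Cst_mult)
  ultimately show ?thesis
    by (simp add: DL_def monom_altdef distrib_left mult.assoc numeral_3_eq_3 monom_Suc monom_0)
qed

lemma wt_ph: assumes "a \<in> g0f" shows "wt 1 (ph a) 0"
proof -
  have "wt 1 (emb a + Cst (1/2) * (\<Sum>k\<in>K. emb (br a (v k)) * emb (v' k)))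
    ([:- Cst (frm x a):] + smult (Cst (1/2)) (\<Sum>k\<in>K. smult (emb (v' k)) 0 + smult (emb (br a (v k))) 0))"
    using assms by (intro wt_add wt_0 wt_Cst_mult wt_sum wt_mult[where \<Delta> = "1/2" and \<Delta>' = "1/2"] wt_half) auto
  then show ?thesis using assms by (simp add: phi_gen_def)
qed

lemma wt_ps: assumes u: "u \<in> g (- (1/2))" shows "wt (3/2) (ps u) 0"
proof -
  have cubic: "wt (3/2) (Cst (1/3) * (\<Sum>h\<in>K. \<Sum>k\<in>K. emb (br (br u (v h)) (v k)) * emb (v' h) * emb (v' k)))
    (smult (Cst (1/3)) (\<Sum>h\<in>K. \<Sum>k\<in>K. smult (emb (v' k)) (smult (emb (v' h)) 0 + smult (emb (br (br u (v h)) (v k))) 0)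
      + smult (emb (br (br u (v h)) (v k)) * emb (v' h)) 0))"
    using assms
    by (intro wt_Cst_mult wt_sum wt_mult[where \<Delta> = 1 and \<Delta>' = "1/2"] wt_mult[where \<Delta> = "1/2" and \<Delta>' = "1/2"] wt_half)
      auto
  have "wt (3/2) (\<Sum>k\<in>K. emb (br u (v k)) * emb (v' k))
    (\<Sum>k\<in>K. smult (emb (v' k)) [:- Cst (frm x (br u (v k))):] + smult (emb (br u (v k))) 0)"
    using assms by (intro wt_sum wt_mult[where \<Delta> = 1 and \<Delta>' = "1/2"] wt_half wt_0) auto
  moreover have "(\<Sum>k\<in>K. smult (emb (v' k)) [:- Cst (frm x (br u (v k))):]) = [:- (Cst (1/2) * emb (br e u)):]"
  proof -
    have "(\<Sum>k\<in>K. emb (v' k) * - Cst (frm x (br u (v k)))) = Cst (1/2) * (\<Sum>k\<in>K. Cst (frm u (v k)) * emb (v' k))"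
      unfolding sum_distrib_left
    proof (rule sum.cong)
      fix k
      have "- Cst (frm x (br u (v k))) = (Cst (1/2) * Cst (frm u (v k)) :: ('a, 'i) dpoly)"
        by (simp add: frm_x_br[OF u] flip: Cst_mult)
      then show "emb (v' k) * - Cst (frm x (br u (v k))) = Cst (1/2) * (Cst (frm u (v k)) * emb (v' k))"
        by (simp add: mult_ac)
    qed simp
    then show ?thesis using contract_u(1)[of emb u] u by (simp add: sum_const_poly lin_def lin_simps)
  qed
  ultimately have quad: "wt (3/2) (\<Sum>k\<in>K. emb (br u (v k)) * emb (v' k)) [:- (Cst (1/2) * emb (br e u)):]"
    by simp
  \<comment> \<open>Differentiating [e, u], of weight 1/2, produces (1/2)[e, u] at \<lambda>^2,
    which cancels the contribution of the quadratic term.\<close>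
  have "wt (3/2) (D (emb (br e u))) ([:Cst (1/2) * emb (br e u):] + lamD 0)"
    using assms by (intro wt_D[OF wt_half]) simp_all
  from wt_add[OF wt_add[OF wt_add[OF wt_mhalf[OF u] cubic] quad] this]
  show ?thesis by (simp add: psi_gen_def)
qed

lemma bracket_L_ph: "a \<in> g0f \<Longrightarrow> WB L (ph a) = DL 1 1 (ph a)"
  using wt_ph by (simp add: wt_def WB_L ph_W DL_def)

lemma bracket_L_ps: "u \<in> g (- (1/2)) \<Longrightarrow> WB L (ps u) = DL 1 (3/2) (ps u)"
  using wt_ps by (simp add: wt_def WB_L ps_W DL_def)

lemma bracket_ph_L: "a \<in> g0f \<Longrightarrow> WB (ph a) L = DL 0 1 (ph a)"
  using WB_skew[of "ph a" L] by (simp add: bracket_L_ph DL_def skew_pCons lamD_const)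

lemma bracket_ps_L: "u \<in> g (- (1/2)) \<Longrightarrow> WB (ps u) L = DL (1/2) (3/2) (ps u)"
proof -
  assume u: "u \<in> g (- (1/2))"
  have "(3/2 :: 'a) = 1/2 + 1" by (simp add: field_simps)
  then have "Cst (3/2) = (Cst (1/2) + 1 :: ('a, 'i) dpoly)" by (simp only: Cst_add Cst_1)
  then show ?thesis
    using WB_skew[of "ps u" L] u
    by (simp add: bracket_L_ps DL_def skew_pCons lamD_const D_Cst_mult distrib_right D_add)
qed

section \<open>Brackets of the generators of weights one and three halves\<close>

lemma T_zero_zero: assumes "a \<in> g 0" "b \<in> g 0" shows "WB (emb a) (emb b) = [:emb (br a b), Cst (frm a b):]"
proof -
  have "br a b \<in> g 0" using assms by simp
  then show ?thesis using frm_e_gr[of "br a b" 0] by (simp add: WB_emb)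
qed

lemma T_zero_half: assumes "a \<in> g 0" "w \<in> g (1/2)" shows "WB (emb a) (emb w) = [:emb (br a w):]"
proof -
  have "br a w \<in> g (1/2)" using assms by simp
  moreover have "frm e (br a w) = 0" using frm_gr[OF e_gr, of "br a w" "1/2"] assms by (simp add: field_simps)
  moreover have "frm a w = 0" using frm_gr[of a 0 w "1/2"] assms by simp
  ultimately show ?thesis by (simp add: WB_emb)
qed

lemma T_zero_mhalf: assumes "a \<in> g 0" "u \<in> g (- (1/2))" shows "WB (emb a) (emb u) = [:emb (br a u):]"
proof -
  have "br a u \<in> g (- (1/2))" using assms by simp
  moreover have "frm e (br a u) = 0" using frm_gr[OF e_gr, of "br a u" "- (1/2)"] assms by (simp add: field_simps)
  moreover have "frm a u = 0" using frm_gr[of a 0 u "- (1/2)"] assms by simp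
  ultimately show ?thesis by (simp add: WB_emb)
qed

text \<open>g_0^f preserves \<open>om\<close> by \<open>om_br_zero\<close>, hence annihilates the
  tensor of the dual bases: its action on one factor can be moved to the other.\<close>

lemma half_invariant:
  assumes a: "a \<in> g0f" and lin: "\<And>q. lin (\<lambda>p. G p q)" "\<And>p. lin (G p)"
  shows "(\<Sum>k\<in>K. G (v k) (br a (v' k))) = - (\<Sum>k\<in>K. G (br a (v k)) (v' k))"
proof -
  have "G (v k) (br a (v' k)) = (\<Sum>h\<in>K. - (Cst (om (br a (v h)) (v' k)) * G (v k) (v' h)))" if "k \<in> K" for k
  proof -
    have "om (v h) (br a (v' k)) = - om (br a (v h)) (v' k)" if "h \<in> K" for h
      using a \<open>k \<in> K\<close> that by (simp add: om_br_zero)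
    then show ?thesis
      using contract_half(1)[OF lin(2), of "br a (v' k)" "v k"] a that by (simp cong: sum.cong)
  qed
  then have "(\<Sum>k\<in>K. G (v k) (br a (v' k))) = (\<Sum>k\<in>K. \<Sum>h\<in>K. - (Cst (om (br a (v h)) (v' k)) * G (v k) (v' h)))"
    by simp
  also have "\<dots> = (\<Sum>h\<in>K. - (\<Sum>k\<in>K. Cst (om (br a (v h)) (v' k)) * G (v k) (v' h)))"
    by (subst sum.swap) (simp add: sum_negf)
  also have "\<dots> = (\<Sum>h\<in>K. - G (br a (v h)) (v' h))"
    using a by (intro sum.cong refl arg_cong[where f = uminus] contract_half(3)[OF lin(1)]) simp
  finally show ?thesis by (simp add: sum_negf)
qed

lemma WB_ph: assumes "a \<in> g0f" "q \<in> W" shows "WB (ph a) q = WB (emb a) q"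
  using assms by (simp add: phi_gen_def WB_add_left WB_Cst_mult_left WB_left.sum WB_mult_left W_half cong: sum.cong)

text \<open>What is left of {psi(u)_\<lambda> q} for q in W, where factors from g_{1/2} bracket to
  0. It is introduced for all q, as it will be applied to the separate summands of psi(u1), which
  need not lie in W.\<close>

definition M :: "'g \<Rightarrow> ('a, 'i) dpoly \<Rightarrow> ('a, 'i) dpoly poly" where
  "M u q = WB (emb u) q + (\<Sum>k\<in>K. arrow (WB (emb (br u (v k))) q) (emb (v' k)))"

lemma WB_ps: assumes "u \<in> g (- (1/2))" "q \<in> W" shows "WB (ps u) q = M u q"
  using assms
  by (simp add: psi_gen_def M_def WB_add_left WB_Cst_mult_left WB_D_left WB_left.sum WB_mult_left W_half
      cong: sum.cong)

lemma bracket_ph_ph: assumes a: "a \<in> g0f" and b: "b \<in> g0f"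
  shows "WB (ph a) (ph b) = [:ph (br a b):] + monom (Cst (frm a b)) 1"
proof -
  have "WB (emb a) (\<Sum>k\<in>K. emb (br b (v k)) * emb (v' k))
    = [:(\<Sum>k\<in>K. emb (br a (br b (v k))) * emb (v' k)) + (\<Sum>k\<in>K. emb (br b (v k)) * emb (br a (v' k))):]"
    using assms by (simp add: WB_sum_right WB_mult_right T_zero_half sum_const_poly sum.distrib mult.commute cong: sum.cong)
  also have "(\<Sum>k\<in>K. emb (br b (v k)) * emb (br a (v' k))) = - (\<Sum>k\<in>K. emb (br b (br a (v k))) * emb (v' k))"
    by (rule half_invariant[OF a]) (simp_all add: lin_def lin_simps algebra_simps)
  also have "(\<Sum>k\<in>K. emb (br a (br b (v k))) * emb (v' k)) + \<dots> = (\<Sum>k\<in>K. emb (br (br a b) (v k)) * emb (v' k))"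
    by (simp add: br_jacobi[of a b] emb_add distrib_right sum.distrib)
  finally show ?thesis using assms
    by (simp add: WB_ph ph_W) (simp add: phi_gen_def WB_add_right WB_Cst_mult_right T_zero_zero monom_altdef)
qed

text \<open>ad a commutes with ad e and annihilates the tensor of \<open>v\<close> and
  \<open>v'\<close>, so as a derivation it only replaces u by [a, u]; the \<lambda>-terms of the
  quadratic and of the derivative summand cancel.\<close>

lemma bracket_ph_ps: assumes a: "a \<in> g0f" and u: "u \<in> g (- (1/2))"
  shows "WB (ph a) (ps u) = [:ps (br a u):]"
proof -
  let ?Y = "\<lambda>u h k. br (br u (v h)) (v k)"
  let ?p = "\<lambda>h k. emb (v' h) * emb (v' k)"
  have "WB (emb a) (\<Sum>h\<in>K. \<Sum>k\<in>K. emb (?Y u h k) * emb (v' h) * emb (v' k))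
    = [:(\<Sum>h\<in>K. \<Sum>k\<in>K. emb (br a (?Y u h k)) * ?p h k)
        + (\<Sum>h\<in>K. \<Sum>k\<in>K. emb (?Y u h k) * (emb (br a (v' h)) * emb (v' k)))
        + (\<Sum>h\<in>K. \<Sum>k\<in>K. emb (?Y u h k) * (emb (v' h) * emb (br a (v' k)))):]"
    using assms
    by (simp add: WB_sum_right WB_mult_right R_mult T_zero_half sum_const_poly cong: sum.cong)
      (simp add: sum.distrib distrib_left mult_ac)
  also have "(\<Sum>h\<in>K. \<Sum>k\<in>K. emb (?Y u h k) * (emb (br a (v' h)) * emb (v' k)))
      = (\<Sum>k\<in>K. \<Sum>h\<in>K. emb (?Y u h k) * (emb (br a (v' h)) * emb (v' k)))"
    by (rule sum.swap)
  also have "(\<Sum>k\<in>K. \<Sum>h\<in>K. emb (?Y u h k) * (emb (br a (v' h)) * emb (v' k)))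
      = (\<Sum>k\<in>K. - (\<Sum>h\<in>K. emb (br (br u (br a (v h))) (v k)) * ?p h k))"
    by (intro sum.cong refl half_invariant[OF a]) (simp_all add: lin_def lin_simps algebra_simps)
  also have "\<dots> = - (\<Sum>h\<in>K. \<Sum>k\<in>K. emb (br (br u (br a (v h))) (v k)) * ?p h k)"
    by (subst sum.swap) (simp add: sum_negf)
  also have "(\<Sum>h\<in>K. \<Sum>k\<in>K. emb (?Y u h k) * (emb (v' h) * emb (br a (v' k))))
      = (\<Sum>h\<in>K. - (\<Sum>k\<in>K. emb (br (br u (v h)) (br a (v k))) * ?p h k))"
    by (intro sum.cong refl half_invariant[OF a]) (simp_all add: lin_def lin_simps algebra_simps)
  also have "(\<Sum>h\<in>K. \<Sum>k\<in>K. emb (br a (?Y u h k)) * ?p h k)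
      + - (\<Sum>h\<in>K. \<Sum>k\<in>K. emb (br (br u (br a (v h))) (v k)) * ?p h k)
      + (\<Sum>h\<in>K. - (\<Sum>k\<in>K. emb (br (br u (v h)) (br a (v k))) * ?p h k))
      = (\<Sum>h\<in>K. \<Sum>k\<in>K. emb (?Y (br a u) h k) * emb (v' h) * emb (v' k))"
  proof -
    have "br a (?Y u h k) = ?Y (br a u) h k + br (br u (br a (v h))) (v k) + br (br u (v h)) (br a (v k))" for h k
      by (simp only: br_jacobi[of a "br u (v h)" "v k"] br_jacobi[of a u "v h"] br_add_left)
    then show ?thesis by (simp add: emb_add distrib_right sum.distrib sum_negf mult.assoc)
  qed
  finally have cubic: "WB (emb a) (\<Sum>h\<in>K. \<Sum>k\<in>K. emb (?Y u h k) * emb (v' h) * emb (v' k))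
      = [:\<Sum>h\<in>K. \<Sum>k\<in>K. emb (?Y (br a u) h k) * emb (v' h) * emb (v' k):]" .
  have frm: "frm a (br u y) = frm (br a u) y" for y by (simp add: frm_invariant)
  have bau: "br a u \<in> g (- (1/2))" using assms by simp
  have "WB (emb a) (\<Sum>k\<in>K. emb (br u (v k)) * emb (v' k))
    = [:(\<Sum>k\<in>K. emb (br a (br u (v k))) * emb (v' k)) + (\<Sum>k\<in>K. emb (br u (v k)) * emb (br a (v' k))),
        \<Sum>k\<in>K. Cst (frm (br a u) (v k)) * emb (v' k):]"
    using assms by (simp add: WB_sum_right WB_mult_right T_zero_half T_zero_zero sum_linear_poly sum.distrib frm
        mult.commute cong: sum.cong)
  also have "(\<Sum>k\<in>K. Cst (frm (br a u) (v k)) * emb (v' k)) = - emb (br e (br a u))"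
    by (rule contract_u(1)[OF _ bau]) (simp add: lin_def lin_simps)
  also have "(\<Sum>k\<in>K. emb (br u (v k)) * emb (br a (v' k))) = - (\<Sum>k\<in>K. emb (br u (br a (v k))) * emb (v' k))"
    by (rule half_invariant[OF a]) (simp_all add: lin_def lin_simps algebra_simps)
  also have "(\<Sum>k\<in>K. emb (br a (br u (v k))) * emb (v' k)) + \<dots> = (\<Sum>k\<in>K. emb (br (br a u) (v k)) * emb (v' k))"
    by (simp add: br_jacobi[of a u] emb_add distrib_right sum.distrib)
  finally have quad: "WB (emb a) (\<Sum>k\<in>K. emb (br u (v k)) * emb (v' k))
      = [:\<Sum>k\<in>K. emb (br (br a u) (v k)) * emb (v' k), - emb (br e (br a u)):]" .
  have "br a (br e u) = br e (br a u)" using a br_jacobi[of a e u] by simp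
  then have "WB (emb a) (D (emb (br e u))) = [:D (emb (br e (br a u))), emb (br e (br a u)):]"
    using assms by (simp add: WB_D_right T_zero_half lamD_const)
  then show ?thesis using assms
    by (simp add: WB_ph ps_W)
      (simp add: psi_gen_def WB_add_right WB_Cst_mult_right T_zero_mhalf cubic quad del: mult.assoc)
qed

lemma ps_minus: "ps (- u) = - ps u"
  by (simp add: psi_gen_def sum_negf D.minus)

lemma bracket_ps_ph: assumes "b \<in> g0f" "u \<in> g (- (1/2))"
  shows "WB (ps u) (ph b) = [:ps (br u b):]"
  using WB_skew[of "ps u" "ph b"] assms by (simp add: bracket_ph_ps br_skew[of u b] ps_minus)

section \<open>Diagonalization of the conformal weight on the W-algebra\<close>

text \<open>\<open>bas\<close> need not consist of homogeneous vectors, so induction on its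
  variables is replaced by one on homogeneous elements of g.\<close>

lemma dpoly_emb_induct [case_names const emb D add mult]:
  assumes const: "\<And>c. P (Cst c)"
    and emb: "\<And>i b. i \<in> {-1, -(1/2), 0, 1/2, 1} \<Longrightarrow> b \<in> g i \<Longrightarrow> P (emb b)"
    and D: "\<And>q. P q \<Longrightarrow> P (D q)" and add: "\<And>p q. P p \<Longrightarrow> P q \<Longrightarrow> P (p + q)"
    and mult: "\<And>p q. P p \<Longrightarrow> P q \<Longrightarrow> P (p * q)"
  shows "P q"
proof (induction q rule: dpoly_induct)
  case (dvar i n)
  have "P (emb b)" for b
  proof (induction b rule: gr_sum_induct)
    case (hom i b)
    then show ?case by (rule emb)
  next
    case (add a b)
    then show ?case unfolding emb_add by (rule assms(4))
  qed
  then have "P ((D ^^ n) (emb (bas i)))" by (induction n) (simp_all add: D)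
  then show ?case by (simp add: emb_bas flip: dvar_D_power)
qed (auto intro: const add mult)

lemma R_R [simp]: "R (R q) = R q"
  by (rule R_V[OF R_mem_V])

lemma coeff_lamD: "coeff (lamD P) n = D (coeff P n) + (case n of 0 \<Rightarrow> 0 | Suc m \<Rightarrow> coeff P m)"
  by (simp add: lamD_def coeff_map_poly coeff_pCons)

lemma WB_Lam_emb:
  "b \<in> g i \<Longrightarrow> WB Lam (emb b) = [:D (R (emb b)), Cst (1 - i) * R (emb b) + Cst (2 * z * frm e b), - Cst (frm x b):]"
  by (simp add: W_bracket_def B_Lam_emb RP_pCons R_D R_add R_mult)

definition weight_op :: "('a, 'i) dpoly \<Rightarrow> ('a, 'i) dpoly" where
  "weight_op q = coeff (WB Lam q) 1"

lemma coeff_WB_Lam_0: "coeff (WB Lam q) 0 = D (R q)"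
  by (induction q rule: dpoly_emb_induct)
    (simp_all add: WB_Lam_emb WB_add_right WB_mult_right WB_D_right coeff_lamD R_add R_mult R_D D_add D_mult)

lemma weight_op_add: "weight_op (p + q) = weight_op p + weight_op q"
  and weight_op_Cst_mult: "weight_op (Cst c * q) = Cst c * weight_op q"
  and weight_op_mult: "weight_op (p * q) = R q * weight_op p + R p * weight_op q"
  and weight_op_Cst [simp]: "weight_op (Cst c) = 0"
  by (simp_all add: weight_op_def WB_add_right WB_Cst_mult_right WB_mult_right)

lemma weight_op_D: "weight_op (D q) = D (weight_op q) + D (R q)"
  by (simp add: weight_op_def WB_D_right coeff_lamD coeff_WB_Lam_0)

sublocale weight_op: additive weight_op
  by standard (rule weight_op_add)

lemma weight_op_0 [simp]: "weight_op 0 = 0"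
  by (rule weight_op.zero)

lemma weight_op_emb: "b \<in> g i \<Longrightarrow> weight_op (emb b) = Cst (1 - i) * R (emb b) + Cst (2 * z * frm e b)"
  by (simp add: weight_op_def WB_Lam_emb)

lemma R_coeff_WB [simp]: "R (coeff (WB p q) n) = coeff (WB p q) n"
  by (simp add: W_bracket_def coeff_map_poly)

lemma R_weight_op [simp]: "R (weight_op q) = weight_op q"
  by (simp add: weight_op_def)

lemma R_emb_cases:
  assumes "i \<in> {-1, -(1/2), 0, 1/2, 1}" "b \<in> g i"
  obtains "R (emb b) = emb b" | c where "b = scl c e"
  using assms R_emb_hom[of i b] gr_one[of b] by (cases "i = 1") auto

text \<open>On homogeneous elements of g, \<open>rho\<close> changes only multiples of e, into
  constants. A derivation along \<open>rho\<close> that kills e therefore cannot tell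
  \<open>R q\<close> from \<open>q\<close>.\<close>

lemma R_absorb:
  fixes G :: "('a, 'i) dpoly \<Rightarrow> 'm::ab_group_add"
  assumes add: "\<And>p q. G (p + q) = G p + G q" and mult: "\<And>p q. G (p * q) = F (R q) (G p) + F (R p) (G q)"
    and D: "\<And>q. G (D q) = T (G q) (R q)" and const: "\<And>c. G (Cst c) = 0"
    and F: "\<And>p. F p 0 = 0" and e: "G (emb e) = 0"
  shows "G (R q) = G q"
proof (induction q rule: dpoly_emb_induct)
  case (emb i b)
  show ?case
  proof (rule R_emb_cases[OF emb])
    fix c assume "b = scl c e"
    then show ?thesis by (simp add: emb_scl mult R_mult const F e flip: Cst_mult)
  qed simp
qed (simp_all add: R_add R_mult R_D assms)

lemma weight_op_R [simp]: "weight_op (R q) = weight_op q"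
proof (rule R_absorb[where F = "(*)" and T = "\<lambda>a b. D a + D b"])
  show "weight_op (emb e) = 0" using frm_gr[OF e_gr e_gr] by (simp add: weight_op_emb[OF e_gr])
qed (simp_all add: weight_op_add weight_op_mult weight_op_D)

lemma T_half_e: "w \<in> g (1/2) \<Longrightarrow> WB (emb w) (emb e) = 0"
proof -
  assume w: "w \<in> g (1/2)"
  have "frm w e = 0" using frm_gr[OF w e_gr] by (simp add: field_simps)
  moreover have "br w e = 0" using w by (simp add: br_skew[of w e] br_e_half)
  ultimately show ?thesis by (simp add: WB_emb)
qed

lemma T_half_R: assumes "w \<in> g (1/2)" shows "WB (emb w) (R q) = WB (emb w) q"
  by (rule R_absorb[where F = smult and T = "\<lambda>a b. lamD a"])
    (simp_all add: WB_add_right WB_mult_right WB_D_right T_half_e assms)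

lemma T_e_R: "WB (emb e) (R q) = WB (emb e) q"
  by (rule R_absorb[where F = smult and T = "\<lambda>a b. lamD a"])
    (use frm_gr[OF e_gr e_gr] in \<open>simp_all add: WB_add_right WB_mult_right WB_D_right WB_emb br_self\<close>)

text \<open>a has weight 1 - j, and the coefficient of \<lambda>^n in a bracket has weight lower by
  n + 1 than the sum of the two weights: a total change by -(j + n).\<close>

lemma T_weight_op:
  assumes a: "a \<in> g j" and absorb: "\<And>q. WB (emb a) (R q) = WB (emb a) q"
  shows "coeff (WB (emb a) (weight_op q)) n = weight_op (coeff (WB (emb a) q) n) + Cst (j + of_nat n) * coeff (WB (emb a) q) n"
proof (induction q arbitrary: n rule: dpoly_emb_induct)
  case (emb i b)
  have ab: "br a b \<in> g (j + i)" using a emb by (intro br_gr)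
  let ?E = "frm e (br a b)"
  let ?r = "R (emb (br a b))"
  \<comment> \<open>(e|[a, b]) is nonzero only for i = -1 - j, and (a|b) in the next claim only for
    i = -j; for these values the coefficients agree.\<close>
  have E: "(1 - i) * (z * ?E) = 2 * z * ?E + j * (z * ?E)"
  proof (cases "j + i = - 1")
    case True
    then have i: "i = - 1 - j" by (simp add: algebra_simps)
    show ?thesis unfolding i by (simp add: algebra_simps)
  next
    case False
    then show ?thesis using frm_e_gr[OF ab] by simp
  qed
  have F: "(1 - i) * frm a b = (j + 1) * frm a b"
  proof (cases "j + i = 0")
    case True
    then have i: "i = - j" by (simp add: eq_neg_iff_add_eq_0 add.commute)
    show ?thesis unfolding i by (simp add: algebra_simps)
  next
    case False
    then show ?thesis using frm_gr[OF a emb(2)] by simp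
  qed
  have "WB (emb a) (weight_op (emb b)) = smult (Cst (1 - i)) (WB (emb a) (emb b))"
    by (simp add: weight_op_emb[OF emb(2)] WB_add_right WB_Cst_mult_right absorb)
  then have "WB (emb a) (weight_op (emb b)) = [:Cst (1 - i) * ?r + Cst ((1 - i) * (z * ?E)), Cst ((1 - i) * frm a b):]"
    by (simp add: WB_emb Cst_mult distrib_left)
  moreover have "weight_op ?r = Cst (1 - (j + i)) * ?r + Cst (2 * z * ?E)"
    by (simp add: weight_op_emb[OF ab])
  moreover have "Cst (1 - i) * ?r = Cst (1 - (j + i)) * ?r + Cst j * ?r"
    by (simp add: Cst_diff Cst_add algebra_simps)
  ultimately show ?case
    unfolding E F
    by (cases n; cases "n - 1") (auto simp: WB_emb weight_op_add weight_op_Cst_mult Cst_add Cst_mult algebra_simps)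
next
  case (D q)
  show ?case
    by (cases n) (simp_all add: weight_op_D WB_add_right WB_D_right coeff_lamD absorb D D_add D_Cst_mult weight_op_add Cst_add algebra_simps)
next
  case (mult p q)
  show ?case
    by (simp add: weight_op_mult WB_add_right WB_mult_right absorb mult weight_op_add R_mult R_add distrib_left mult_ac add_ac)
qed (simp_all add: WB_add_right WB_right.zero weight_op_add distrib_left)

lemma W_add: "p \<in> W \<Longrightarrow> q \<in> W \<Longrightarrow> p + q \<in> W"
  and W_Cst_mult: "p \<in> W \<Longrightarrow> Cst c * p \<in> W"
  and W_0: "0 \<in> W"
  by (simp_all add: W_iff V_iff R_add R_mult WB_add_right WB_Cst_mult_right WB_right.zero)

lemma W_subspace: "dpoly.subspace W"
  by (rule dpoly.subspaceI) (simp_all add: W_0 W_add W_Cst_mult)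

lemma weight_op_W: assumes "q \<in> W" shows "weight_op q \<in> W"
proof -
  have "coeff (WB (emb w) (weight_op q)) n = 0" if "w \<in> g (1/2)" for w n
    using T_weight_op[OF that T_half_R[OF that]] W_half[OF assms that] by simp
  moreover have "coeff (WB (emb e) (weight_op q)) n = 0" for n
    using T_weight_op[OF e_gr T_e_R] W_e[OF assms] by simp
  ultimately show ?thesis by (auto simp: W_iff V_iff intro: poly_eqI)
qed

section \<open>Eigenspaces of the weight operator\<close>

definition eig :: "'a \<Rightarrow> ('a, 'i) dpoly \<Rightarrow> bool" where
  "eig \<mu> q \<longleftrightarrow> R q = q \<and> weight_op q = Cst \<mu> * q"

lemma eig_Cst: "eig 0 (Cst c)"
  by (simp add: eig_def)

lemma eig_add: "eig \<mu> p \<Longrightarrow> eig \<mu> q \<Longrightarrow> eig \<mu> (p + q)"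
  and eig_scale: "eig \<mu> p \<Longrightarrow> eig \<mu> (Cst c * p)"
  and eig_mult: "eig \<mu> p \<Longrightarrow> eig \<nu> q \<Longrightarrow> eig (\<mu> + \<nu>) (p * q)"
  and eig_D: "eig \<mu> p \<Longrightarrow> eig (\<mu> + 1) (D p)"
  by (simp_all add: eig_def R_add R_mult R_D weight_op_add weight_op_Cst_mult weight_op_mult weight_op_D D_mult Cst_add algebra_simps)

abbreviation eig_span :: "('a, 'i) dpoly set" where
  "eig_span \<equiv> dpoly.span {p. \<exists>\<mu>. eig \<mu> p}"

lemma eig_span_base: "eig \<mu> p \<Longrightarrow> p \<in> eig_span"
  by (intro dpoly.span_base) auto

lemma R_mem_span_eig: "R q \<in> eig_span"
proof (induction q rule: dpoly_emb_induct)
  case (const c)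
  show ?case using eig_span_base[OF eig_Cst] by simp
next
  case (emb i b)
  show ?case
  proof (rule R_emb_cases[OF emb])
    fix c assume "b = scl c e"
    then show ?thesis using eig_span_base[OF eig_Cst] by (simp add: emb_scl R_mult flip: Cst_mult)
next
    assume fixed: "R (emb b) = emb b"
    have "eig (1 - i) (emb b) \<or> i = - 1"
      using fixed frm_e_gr[OF emb(2)] by (auto simp: eig_def weight_op_emb[OF emb(2)])
    \<comment> \<open>In degree -1 the constant is the correction from \<open>wt_f\<close>; it may
      be subtracted again inside the span, being itself an eigenvector of weight 0.\<close>
    moreover have "eig 2 (emb b + Cst (z * frm e b))" if "i = - 1"
    proof -
      have "Cst (2 * z * frm e b) = (Cst 2 * Cst (z * frm e b) :: ('a, 'i) dpoly)"
        by (simp add: mult.assoc flip: Cst_mult)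
      then show ?thesis using that
        by (simp add: eig_def R_add fixed weight_op_add weight_op_emb[OF emb(2)] distrib_left)
    qed
    ultimately show ?thesis
      using eig_span_base[of "1 - i" "emb b"] dpoly.span_diff[OF eig_span_base eig_span_base[OF eig_Cst], of 2 "emb b + Cst (z * frm e b)" "z * frm e b"]
      unfolding fixed by auto
  qed
next
  case (D q)
  have "D p \<in> eig_span" if "p \<in> eig_span" for p
    using that
  proof (induction p rule: dpoly.span_induct_alt)
    case (step c p q)
    then obtain \<mu> where "eig \<mu> p" by auto
    then have "D p \<in> eig_span" by (intro eig_span_base[OF eig_D])
    then show ?case
      using dpoly.span_add[OF dpoly.span_scale step(2)] by (simp add: D_add D_Cst_mult)
  qed (simp add: dpoly.span_zero)
  with D show ?case by (simp add: R_D)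
next
  case (add p q)
  then show ?case by (simp add: R_add dpoly.span_add)
next
  case (mult p q)
  have "p * q \<in> eig_span" if "p \<in> eig_span" "q \<in> eig_span" for p q
    using that(1)
  proof (induction p rule: dpoly.span_induct_alt)
    case (step c p p')
    then obtain \<mu> where p: "eig \<mu> p" by auto
    have "p * q \<in> eig_span" using that(2)
    proof (induction q rule: dpoly.span_induct_alt)
      case (step c q q')
      then obtain \<nu> where "eig \<nu> q" by auto
      then have "Cst c * (p * q) \<in> eig_span" by (intro dpoly.span_scale eig_span_base[OF eig_mult[OF p]])
      then show ?case using dpoly.span_add[OF _ step(2)] by (simp add: distrib_left mult.left_commute)
    qed (simp add: dpoly.span_zero)
    then show ?case using dpoly.span_add[OF dpoly.span_scale step(2)] by (simp add: distrib_right mult.assoc)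
  qed (simp add: dpoly.span_zero)
  with mult show ?case by (simp add: R_mult)
qed

lemma span_eig_decomp:
  assumes "q \<in> dpoly.span {p. \<exists>\<mu>. eig \<mu> p}"
  shows "\<exists>N p. finite N \<and> (\<forall>\<mu>. eig \<mu> (p \<mu>)) \<and> (\<forall>\<mu>. \<mu> \<notin> N \<longrightarrow> p \<mu> = 0) \<and> q = (\<Sum>\<mu>\<in>N. p \<mu>)"
  using assms
proof (induction q rule: dpoly.span_induct_alt)
  case base
  have "eig \<mu> 0" for \<mu> by (simp add: eig_def)
  then show ?case by (intro exI[of _ "{}"] exI[of _ "\<lambda>_. 0"]) simp
next
  case (step c b q)
  then obtain \<nu> where b: "eig \<nu> b" by auto
  obtain N p where p: "finite N" "\<And>\<mu>. eig \<mu> (p \<mu>)" "\<And>\<mu>. \<mu> \<notin> N \<Longrightarrow> p \<mu> = 0" "q = (\<Sum>\<mu>\<in>N. p \<mu>)"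
    using step(2) by blast
  let ?p = "\<lambda>\<mu>. p \<mu> + (if \<mu> = \<nu> then Cst c * b else 0)"
  have "(\<Sum>\<mu>\<in>insert \<nu> N. p \<mu>) = q"
    unfolding p(4) using p by (intro sum.mono_neutral_right) auto
  then have "(\<Sum>\<mu>\<in>insert \<nu> N. ?p \<mu>) = Cst c * b + q"
    using p(1) by (simp add: sum.distrib del: sum.insert)
  moreover have "eig \<mu> (?p \<mu>)" for \<mu>
    using eig_add[OF p(2) eig_scale[OF b]] p(2) by auto
  ultimately show ?case using p
    by (intro exI[of _ "insert \<nu> N"] exI[of _ ?p]) auto
qed

text \<open>\<open>weight_op\<close> - \<nu> preserves W, kills the component of weight \<nu> and
  multiplies the others by the nonzero scalars \<mu> - \<nu>, so the number of components drops by
  one.\<close>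

lemma eig_components:
  assumes "finite N" "\<And>\<mu>. eig \<mu> (p \<mu>)" "(\<Sum>\<mu>\<in>N. p \<mu>) \<in> W" "\<mu> \<in> N"
  shows "p \<mu> \<in> W"
  using assms
proof (induction N arbitrary: p \<mu> rule: finite_induct)
  case (insert \<nu> N)
  let ?q = "\<Sum>\<mu>\<in>insert \<nu> N. p \<mu>"
  have "weight_op ?q + Cst (- \<nu>) * ?q \<in> W"
    using insert.prems(2) by (intro W_add W_Cst_mult weight_op_W)
  moreover have "weight_op ?q + Cst (- \<nu>) * ?q = (\<Sum>\<mu>\<in>insert \<nu> N. Cst (\<mu> - \<nu>) * p \<mu>)"
    using insert.prems(1)
    by (simp only: weight_op.sum sum_distrib_left sum.distrib[symmetric]) (simp add: eig_def Cst_diff left_diff_distrib)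
  ultimately have "(\<Sum>\<mu>\<in>N. Cst (\<mu> - \<nu>) * p \<mu>) \<in> W"
    using insert.hyps by simp
  then have scaled: "Cst (\<mu> - \<nu>) * p \<mu> \<in> W" if "\<mu> \<in> N" for \<mu>
    using that insert.prems(1) by (intro insert.IH[of "\<lambda>\<mu>. Cst (\<mu> - \<nu>) * p \<mu>"] eig_scale)
  have N: "p \<mu> \<in> W" if "\<mu> \<in> N" for \<mu>
  proof -
    have "1 / (\<mu> - \<nu>) * (\<mu> - \<nu>) = 1" using that insert.hyps by auto
    then have "Cst (1 / (\<mu> - \<nu>)) * (Cst (\<mu> - \<nu>) * p \<mu>) = p \<mu>"
      by (simp only: mult.assoc[symmetric] Cst_mult[symmetric] Cst_1 mult_1_left)
    then show ?thesis using W_Cst_mult[OF scaled[OF that], of "1 / (\<mu> - \<nu>)"] by simp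
  qed
  have "(\<Sum>\<mu>\<in>N. p \<mu>) \<in> W"
    by (rule dpoly.subspace_sum[OF W_subspace N])
  from dpoly.subspace_diff[OF W_subspace insert.prems(2) this] have "p \<nu> \<in> W"
    using insert.hyps by simp
  with N insert.prems(3) show ?case by blast
qed simp

lemma energy_momentum_L: "energy_momentum_element W WB L"
proof -
  let ?E = "{q \<in> W. \<exists>\<mu>. eig \<mu> q}"
  obtain S where S: "S \<subseteq> ?E" "dpoly.independent S" "?E \<subseteq> dpoly.span S"
    using dpoly.maximal_independent_subset[of ?E] by blast
  have mem: "q \<in> dpoly.span S" if q: "q \<in> W" for q
  proof -
    have "q \<in> dpoly.span {p. \<exists>\<mu>. eig \<mu> p}" using R_mem_span_eig[of q] W_R[OF q] by simp
    then obtain N p where p: "finite N" "\<And>\<mu>. eig \<mu> (p \<mu>)" "q = (\<Sum>\<mu>\<in>N. p \<mu>)"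
      using span_eig_decomp by blast
    have "p \<mu> \<in> ?E" if "\<mu> \<in> N" for \<mu>
      using eig_components[OF p(1,2) _ that] q p by auto
    then show ?thesis unfolding p(3) using S(3) by (intro dpoly.span_sum) auto
  qed
  have "dpoly.span S \<subseteq> W"
    using S(1) by (intro dpoly.span_minimal W_subspace) auto
  with mem have span: "dpoly.span S = W" by blast
  have eigen: "eigenvector_of_weight W WB L \<mu> q" if "q \<in> W" "eig \<mu> q" for q \<mu>
  proof -
    obtain a b P where P: "WB Lam q = pCons a (pCons b P)" by (metis pCons_cases)
    have "a = D q" using coeff_WB_Lam_0[of q] W_R[OF that(1)] by (simp add: P)
    moreover have "b = Cst \<mu> * q" using that(2) by (simp add: eig_def weight_op_def P)
    ultimately have "WB L q = DL 1 \<mu> q + monom 1 2 * P"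
      by (simp add: WB_L[OF that(1)] P DL_def numeral_2_eq_2 monom_Suc monom_0)
    then show ?thesis using that by (auto simp: eigenvector_of_weight_def)
  qed
  have "virasoro_element W WB L"
    unfolding virasoro_element_def bracket_L_L
    by (intro conjI L_W exI[of _ "- frm x x"] exI[of _ "4 * frm x x * z"]) (simp flip: minus_monom)
  moreover have "\<exists>\<mu>. eigenvector_of_weight W WB L \<mu> q" if q: "q \<in> S" for q
  proof -
    obtain \<mu> where "q \<in> W" "eig \<mu> q" using S(1) q by blast
    then show ?thesis using eigen by blast
  qed
  ultimately show ?thesis
    unfolding energy_momentum_element_def using S(2) span by blast
qed

section \<open>Invariance of the bracket of two elements of weight three halves\<close>

text \<open>Only the \<open>\<lambda>\<^sup>0\<close>-part of \<open>{w\<^sub>\<lambda> \<cdot>}\<close> is needed below.  On \<open>\<V>(\<gg>)\<close> it is \<open>th w\<close>, after \<open>\<rho>\<close> it is \<open>tau w\<close>.\<close>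

definition th :: "'g \<Rightarrow> ('a, 'i) dpoly \<Rightarrow> ('a, 'i) dpoly" where
  "th w q = coeff (B (emb w) q) 0"

definition tau :: "'g \<Rightarrow> ('a, 'i) dpoly \<Rightarrow> ('a, 'i) dpoly" where
  "tau w q = coeff (WB (emb w) q) 0"

lemma R_th: "R (th w q) = tau w q"
  by (simp add: th_def tau_def W_bracket_def coeff_map_poly)

lemma th_add: "th w (p + q) = th w p + th w q"
  and th_mult: "th w (p * q) = q * th w p + p * th w q"
  and th_D: "th w (D q) = D (th w q)"
  and th_Cst [simp]: "th w (Cst c) = 0"
  and th_0 [simp]: "th w 0 = 0"
  by (simp_all add: th_def B.add_right B.mult_right B.D_right B.right.zero coeff_lamD)

lemma th_emb: "th w (emb b) = emb (br w b) + Cst (z * frm e (br w b))"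
  by (simp add: th_def B_emb)

lemma tau_add: "tau w (p + q) = tau w p + tau w q"
  and tau_mult: "tau w (p * q) = R q * tau w p + R p * tau w q"
  and tau_Cst_mult: "tau w (Cst c * q) = Cst c * tau w q"
  and tau_D: "tau w (D q) = D (tau w q)"
  and tau_Cst [simp]: "tau w (Cst c) = 0"
  and tau_0 [simp]: "tau w 0 = 0"
  by (simp_all add: tau_def WB_add_right WB_mult_right WB_Cst_mult_right WB_D_right WB_right.zero coeff_lamD)

sublocale tau: additive "tau w" for w
  by standard (rule tau_add)

lemma tau_R: "w \<in> g (1/2) \<Longrightarrow> tau w (R q) = tau w q"
  by (simp add: tau_def T_half_R)

text \<open>This is the part of the Jacobi identity of \<open>\<V>(\<gg>)\<close> that the proof uses.\<close>

lemma th_B: "th w (coeff (B (emb a) q) n) = coeff (B (emb a) (th w q)) n + coeff (B (emb (br w a)) q) n"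
proof (induction q arbitrary: n rule: dpoly_emb_induct)
  case (emb i b)
  have jac: "br w (br a b) = br a (br w b) + br (br w a) b"
    by (simp add: br_jacobi[of w a b] add.commute)
  have "frm a (br w b) + frm (br w a) b = 0"
    by (simp add: br_skew[of w a] flip: frm_invariant)
  then have "Cst (frm a (br w b)) + Cst (frm (br w a) b) = (0 :: ('a, 'i) dpoly)"
    by (simp flip: Cst_add)
  then show ?case
    by (cases n; cases "n - 1")
      (auto simp: B_emb th_emb th_add B.add_right jac emb_add frm_add_right Cst_add distrib_left)
next
  case (D q)
  then show ?case
    by (cases n) (simp_all add: B.D_right coeff_lamD th_add th_D D_add)
next
  case (mult p q)
  then show ?case
    by (simp add: B.mult_right th_add th_mult B.add_right algebra_simps)
qed (simp_all add: B.add_right B.right.zero th_add)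

abbreviation tauP :: "'g \<Rightarrow> ('a, 'i) dpoly poly \<Rightarrow> ('a, 'i) dpoly poly" where
  "tauP w \<equiv> map_poly (tau w)"

lemma tauP_add: "tauP w (P + Q) = tauP w P + tauP w Q"
  by (rule poly_eqI) (simp add: coeff_map_poly tau_add)

sublocale tauP: additive "tauP w" for w
  by standard (rule tauP_add)

lemma tauP_arrow: "tauP w (arrow P k) = arrow (tauP w P) (R k) + arrow (RP P) (tau w k)"
proof (induction P arbitrary: k rule: poly_induct_shift)
  case (const p)
  then show ?case by (simp add: map_poly_pCons tau_mult RP_pCons mult.commute)
next
  case (shift P)
  then show ?case
    by (simp add: arrow_shift tauP_add map_poly_pCons RP_pCons R_D tau_D)
qed (simp_all add: arrow_add_left tauP_add RP_add)

lemma tauP_WB: assumes "w \<in> g (1/2)"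
  shows "tauP w (WB (emb a) q) = WB (emb a) (th w q) + WB (emb (br w a)) q"
proof (rule poly_eqI)
  fix n
  have "coeff (tauP w (WB (emb a) q)) n = tau w (coeff (B (emb a) q) n)"
    by (simp add: coeff_map_poly W_bracket_def tau_R[OF assms])
  also have "\<dots> = R (coeff (B (emb a) (th w q)) n + coeff (B (emb (br w a)) q) n)"
    by (simp add: th_B flip: R_th)
  finally show "coeff (tauP w (WB (emb a) q)) n = coeff (WB (emb a) (th w q) + WB (emb (br w a)) q) n"
    by (simp add: W_bracket_def coeff_map_poly R_add)
qed

section \<open>The derivation \<open>M u\<close> and its compatibility with
  \<open>tau\<close>\<close>

lemma T_mhalf_half: assumes "u \<in> g (- (1/2))" "w \<in> g (1/2)"
  shows "WB (emb u) (emb w) = [:emb (br u w), Cst (frm u w):]"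
proof -
  have "br u w \<in> g 0" using assms by simp
  then show ?thesis using frm_e_gr[of "br u w" 0] by (simp add: WB_emb)
qed

lemma T_mhalf_zero: assumes "u \<in> g (- (1/2))" "a \<in> g 0"
  shows "WB (emb u) (emb a) = [:emb (br u a):]"
proof -
  have "br u a \<in> g (- (1/2))" using assms by simp
  moreover have "frm e (br u a) = 0" using frm_gr[OF e_gr, of "br u a" "- (1/2)"] assms by (simp add: field_simps)
  moreover have "frm u a = 0" using frm_gr[of u "- (1/2)" a 0] assms by simp
  ultimately show ?thesis by (simp add: WB_emb)
qed

lemma M_add: "M u (p + q) = M u p + M u q"
  by (simp add: M_def WB_add_right arrow_add_left sum.distrib add_ac)

lemma M_mult: "M u (p * q) = smult (R q) (M u p) + smult (R p) (M u q)"
proof -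
  have "(\<Sum>k\<in>K. arrow (WB (emb (br u (v k))) (p * q)) (emb (v' k)))
      = smult (R q) (\<Sum>k\<in>K. arrow (WB (emb (br u (v k))) p) (emb (v' k)))
      + smult (R p) (\<Sum>k\<in>K. arrow (WB (emb (br u (v k))) q) (emb (v' k)))"
    by (simp add: WB_mult_right arrow_add_left arrow_smult sum.distrib smult_module.scale_sum_right)
  then show ?thesis by (simp add: M_def WB_mult_right smult_add_right)
qed

lemma M_D: "M u (D q) = lamD (M u q)"
  by (simp add: M_def WB_D_right arrow_lamD lamD_add lamD.sum)

lemma M_Cst [simp]: "M u (Cst c) = 0"
  by (simp add: M_def)

lemma M_Cst_mult: "M u (Cst c * q) = smult (Cst c) (M u q)"
  by (simp add: M_mult)

sublocale M: additive "M u" for u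
  by standard (rule M_add)

text \<open>The bracket with u gives -[e, u], the sum over \<open>K\<close> contracts to [e, u].
  Thus \<open>M\<close> factors through \<open>rho\<close>, which lets \<open>tauP_M\<close> replace
  \<open>th w q\<close> by \<open>tau w q\<close>.\<close>

lemma M_e: assumes u: "u \<in> g (- (1/2))" shows "M u (emb e) = 0"
proof -
  have "frm e (br e u) = 0" using u frm_gr[OF e_gr br_e_mhalf_gr[OF u]] by (simp add: field_simps)
  moreover have "frm u e = 0" using frm_gr[OF u e_gr] by (simp add: field_simps)
  moreover have "br u e = - br e u" by (rule br_skew)
  ultimately have 1: "WB (emb u) (emb e) = [:- emb (br e u):]"
    using u by (simp add: WB_emb)
  have 2: "WB (emb a) (emb e) = [:Cst (2 * frm x a):]" if "a \<in> g 0" for a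
  proof -
    have "frm e e = 0" using frm_gr[OF e_gr e_gr] by simp
    moreover have "frm a e = 0" using frm_gr[OF that e_gr] by simp
    ultimately show ?thesis using br_zero_e[OF that]
      by (simp add: WB_emb emb_scl R_mult frm_scl_right mult.commute flip: Cst_mult)
  qed
  have "(\<Sum>k\<in>K. arrow (WB (emb (br u (v k))) (emb e)) (emb (v' k))) = (\<Sum>k\<in>K. [:- (Cst (frm u (v k)) * emb (v' k)):])"
    using u by (intro sum.cong) (simp_all add: 2 frm_x_br)
  also have "\<dots> = [:emb (br e u):]"
    using contract_u(1)[of emb u] u by (simp add: sum_const_poly sum_negf lin_def lin_simps)
  finally show ?thesis by (simp add: M_def 1)
qed

lemma M_R: assumes "u \<in> g (- (1/2))" shows "M u (R q) = M u q"
  by (rule R_absorb[where F = smult and T = "\<lambda>a b. lamD a"]) (simp_all add: M_add M_mult M_D M_e assms)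

text \<open>\<open>tau w\<close> acts on three places of \<open>M u q\<close>: on q it gives 0 as q
  is in W, on u it gives [w, u], and on the factors \<open>v' k\<close> it gives [u, w] after
  contraction. The last two cancel, and [w, [u, v_k]] lies in g_{1/2}, so its bracket with q is
  0.\<close>

lemma tauP_M: assumes w: "w \<in> g (1/2)" and u: "u \<in> g (- (1/2))" and q: "q \<in> W"
  shows "tauP w (M u q) = 0"
proof -
  have "tau w (emb (v' k)) = Cst (om w (v' k))" if "k \<in> K" for k
    using w that by (simp add: tau_def T_half_half)
  then have "tauP w (arrow (WB (emb (br u (v k))) q) (emb (v' k)))
    = arrow (WB (emb (br u (v k))) (th w q)) (emb (v' k)) + WB (emb (br u (scl (om w (v' k)) (v k)))) q" if "k \<in> K" for k
  proof -
    have "RP (WB a b) = WB a b" for a b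
      by (rule poly_eqI) (simp add: coeff_map_poly)
    moreover have "br w (br u (v k)) \<in> g (1/2)" using w u that by simp
    ultimately show ?thesis
      using w that by (simp add: tauP_arrow tauP_WB W_half[OF q] tau_def T_half_half br_scl_right WB_emb_scl)
  qed
  then have "tauP w (M u q) = M u (th w q) + WB (emb (br w u)) q
      + WB (emb (br u (\<Sum>k\<in>K. scl (om w (v' k)) (v k)))) q"
    using w by (simp add: M_def tauP_add tauP_WB tauP.sum sum.distrib br_right.sum emb.sum WB_left.sum cong: sum.cong)
  also have "\<dots> = M u (th w q)"
    using w by (simp add: expand_half br_skew[of w u] WB_left.minus)
  also have "\<dots> = M u (tau w q)"
    using M_R[OF u, of "th w q"] by (simp add: R_th)
  also have "tau w q = 0" using W_half[OF q w] by (simp add: tau_def)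
  finally show ?thesis by (simp add: M.zero)
qed

text \<open>
  The operator \<open>euler\<close> vanishes on invariants, while modulo terms of higher degree in \<open>\<gg>\<^sub>1\<^sub>/\<^sub>2\<close> it counts the
  number of underived factors from \<open>\<gg>\<^sub>1\<^sub>/\<^sub>2\<close>.  Here this number is \<open>1\<close>, \<open>2\<close> or \<open>4\<close>, so an invariant
  annihilated by \<open>(euler - 1)(euler - 2)(euler - 4)\<close> is zero.
\<close>

definition euler :: "('a, 'i) dpoly \<Rightarrow> ('a, 'i) dpoly" where
  "euler q = (\<Sum>k\<in>K. emb (v' k) * tau (v k) q)"

lemma euler_add: "euler (p + q) = euler p + euler q"
  and euler_Cst_mult: "euler (Cst c * q) = Cst c * euler q"
  and euler_mult: "euler (p * q) = R q * euler p + R p * euler q"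
  by (simp_all add: euler_def tau_add tau_Cst_mult tau_mult sum.distrib sum_distrib_left algebra_simps)

sublocale euler: additive euler
  by standard (rule euler_add)

lemma euler_numeral_mult: "euler (numeral n * q) = numeral n * euler q"
  using euler_Cst_mult[of "numeral n" q] by (simp add: Cst_numeral)

lemma euler_half: "w \<in> g (1/2) \<Longrightarrow> euler (emb w) = emb w"
  using contract_half(1)[of emb w]
  by (simp add: euler_def tau_def T_half_half lin_def lin_simps mult.commute cong: sum.cong)

lemma euler_D_half: "w \<in> g (1/2) \<Longrightarrow> euler (D (emb w)) = 0"
  by (simp add: euler_def tau_def T_half_half WB_D_right lamD_const)

lemma euler_zero: "a \<in> g 0 \<Longrightarrow> euler (emb a) = (\<Sum>k\<in>K. emb (v' k) * emb (br (v k) a))"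
  by (simp add: euler_def tau_def T_half_zero)

lemma euler_mhalf: "u \<in> g (- (1/2)) \<Longrightarrow> euler (emb u) = (\<Sum>k\<in>K. emb (v' k) * emb (br (v k) u))"
  by (simp add: euler_def tau_def T_half_mhalf)

text \<open>(t - 1)(t - 2)(t - 4) = t^3 - 7t^2 + 14t - 8 evaluated at \<open>euler\<close>, with the
  negative terms moved to the other side.\<close>

definition pos_degree :: "('a, 'i) dpoly \<Rightarrow> bool" where
  "pos_degree q \<longleftrightarrow> euler (euler (euler q)) + 14 * euler q = 7 * euler (euler q) + 8 * q"

lemma pos_degree_0 [simp]: "pos_degree 0"
  by (simp add: pos_degree_def euler.zero)

lemma pos_degree_add: "pos_degree p \<Longrightarrow> pos_degree q \<Longrightarrow> pos_degree (p + q)"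
proof -
  assume *: "pos_degree p" "pos_degree q"
  have "euler (euler (euler (p + q))) + 14 * euler (p + q)
      = (euler (euler (euler p)) + 14 * euler p) + (euler (euler (euler q)) + 14 * euler q)"
    by (simp only: euler_add distrib_left add_ac)
  also have "\<dots> = (7 * euler (euler p) + 8 * p) + (7 * euler (euler q) + 8 * q)"
    using * by (simp only: pos_degree_def)
  finally show ?thesis
    by (simp only: pos_degree_def euler_add distrib_left add_ac)
qed

lemma pos_degree_Cst_mult: "pos_degree p \<Longrightarrow> pos_degree (Cst c * p)"
proof -
  assume "pos_degree p"
  then have "Cst c * (euler (euler (euler p)) + 14 * euler p) = Cst c * (7 * euler (euler p) + 8 * p)" by (simp add: pos_degree_def)
  then show ?thesis by (simp add: pos_degree_def euler_Cst_mult distrib_left mult.left_commute)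
qed

lemma pos_degree_minus: "pos_degree p \<Longrightarrow> pos_degree (- p)"
  using pos_degree_Cst_mult[of p "-1"] by simp

lemma pos_degree_diff: "pos_degree p \<Longrightarrow> pos_degree q \<Longrightarrow> pos_degree (p - q)"
  using pos_degree_add[OF _ pos_degree_minus, of p q] by simp

lemma pos_degree_sum: "(\<And>k. k \<in> A \<Longrightarrow> pos_degree (p k)) \<Longrightarrow> pos_degree (\<Sum>k\<in>A. p k)"
  by (induct A rule: infinite_finite_induct) (simp_all add: pos_degree_add)

text \<open>On the span of \<open>q\<close>, \<open>b\<close>, \<open>c\<close> the operator is
  triangular with diagonal 1, 2, 4, so the cubic annihilates it.\<close>

lemma pos_degree_triangular: assumes "euler q = q + b" "euler b = 2 * b + c" "euler c = 4 * c" shows "pos_degree q"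
  by (simp add: pos_degree_def euler_add euler_numeral_mult assms)

lemma pos_degree_triangular': assumes "euler b = 2 * b + c" "euler c = 4 * c" shows "pos_degree b"
  by (simp add: pos_degree_def euler_add euler_numeral_mult assms)

lemma euler_two: "a \<in> g (1/2) \<Longrightarrow> b \<in> g (1/2) \<Longrightarrow> euler (emb a * emb b) = 2 * (emb a * emb b)"
  by (simp add: euler_mult euler_half mult.commute)

lemma euler_four: assumes "a \<in> g (1/2)" "b \<in> g (1/2)" "c \<in> g (1/2)" "d \<in> g (1/2)"
  shows "euler (emb a * emb b * (emb c * emb d)) = 4 * (emb a * emb b * (emb c * emb d))"
  using assms by (subst euler_mult) (simp add: euler_two R_mult mult_ac)

lemma pos_degree_two: "a \<in> g (1/2) \<Longrightarrow> b \<in> g (1/2) \<Longrightarrow> pos_degree (emb a * emb b)"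
  by (rule pos_degree_triangular'[where c = 0]) (simp_all add: euler_two euler.zero)

lemma pos_degree_two_D: "a \<in> g (1/2) \<Longrightarrow> b \<in> g (1/2) \<Longrightarrow> pos_degree (emb a * D (emb b))"
  by (rule pos_degree_triangular[where b = 0 and c = 0]) (simp_all add: euler_mult euler_half euler_D_half R_D euler.zero mult.commute)

lemma pos_degree_four: assumes "a \<in> g (1/2)" "b \<in> g (1/2)" "c \<in> g (1/2)" "d \<in> g (1/2)"
  shows "pos_degree (emb a * emb b * (emb c * emb d))"
  by (simp add: pos_degree_def euler_four[OF assms] euler_numeral_mult)

lemma euler_zero_two: assumes "c \<in> g 0" "a \<in> g (1/2)" "b \<in> g (1/2)"
  shows "euler (emb c * (emb a * emb b)) = 2 * (emb c * (emb a * emb b)) + euler (emb c) * (emb a * emb b)"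
  using assms by (subst euler_mult) (simp add: euler_two R_mult mult_ac)

lemma euler_euler_zero_two: assumes "c \<in> g 0" "a \<in> g (1/2)" "b \<in> g (1/2)"
  shows "euler (euler (emb c) * (emb a * emb b)) = 4 * (euler (emb c) * (emb a * emb b))"
  using assms by (simp add: euler_zero sum_distrib_right euler.sum euler_four sum_distrib_left cong: sum.cong)

lemma pos_degree_zero_two: assumes "c \<in> g 0" "a \<in> g (1/2)" "b \<in> g (1/2)" shows "pos_degree (emb c * (emb a * emb b))"
  by (rule pos_degree_triangular'[OF euler_zero_two[OF assms] euler_euler_zero_two[OF assms]])

text \<open>\<open>euler\<close> turns u into products of \<open>v' k\<close> with elements of g_0,
  and an element of g_0 into products of two elements of g_{1/2}; the number of factors from g_{1/2}
  goes 1, 2, 4 and skips 3.\<close>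

lemma pos_degree_mhalf_half: assumes u: "u \<in> g (- (1/2))" and a: "a \<in> g (1/2)" shows "pos_degree (emb u * emb a)"
proof (rule pos_degree_triangular)
  let ?b = "\<Sum>k\<in>K. emb (br (v k) u) * (emb (v' k) * emb a)"
  let ?c = "\<Sum>k\<in>K. euler (emb (br (v k) u)) * (emb (v' k) * emb a)"
  show "euler (emb u * emb a) = emb u * emb a + ?b"
    using assms by (subst euler_mult) (simp add: euler_half euler_mhalf sum_distrib_left mult_ac add.commute)
  show "euler ?b = 2 * ?b + ?c"
    using assms by (simp add: euler.sum euler_zero_two sum.distrib sum_distrib_left cong: sum.cong)
  show "euler ?c = 4 * ?c"
    using assms by (simp add: euler.sum euler_euler_zero_two sum_distrib_left cong: sum.cong)
qed

lemma pos_degree_invariant: assumes "pos_degree q" "\<And>w. w \<in> g (1/2) \<Longrightarrow> tau w q = 0" shows "q = 0"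
proof -
  have "euler q = 0" using assms(2) by (simp add: euler_def)
  then have "8 * q = 0" using assms(1) by (simp add: pos_degree_def euler.zero)
  then have "Cst (1/8) * (Cst 8 * q) = 0" by (simp add: Cst_numeral)
  then show ?thesis by (simp only: mult.assoc[symmetric] Cst_mult[symmetric]) simp
qed

section \<open>The bracket of two elements of weight three halves\<close>

text \<open>Equality up to terms that, by \<open>pos_degree_invariant\<close>, cannot make a
  difference between two invariants.\<close>

definition eqv :: "('a, 'i) dpoly poly \<Rightarrow> ('a, 'i) dpoly poly \<Rightarrow> bool" where
  "eqv P Q \<longleftrightarrow> (\<forall>n. pos_degree (coeff (P - Q) n))"

lemma eqv_refl [simp]: "eqv P P"
  by (simp add: eqv_def)

lemma eqv_sym: "eqv P Q \<Longrightarrow> eqv Q P"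
  unfolding eqv_def using pos_degree_minus by (metis coeff_minus minus_diff_eq)

lemma eqv_trans [trans]: "eqv P Q \<Longrightarrow> eqv Q S \<Longrightarrow> eqv P S"
  unfolding eqv_def
proof
  fix n assume *: "\<forall>n. pos_degree (coeff (P - Q) n)" "\<forall>n. pos_degree (coeff (Q - S) n)"
  have "coeff (P - S) n = coeff (P - Q) n + coeff (Q - S) n" by simp
  then show "pos_degree (coeff (P - S) n)" using * pos_degree_add by metis
qed

lemma eqv_add: "eqv P Q \<Longrightarrow> eqv P' Q' \<Longrightarrow> eqv (P + P') (Q + Q')"
  unfolding eqv_def
proof
  fix n assume *: "\<forall>n. pos_degree (coeff (P - Q) n)" "\<forall>n. pos_degree (coeff (P' - Q') n)"
  have "coeff (P + P' - (Q + Q')) n = coeff (P - Q) n + coeff (P' - Q') n" by simp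
  then show "pos_degree (coeff (P + P' - (Q + Q')) n)" using * pos_degree_add by metis
qed

lemma eqv_smult_Cst: "eqv P Q \<Longrightarrow> eqv (smult (Cst c) P) (smult (Cst c) Q)"
  unfolding eqv_def by (simp add: pos_degree_Cst_mult flip: right_diff_distrib)

lemma eqv_sum: "(\<And>k. k \<in> A \<Longrightarrow> eqv (P k) (Q k)) \<Longrightarrow> eqv (\<Sum>k\<in>A. P k) (\<Sum>k\<in>A. Q k)"
  by (induct A rule: infinite_finite_induct) (simp_all add: eqv_add)

lemma eqv_pCons: "pos_degree (p - q) \<Longrightarrow> eqv P Q \<Longrightarrow> eqv (pCons p P) (pCons q Q)"
  by (auto simp: eqv_def coeff_pCons split: nat.split)

lemma eqv_linear: "pos_degree p \<Longrightarrow> pos_degree q \<Longrightarrow> eqv [:p, q:] 0"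
  by (auto simp: eqv_def coeff_pCons split: nat.split)

lemma M_half: assumes "u \<in> g (- (1/2))" "y \<in> g (1/2)"
  shows "M u (emb y) = [:emb (br u y) + (\<Sum>k\<in>K. emb (br (br u (v k)) y) * emb (v' k)), Cst (frm u y):]"
proof -
  have "(\<Sum>k\<in>K. arrow (WB (emb (br u (v k))) (emb y)) (emb (v' k)))
      = [:\<Sum>k\<in>K. emb (br (br u (v k)) y) * emb (v' k):]"
    using assms by (simp add: T_zero_half sum_const_poly cong: sum.cong)
  then show ?thesis using assms by (simp add: M_def T_mhalf_half)
qed

lemma M_zero: assumes u: "u \<in> g (- (1/2))" and b: "b \<in> g 0"
  shows "M u (emb b) = [:emb (br u b) + (\<Sum>k\<in>K. emb (br (br u (v k)) b) * emb (v' k)) + D (emb (br e (br u b))),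
    emb (br e (br u b)):]"
proof -
  have ub: "br u b \<in> g (- (1/2))" using assms by simp
  have arr: "arrow [:p, Cst c:] q = [:p * q + Cst c * D q, Cst c * q:]" for p q c
  proof -
    have "[:p, Cst c:] = [:p:] + pCons 0 [:Cst c:]" by simp
    then show ?thesis by (simp only: arrow_add_left arrow_shift arrow_const) simp
  qed
  have frm: "frm (br u y) b = - frm (br u b) y" for y
    by (simp add: frm_invariant br_skew[of y b])
  have "(\<Sum>k\<in>K. arrow (WB (emb (br u (v k))) (emb b)) (emb (v' k)))
    = [:(\<Sum>k\<in>K. emb (br (br u (v k)) b) * emb (v' k)) - (\<Sum>k\<in>K. Cst (frm (br u b) (v k)) * D (emb (v' k))),
        - (\<Sum>k\<in>K. Cst (frm (br u b) (v k)) * emb (v' k)):]"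
    using assms
    by (simp add: T_zero_zero arr[of _ "- _", unfolded Cst_minus] frm sum_linear_poly sum_subtractf sum_negf
        cong: sum.cong)
  also have "(\<Sum>k\<in>K. Cst (frm (br u b) (v k)) * D (emb (v' k))) = - D (emb (br e (br u b)))"
    by (rule contract_u(1)[OF _ ub]) (simp add: lin_def lin_simps)
  also have "(\<Sum>k\<in>K. Cst (frm (br u b) (v k)) * emb (v' k)) = - emb (br e (br u b))"
    by (rule contract_u(1)[OF _ ub]) (simp add: lin_def lin_simps)
  finally show ?thesis using assms by (simp add: M_def T_mhalf_zero add.assoc)
qed

lemma frm_br_e: "frm u (br e u1) = - omega u u1"
proof -
  have "frm u (br e u1) = frm (br u e) u1" by (simp add: frm_invariant)
  also have "\<dots> = - frm e (br u u1)" by (simp add: br_skew[of u e] frm_invariant)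
  finally show ?thesis by (simp add: omega_def)
qed

lemma M_mhalf: assumes u: "u \<in> g (- (1/2))" and u1: "u1 \<in> g (- (1/2))"
  shows "M u (emb u1) = [:Cst (omega u u1 / (2 * frm x x)) * emb f + Cst (z * omega u u1)
    + (\<Sum>k\<in>K. emb (br (br u (v k)) u1) * emb (v' k)):]"
proof -
  have "frm u u1 = 0" using frm_gr[OF u u1] by (simp add: half_cancel)
  then have "WB (emb u) (emb u1) = [:Cst (omega u u1 / (2 * frm x x)) * emb f + Cst (z * omega u u1):]"
    by (simp add: WB_emb br_mhalf_mhalf[OF u u1] emb_scl R_mult frm_scl_right frm_e_f)
  moreover have "(\<Sum>k\<in>K. arrow (WB (emb (br u (v k))) (emb u1)) (emb (v' k)))
      = [:\<Sum>k\<in>K. emb (br (br u (v k)) u1) * emb (v' k):]"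
    using assms by (simp add: T_zero_mhalf sum_const_poly cong: sum.cong)
  ultimately show ?thesis by (simp add: M_def)
qed

text \<open>\<open>M u\<close> is a derivation and replaces one factor at a time, so two underived
  factors from g_{1/2} always survive.\<close>

lemma eqv_M_three: assumes u: "u \<in> g (- (1/2))" and y: "a \<in> g (1/2)" "b \<in> g (1/2)" "c \<in> g (1/2)"
  shows "eqv (M u (emb a * emb b * emb c)) 0"
proof -
  have *: "eqv (smult (emb p * emb q) (M u (emb y))) 0" if "p \<in> g (1/2)" "q \<in> g (1/2)" "y \<in> g (1/2)" for p q y
  proof -
    have "pos_degree (emb (br u y) * (emb p * emb q))"
      using u that by (intro pos_degree_zero_two) auto
    moreover have "pos_degree (\<Sum>k\<in>K. emb p * emb q * (emb (br (br u (v k)) y) * emb (v' k)))"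
      using u that by (intro pos_degree_sum pos_degree_four) auto
    moreover have "pos_degree (Cst (frm u y) * (emb p * emb q))"
      using that by (intro pos_degree_Cst_mult pos_degree_two) auto
    ultimately show ?thesis
      unfolding M_half[OF u that(3)]
      by (simp add: eqv_linear pos_degree_add distrib_left sum_distrib_left mult.commute)
  qed
  have "M u (emb a * emb b * emb c) = smult (emb b * emb c) (M u (emb a)) + smult (emb a * emb c) (M u (emb b))
      + smult (emb a * emb b) (M u (emb c))"
    using y by (simp add: M_mult R_mult smult_add_right mult_ac add_ac)
  then show ?thesis
    using eqv_add[OF eqv_add[OF *[OF y(2,3,1)] *[OF y(1,3,2)]] *[OF y(1,2,3)]] by simp
qed

text \<open>When \<open>M u\<close> acts on b the factor y survives, so only its action on y counts,
  and of that only the terms outside the sum over \<open>K\<close>.\<close>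

lemma eqv_M_quad: assumes u: "u \<in> g (- (1/2))" and b: "b \<in> g 0" and y: "y \<in> g (1/2)"
  shows "eqv (M u (emb b * emb y)) [:emb b * emb (br u y), Cst (frm u y) * emb b:]"
proof -
  have "eqv (smult (emb y) (M u (emb b))) 0"
  proof -
    have w: "br e (br u b) \<in> g (1/2)" "br u b \<in> g (- (1/2))" using u b by simp_all
    have "pos_degree (emb (br u b) * emb y)" using u b y by (intro pos_degree_mhalf_half) auto
    moreover have "pos_degree (\<Sum>k\<in>K. emb (br (br u (v k)) b) * (emb (v' k) * emb y))"
      using u b y by (intro pos_degree_sum pos_degree_zero_two) auto
    moreover have "pos_degree (emb y * D (emb (br e (br u b))))" using w y by (intro pos_degree_two_D)
    moreover have "pos_degree (emb y * emb (br e (br u b)))" using w y by (intro pos_degree_two)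
    ultimately show ?thesis
      unfolding M_zero[OF u b]
      by (simp add: eqv_linear pos_degree_add distrib_left sum_distrib_left mult_ac)
  qed
  moreover have "eqv (smult (emb b) (M u (emb y))) [:emb b * emb (br u y), Cst (frm u y) * emb b:]"
  proof -
    have "pos_degree (\<Sum>k\<in>K. emb b * (emb (br (br u (v k)) y) * emb (v' k)))"
      using u b y by (intro pos_degree_sum pos_degree_zero_two) auto
    then show ?thesis
      unfolding M_half[OF u y]
      by (simp add: eqv_pCons distrib_left sum_distrib_left mult.commute)
  qed
  ultimately show ?thesis
    using eqv_add[of "smult (emb y) (M u (emb b))" 0] b y by (simp add: M_mult)
qed

lemma pos_degree_two_D': "a \<in> g (1/2) \<Longrightarrow> b \<in> g (1/2) \<Longrightarrow> pos_degree (D (emb a * emb b))"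
  using pos_degree_add[OF pos_degree_two_D[of a b] pos_degree_two_D[of b a]] by (simp add: D_mult)

lemma eqv_M_ps: assumes u: "u \<in> g (- (1/2))" and u1: "u1 \<in> g (- (1/2))"
  shows "eqv (M u (ps u1))
    [:Cst (omega u u1 / (2 * frm x x)) * emb f + Cst (z * omega u u1) + D (emb (br u (br e u1)))
        + (\<Sum>k\<in>K. emb (br u1 (v k)) * emb (br u (v' k))),
      emb (br u (br e u1)) + emb (br u1 (br e u)),
      - Cst (omega u u1):]"
proof -
  let ?O = "omega u u1"
  have w1: "br e u1 \<in> g (1/2)" using u1 by simp
  have 1: "eqv (M u (emb u1)) [:Cst (?O / (2 * frm x x)) * emb f + Cst (z * ?O):]"
    unfolding M_mhalf[OF u u1] using u u1
    by (intro eqv_pCons) (auto intro!: pos_degree_sum pos_degree_mhalf_half)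
  have cubic: "eqv (smult (Cst (1/3)) (M u (\<Sum>h\<in>K. \<Sum>k\<in>K. emb (br (br u1 (v h)) (v k)) * emb (v' h) * emb (v' k))))
     (smult (Cst (1/3)) (\<Sum>h\<in>K. \<Sum>k\<in>K. 0))"
    unfolding M.sum using u u1 by (intro eqv_smult_Cst eqv_sum eqv_M_three) auto
  have "eqv (M u (\<Sum>k\<in>K. emb (br u1 (v k)) * emb (v' k)))
      (\<Sum>k\<in>K. [:emb (br u1 (v k)) * emb (br u (v' k)), Cst (frm u (v' k)) * emb (br u1 (v k)):])"
    unfolding M.sum using u u1 by (intro eqv_sum eqv_M_quad) auto
  also have "(\<Sum>k\<in>K. [:emb (br u1 (v k)) * emb (br u (v' k)), Cst (frm u (v' k)) * emb (br u1 (v k)):])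
      = [:\<Sum>k\<in>K. emb (br u1 (v k)) * emb (br u (v' k)), emb (br u1 (br e u)):]"
    using contract_u(2)[of "\<lambda>y. emb (br u1 y)" u] u by (simp add: sum_linear_poly lin_def lin_simps)
  finally have quad: "eqv (M u (\<Sum>k\<in>K. emb (br u1 (v k)) * emb (v' k)))
      [:\<Sum>k\<in>K. emb (br u1 (v k)) * emb (br u (v' k)), emb (br u1 (br e u)):]" .
  have "frm u (br e u1) = - ?O" by (rule frm_br_e)
  then have "M u (D (emb (br e u1))) = [:D (emb (br u (br e u1))), emb (br u (br e u1)), - Cst ?O:]
      + [:\<Sum>k\<in>K. D (emb (br (br u (v k)) (br e u1)) * emb (v' k)), \<Sum>k\<in>K. emb (br (br u (v k)) (br e u1)) * emb (v' k):]"
    by (simp add: M_D M_half[OF u w1] lamD_pCons D_add D.sum D.minus)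
  moreover have "eqv \<dots> ([:D (emb (br u (br e u1))), emb (br u (br e u1)), - Cst ?O:] + 0)"
    using u w1 by (intro eqv_add eqv_refl eqv_linear pos_degree_sum pos_degree_two pos_degree_two_D') auto
  ultimately have der: "eqv (M u (D (emb (br e u1)))) [:D (emb (br u (br e u1))), emb (br u (br e u1)), - Cst ?O:]"
    by simp
  from eqv_add[OF eqv_add[OF eqv_add[OF 1 cubic] quad] der]
  show ?thesis by (simp add: psi_gen_def M_add M_Cst_mult add_ac)
qed

section \<open>The projection to g_0^f and comparison of the two sides\<close>

lemma sharp_g0f: assumes "a \<in> g 0" shows "sharp a \<in> g0f"
  using assms x_gr by (intro g0fI) (simp_all add: sharp_def gr_diff gr_scl frm_right.diff frm_scl_right frm_sym[of x a])

lemma pos_degree_ph_ph: assumes a: "a \<in> g0f" and b: "b \<in> g0f" shows "pos_degree (ph a * ph b - emb a * emb b)"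
proof -
  let ?S = "\<lambda>a. \<Sum>k\<in>K. emb (br a (v k)) * emb (v' k)"
  have "pos_degree (emb a * ?S b)"
    unfolding sum_distrib_left using assms by (intro pos_degree_sum pos_degree_zero_two) auto
  moreover have "pos_degree (emb b * ?S a)"
    unfolding sum_distrib_left using assms by (intro pos_degree_sum pos_degree_zero_two) auto
  moreover have "pos_degree (?S a * ?S b)"
    unfolding sum_distrib_left sum_distrib_right using assms by (intro pos_degree_sum pos_degree_four) auto
  ultimately have "pos_degree (Cst (1/2) * (emb a * ?S b) + Cst (1/2) * (emb b * ?S a) + Cst (1/2) * (Cst (1/2) * (?S a * ?S b)))"
    by (intro pos_degree_add pos_degree_Cst_mult)
  moreover have "ph a * ph b - emb a * emb b
    = Cst (1/2) * (emb a * ?S b) + Cst (1/2) * (emb b * ?S a) + Cst (1/2) * (Cst (1/2) * (?S a * ?S b))"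
    unfolding phi_gen_def by (simp only: distrib_left distrib_right mult_ac add_ac) simp
  ultimately show ?thesis by simp
qed

lemma pos_degree_ph: assumes a: "a \<in> g0f" shows "pos_degree (ph a - emb a)" "pos_degree (D (ph a) - D (emb a))"
  using assms
  by (auto simp: phi_gen_def D_add D_Cst_mult D.sum intro!: pos_degree_Cst_mult pos_degree_sum pos_degree_two pos_degree_two_D')

lemma pos_degree_L: "pos_degree (L - (emb f + D (emb x) + Cst (1/2) * (\<Sum>j\<in>J0. emb (al j) * emb (al' j))))"
proof -
  have "pos_degree ((\<Sum>k\<in>K. emb (br f (v k)) * emb (v' k)) + Cst (1/2) * (\<Sum>k\<in>K. emb (v' k) * D (emb (v k))))"
    by (intro pos_degree_add pos_degree_Cst_mult pos_degree_sum pos_degree_mhalf_half pos_degree_two_D) auto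
  then show ?thesis by (simp add: L_gen_def mult.commute)
qed

text \<open>The decomposition of g_0 into g_0^f and Fx is orthogonal, so the Casimir elements differ
  by x^2/(x|x). This square is needed against the one in \<open>sharp_quadratic\<close>.\<close>

lemma casimir_g0: "(\<Sum>j\<in>J0. emb (al j) * emb (al' j)) - (\<Sum>i\<in>I0. emb (cl i) * emb (cl' i))
    = Cst (1 / frm x x) * (emb x * emb x)"
proof -
  have split: "emb a = (\<Sum>i\<in>I0. Cst (frm (cl i) a) * emb (cl' i)) + Cst (1 / frm x x) * (Cst (frm x a) * emb x)"
    if a: "a \<in> g 0" for a
  proof -
    have perp: "frm (cl i) (sharp a) = frm (cl i) a" if "i \<in> I0" for i
      using cl_gr[OF that] by (simp add: sharp_def frm_right.diff frm_scl_right frm_sym[of "cl i" x])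
    have "emb (sharp a) = (\<Sum>i\<in>I0. Cst (frm (cl i) a) * emb (cl' i))"
      using lin_sum[of emb "\<lambda>i. frm (cl i) (sharp a)" cl' I0] expand_g0f(1)[OF sharp_g0f[OF a]]
      by (simp add: perp lin_def lin_simps cong: sum.cong)
    moreover have "emb a = emb (sharp a) + Cst (1 / frm x x * frm x a) * emb x"
      by (simp add: sharp_def emb.diff emb_scl frm_sym[of x a])
    ultimately show ?thesis by (simp only: Cst_mult mult.assoc)
  qed
  have lin: "lin emb" by (simp add: lin_def lin_simps)
  have "(\<Sum>j\<in>J0. emb (al j) * emb (al' j))
      = (\<Sum>j\<in>J0. \<Sum>i\<in>I0. emb (cl' i) * (Cst (frm (cl i) (al j)) * emb (al' j)))
        + (\<Sum>j\<in>J0. Cst (1 / frm x x) * emb x * (Cst (frm x (al j)) * emb (al' j)))"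
    unfolding sum.distrib[symmetric]
  proof (rule sum.cong)
    fix j assume "j \<in> J0"
    then have "emb (al j) * emb (al' j)
      = ((\<Sum>i\<in>I0. Cst (frm (cl i) (al j)) * emb (cl' i)) + Cst (1 / frm x x) * (Cst (frm x (al j)) * emb x)) * emb (al' j)"
      by (subst split) simp_all
    then show "emb (al j) * emb (al' j)
      = (\<Sum>i\<in>I0. emb (cl' i) * (Cst (frm (cl i) (al j)) * emb (al' j)))
        + Cst (1 / frm x x) * emb x * (Cst (frm x (al j)) * emb (al' j))"
      by (simp add: distrib_right distrib_left sum_distrib_right sum_distrib_left mult_ac)
  qed simp
  also have "\<dots> = (\<Sum>i\<in>I0. emb (cl' i) * (\<Sum>j\<in>J0. Cst (frm (cl i) (al j)) * emb (al' j)))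
        + Cst (1 / frm x x) * emb x * (\<Sum>j\<in>J0. Cst (frm x (al j)) * emb (al' j))"
    by (subst sum.swap) (simp add: sum_distrib_left)
  also have "\<dots> = (\<Sum>i\<in>I0. emb (cl' i) * emb (cl i)) + Cst (1 / frm x x) * emb x * emb x"
    using x_gr cl_gr by (simp add: contract_g0(2)[OF lin] cong: sum.cong)
  finally show ?thesis by (simp add: mult.commute mult.left_commute)
qed

lemma sharp_br_mhalf: assumes "u \<in> g (- (1/2))" shows "sharp (br u w) = br u w + scl (frm u w / (2 * frm x x)) x"
  using frm_x_br[OF assms] by (simp add: sharp_def frm_sym[of "br u w" x])

text \<open>Each \<open>sharp\<close> adds a multiple of x to its factor. The cross terms together
  give -2 times the x^2-term coming from the product of the two corrections, so one such term is
  left with a negative sign.\<close>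

lemma sharp_quadratic: assumes u: "u \<in> g (- (1/2))" and u1: "u1 \<in> g (- (1/2))"
  shows "(\<Sum>k\<in>K. emb (sharp (br u (v' k))) * emb (sharp (br u1 (v k))))
    = (\<Sum>k\<in>K. emb (br u1 (v k)) * emb (br u (v' k)))
      - Cst (omega u u1 / (2 * frm x x)) * (Cst (1 / (2 * frm x x)) * (emb x * emb x))"
proof -
  let ?O = "omega u u1"
  define r :: 'a where "r = 1 / (2 * frm x x)"
  define X where "X = emb x"
  define A where "A k = emb (br u (v' k))" for k
  define A1 where "A1 k = emb (br u1 (v k))" for k
  have sharp: "emb (sharp (br u w)) = emb (br u w) + Cst r * Cst (frm u w) * X" if "u \<in> g (- (1/2))" for u w
  proof -
    have "emb (sharp (br u w)) = emb (br u w) + Cst (r * frm u w) * X"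
      unfolding sharp_br_mhalf[OF that] emb_add emb_scl X_def r_def by simp
    then show ?thesis by (simp only: Cst_mult)
  qed
  have s1: "(\<Sum>k\<in>K. Cst (frm u (v' k)) * A1 k) = emb (br u1 (br e u))"
    unfolding A1_def by (rule contract_u(2)[OF _ u]) (simp add: lin_def lin_simps)
  have s2: "(\<Sum>k\<in>K. Cst (frm u1 (v k)) * A k) = - emb (br u (br e u1))"
    unfolding A_def by (rule contract_u(1)[OF _ u1]) (simp add: lin_def lin_simps)
  have s3: "(\<Sum>k\<in>K. Cst (frm u (v' k)) * Cst (frm u1 (v k))) = (Cst ?O :: ('a, 'i) dpoly)"
  proof -
    have "(\<Sum>k\<in>K. Cst (frm u (v' k)) * Cst (frm u1 (v k))) = (Cst (frm u1 (br e u)) :: ('a, 'i) dpoly)"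
      using contract_u(2)[of "\<lambda>y. Cst (frm u1 y)" u] u by (simp add: lin_def lin_simps mult.commute)
    also have "frm u1 (br e u) = ?O" by (simp add: omega_def frm_sym[of u1] frm_invariant)
    finally show ?thesis .
  qed
  \<comment> \<open>By Jacobi the difference is -[e, [u, u1]], and [u, u1] is a multiple of
    f.\<close>
  have s4: "emb (br u1 (br e u)) - emb (br u (br e u1)) = - (2 * (Cst ?O * (Cst r * X)))"
  proof -
    have "br u1 (br e u) - br u (br e u1) = - br e (br u u1)"
      by (simp add: br_jacobi[of e u u1] br_skew[of u1 "br e u"])
    also have "\<dots> = scl (- (2 * (?O * r))) x"
      using br_mhalf_mhalf[OF u u1] by (simp add: br_scl_right br_e_f r_def)
    finally have "emb (br u1 (br e u)) - emb (br u (br e u1)) = Cst (- (2 * (?O * r))) * X"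
      by (metis X_def emb.diff emb_scl)
    then show ?thesis by (simp add: Cst_mult Cst_numeral mult.assoc)
  qed
  have "(\<Sum>k\<in>K. emb (sharp (br u (v' k))) * emb (sharp (br u1 (v k))))
    = (\<Sum>k\<in>K. A1 k * A k + Cst r * X * (Cst (frm u (v' k)) * A1 k) + Cst r * X * (Cst (frm u1 (v k)) * A k)
        + Cst r * X * (Cst r * X) * (Cst (frm u (v' k)) * Cst (frm u1 (v k))))"
    using u u1 by (intro sum.cong refl) (simp add: sharp A_def A1_def algebra_simps)
  also have "\<dots> = (\<Sum>k\<in>K. A1 k * A k) + Cst r * X * emb (br u1 (br e u)) + Cst r * X * (- emb (br u (br e u1)))
      + Cst r * X * (Cst r * X) * Cst ?O"
    by (simp only: sum.distrib sum_distrib_left[symmetric] s1 s2 s3)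
  also have "\<dots> = (\<Sum>k\<in>K. A1 k * A k) + Cst r * X * (emb (br u1 (br e u)) - emb (br u (br e u1)))
      + Cst r * X * (Cst r * X) * Cst ?O"
    by (simp add: right_diff_distrib)
  also have "\<dots> = (\<Sum>k\<in>K. A1 k * A k) - Cst (?O * r) * (Cst r * (X * X))"
    unfolding s4 by (simp add: Cst_mult algebra_simps)
  finally show ?thesis by (simp add: A_def A1_def X_def r_def)
qed

abbreviation Lt :: "('a, 'i) dpoly" where
  "Lt \<equiv> Lt_gen J0 al al' I0 cl cl' K v v'"

lemma bracket_ps_ps: assumes u: "u \<in> g (- (1/2))" and u1: "u1 \<in> g (- (1/2))"
  shows "WB (ps u) (ps u1) = [:\<Sum>k\<in>K. ph (sharp (br u (v' k))) * ph (sharp (br u1 (v k))):]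
    + DL 1 2 (ph (sharp (br u (br e u1)))) + [:Cst (omega u u1 / (2 * frm x x)) * Lt:]
    - monom (Cst (omega u u1)) 2 + [:Cst (z * omega u u1):]"
proof -
  let ?O = "omega u u1"
  let ?r = "?O / (2 * frm x x)"
  let ?c = "sharp (br u (br e u1))"
  let ?P = "\<Sum>k\<in>K. ph (sharp (br u (v' k))) * ph (sharp (br u1 (v k)))"
  let ?rhs = "[:?P + D (ph ?c) + Cst ?r * Lt + Cst (z * ?O), 2 * ph ?c, - Cst ?O:]"
  have c: "?c \<in> g0f" using u u1 by (intro sharp_g0f) auto
  have sharp_mem: "sharp (br u (v' k)) \<in> g0f" "sharp (br u1 (v k)) \<in> g0f" if "k \<in> K" for k
    using u u1 that by (auto intro: sharp_g0f)
  have emb_c: "emb ?c = emb (br u (br e u1)) - Cst ?r * emb x"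
    using sharp_br_mhalf[OF u, of "br e u1"] by (simp add: emb.diff emb_scl frm_br_e)
  \<comment> \<open>[u, [e, u1]] and [u1, [e, u]] differ by a multiple of x, and their mean is
    \<open>?c\<close>; hence \<open>2 * ph ?c\<close> at \<lambda>.\<close>
  have "br u1 (br e u) = br u (br e u1) - br e (br u u1)"
    by (simp add: br_jacobi[of e u u1] br_skew[of u1 "br e u"])
  also have "br e (br u u1) = scl (?r + ?r) x"
    using br_mhalf_mhalf[OF u u1] by (simp add: br_scl_right br_e_f)
  finally have "emb (br u1 (br e u)) = emb (br u (br e u1)) - (Cst ?r + Cst ?r) * emb x"
    by (simp only: emb.diff emb_scl Cst_add)
  then have lambda_part: "emb (br u (br e u1)) + emb (br u1 (br e u)) = 2 * emb ?c"
    by (simp add: emb_c algebra_simps)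
  let ?S = "\<Sum>k\<in>K. emb (sharp (br u (v' k))) * emb (sharp (br u1 (v k)))"
  let ?C0 = "\<Sum>j\<in>J0. emb (al j) * emb (al' j)" and ?C0f = "\<Sum>i\<in>I0. emb (cl i) * emb (cl' i)"
  \<comment> \<open>The x^2 of \<open>sharp_quadratic\<close> cancels against that of
    \<open>casimir_g0\<close>, and the derivative of x in \<open>D (emb ?c)\<close> against x' in
    L.\<close>
  have free: "?S + D (emb ?c) + Cst ?r * ((emb f + D (emb x) + Cst (1/2) * ?C0) - Cst (1/2) * ?C0f) + Cst (z * ?O)
    = Cst ?r * emb f + Cst (z * ?O) + D (emb (br u (br e u1)))
        + (\<Sum>k\<in>K. emb (br u1 (v k)) * emb (br u (v' k)))"
  proof -
    have "Cst (1/2) * ?C0 - Cst (1/2) * ?C0f = Cst (1/2) * (Cst (1 / frm x x) * (emb x * emb x))"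
      using casimir_g0 by (simp flip: right_diff_distrib)
    also have "\<dots> = Cst (1 / (2 * frm x x)) * (emb x * emb x)"
      by (simp flip: mult.assoc Cst_mult)
    finally have "Cst ?r * (Cst (1/2) * ?C0) - Cst ?r * (Cst (1/2) * ?C0f)
        = Cst ?r * (Cst (1 / (2 * frm x x)) * (emb x * emb x))"
      by (simp flip: right_diff_distrib)
    then show ?thesis
      unfolding sharp_quadratic[OF u u1] emb_c D.diff D_Cst_mult
      by (simp add: right_diff_distrib distrib_left)
  qed
  have "pos_degree (?P - ?S)"
    unfolding sum_subtractf[symmetric] by (intro pos_degree_sum pos_degree_ph_ph sharp_mem)
  moreover have "pos_degree (Lt - ((emb f + D (emb x) + Cst (1/2) * ?C0) - Cst (1/2) * ?C0f))"
  proof -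
    have "pos_degree ((L - (emb f + D (emb x) + Cst (1/2) * ?C0)) - Cst (1/2) * (\<Sum>i\<in>I0. ph (cl i) * ph (cl' i) - emb (cl i) * emb (cl' i)))"
      by (intro pos_degree_diff pos_degree_L pos_degree_Cst_mult pos_degree_sum pos_degree_ph_ph cl_gr)
    then show ?thesis by (simp add: Lt_gen_def sum_subtractf right_diff_distrib algebra_simps)
  qed
  ultimately have "pos_degree ((?P - ?S) + (D (ph ?c) - D (emb ?c))
      + Cst ?r * (Lt - ((emb f + D (emb x) + Cst (1/2) * ?C0) - Cst (1/2) * ?C0f)))"
    using pos_degree_ph[OF c] by (intro pos_degree_add pos_degree_Cst_mult)
  then have "pos_degree ((?P + D (ph ?c) + Cst ?r * Lt + Cst (z * ?O))
      - (?S + D (emb ?c) + Cst ?r * ((emb f + D (emb x) + Cst (1/2) * ?C0) - Cst (1/2) * ?C0f) + Cst (z * ?O)))"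
    by (simp add: right_diff_distrib distrib_left algebra_simps)
  moreover have "pos_degree (2 * ph ?c - 2 * emb ?c)"
    using pos_degree_Cst_mult[OF pos_degree_ph(1)[OF c], of 2] by (simp add: Cst_numeral right_diff_distrib)
  ultimately have "eqv ?rhs [:Cst ?r * emb f + Cst (z * ?O) + D (emb (br u (br e u1)))
        + (\<Sum>k\<in>K. emb (br u1 (v k)) * emb (br u (v' k))),
      emb (br u (br e u1)) + emb (br u1 (br e u)), - Cst ?O:]"
    unfolding free lambda_part by (intro eqv_pCons eqv_refl)
  from eqv_trans[OF eqv_M_ps[OF u u1] eqv_sym[OF this]]
  have pos_degree: "pos_degree (coeff (M u (ps u1) - ?rhs) n)" for n by (simp add: eqv_def)
  \<comment> \<open>The coefficients of \<open>?rhs\<close> are differential polynomials in elements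
    of W, on which the derivation \<open>tau w\<close> vanishes.\<close>
  have "coeff (M u (ps u1) - ?rhs) n = 0" for n
  proof (rule pos_degree_invariant[OF pos_degree])
    fix w assume w: "w \<in> g (1/2)"
    have tau_ph: "tau w (ph a) = 0" if "a \<in> g0f" for a using T_phi_half[OF that w] by (simp add: tau_def)
    have tau_L: "tau w L = 0" using T_L_half[OF w] by (simp add: tau_def)
    have tau_P: "tau w ?P = 0"
      by (simp add: tau.sum tau_mult tau_ph sharp_mem cong: sum.cong)
    have tau_Lt: "tau w Lt = 0"
      by (simp add: Lt_gen_def tau.diff tau_L tau_Cst_mult tau.sum tau_mult tau_ph cl_gr cong: sum.cong)
    have tau_2: "tau w (2 * ph ?c) = 0" using tau_ph[OF c] tau_Cst_mult[of w 2 "ph ?c"] by (simp add: Cst_numeral)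
    have "tauP w ?rhs = 0"
      by (simp add: map_poly_pCons tau_add tau_P tau_D tau_ph[OF c] tau_Cst_mult tau_Lt tau_2 tau.minus)
    then have "tauP w (M u (ps u1) - ?rhs) = 0"
      using tauP_M[OF w u ps_W[OF u1]] by (simp only: tauP.diff) simp
    then have "coeff (tauP w (M u (ps u1) - ?rhs)) n = 0" by simp
    then show "tau w (coeff (M u (ps u1) - ?rhs) n) = 0" by (simp only: coeff_map_poly tau_0)
  qed
  then have "M u (ps u1) - ?rhs = 0" by (intro poly_eqI) simp
  then show ?thesis
    using WB_ps[OF u ps_W[OF u1]]
    by (simp add: DL_def numeral_2_eq_2 monom_Suc monom_0 Cst_numeral[symmetric] add_ac)
qed

end

section \<open>The main theorem\<close>

theorem theorem4p4:
  fixes scl :: "'a::{alg_closed_field, field_char_0} \<Rightarrow> 'g::ab_group_add \<Rightarrow> 'g"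
    and br :: "'g \<Rightarrow> 'g \<Rightarrow> 'g"
    and frm :: "'g \<Rightarrow> 'g \<Rightarrow> 'a"
    and bas :: "'i::finite \<Rightarrow> 'g"
    and e x f :: 'g
    and z :: 'a
    and J0 :: "'j set" and a a' :: "'j \<Rightarrow> 'g"
    and J0f :: "'l set" and c c' :: "'l \<Rightarrow> 'g"
    and K :: "'k set" and v v' :: "'k \<Rightarrow> 'g"
  assumes min: "minimal_nilpotent scl br frm bas e x f"
  defines "gr \<equiv> lie_algebra.gr scl br x"
    and "g0f \<equiv> minimal_nilpotent.g0f scl br x f"
    and "sharp \<equiv> minimal_nilpotent.sharp scl frm x"
    and "\<omega> \<equiv> minimal_nilpotent.omega br frm e"
    and "W \<equiv> simple_lie_algebra_with_form.W_algebra scl br frm bas x f e z"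
    and "lam \<equiv> simple_lie_algebra_with_form.W_bracket scl br frm bas x f e z"
    and "L \<equiv> minimal_nilpotent.L_gen scl br bas x f J0 a a' K v v'"
    and "\<phi> \<equiv> minimal_nilpotent.phi_gen scl br bas K v v'"
    and "\<psi> \<equiv> minimal_nilpotent.psi_gen scl br bas e K v v'"
    and "Lt \<equiv> minimal_nilpotent.Lt_gen scl br bas x f J0 a a' J0f c c' K v v'"
  assumes dual_g0: "lie_algebra.dual_bases scl frm (gr 0) J0 a a'"
    and dual_g0f: "lie_algebra.dual_bases scl frm g0f J0f c c'"
    and dual_half: "lie_algebra.dual_bases scl (\<lambda>y w. frm f (br y w)) (gr (1/2)) K v v'"
  shows
    "(lam L L = DL 1 2 L - monom (Cst (frm x x)) 3 + monom (Cst (4 * frm x x * z)) 1) \<and>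
     (\<forall>q\<in>g0f. lam L (\<phi> q) = DL 1 1 (\<phi> q)) \<and>
     (\<forall>p\<in>g0f. lam (\<phi> p) L = DL 0 1 (\<phi> p)) \<and>
     (\<forall>u\<in>gr (- (1/2)). lam L (\<psi> u) = DL 1 (3/2) (\<psi> u)) \<and>
     (\<forall>u\<in>gr (- (1/2)). lam (\<psi> u) L = DL (1/2) (3/2) (\<psi> u)) \<and>
     (\<forall>p\<in>g0f. \<forall>q\<in>g0f. lam (\<phi> p) (\<phi> q) = [:\<phi> (br p q):] + monom (Cst (frm p q)) 1) \<and>
     (\<forall>p\<in>g0f. \<forall>u\<in>gr (- (1/2)). lam (\<phi> p) (\<psi> u) = [:\<psi> (br p u):]) \<and>
     (\<forall>u\<in>gr (- (1/2)). \<forall>q\<in>g0f. lam (\<psi> u) (\<phi> q) = [:\<psi> (br u q):]) \<and>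
     (\<forall>u\<in>gr (- (1/2)). \<forall>u1\<in>gr (- (1/2)).
        lam (\<psi> u) (\<psi> u1) =
          [:\<Sum>k\<in>K. \<phi> (sharp (br u (v' k))) * \<phi> (sharp (br u1 (v k))):]
          + DL 1 2 (\<phi> (sharp (br u (br e u1))))
          + [:Cst (\<omega> u u1 / (2 * frm x x)) * Lt:]
          - monom (Cst (\<omega> u u1)) 2
          + [:Cst (z * \<omega> u u1):]) \<and>
     energy_momentum_element W lam L \<and>
     (\<forall>p\<in>g0f. primary_of_weight W lam L 1 (\<phi> p)) \<and>
     (\<forall>u\<in>gr (- (1/2)). primary_of_weight W lam L (3/2) (\<psi> u))"
proof -
  interpret W: minimal_W scl br frm bas e x f z J0 a a' J0f c c' K v v'
    using dual_g0 dual_g0f dual_half unfolding gr_def g0f_def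
    by (intro minimal_W.intro[OF min] minimal_W_axioms.intro)
  show ?thesis
    unfolding gr_def g0f_def sharp_def \<omega>_def W_def lam_def L_def \<phi>_def \<psi>_def Lt_def
    using W.bracket_L_L W.bracket_L_ph W.bracket_ph_L W.bracket_L_ps W.bracket_ps_L W.bracket_ph_ph
      W.bracket_ph_ps W.bracket_ps_ph W.bracket_ps_ps W.energy_momentum_L
    by (auto simp: primary_of_weight_def W.ph_W W.ps_W)
qed

end
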